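(* Let $\varphi=\Phi I\in H^\infty$, where $I$ is inner and $\Phi$ is outer, and suppose that $|\varphi|$ is continuous but not constant on $\mathbb{T}$. Then $\varphi$ is saturated if and only if $L_\Phi^+(1)\cap\sigma(I)\neq\emptyset$.
   Context: $\mathbb{T}$ is the unit circle with normalized Lebesgue measure; $H^p$ ($1\le p\le\infty$) is the subspace of $L^p(\mathbb{T})$ of functions with Fourier coefficients supported on $\{0,1,2,\dots\}$, and $H^\infty_0$ is the subspace of $H^\infty$ of functions vanishing at the origin. A function $\varphi\in H^\infty$ is saturated if $\|\varphi\|_\infty = \inf_{f\in H^\infty_0}\|\varphi-\overline{f}\|_\infty$. Every $\varphi \in H^\infty$ factors as $\varphi=\Phi I$ with $I$ inner ($|I|=1$ a.e. on $\mathbb{T}$) and $\Phi$ outer, $|\Phi|=|\varphi|$ a.e. on $\mathbb{T}$. For a bounded function $\psi$ and $0\le\delta\le1$, the super-level set is $L_\psi^+(\delta)=\{e^{i\theta}\in\mathbb{T}: |\psi(e^{i\theta})|\ge \|\psi\|_\infty\delta\}$. Writing an inner function $I=BS$ with $B$ a Blaschke product and $S$ a singular inner function, the spectrum $\sigma(I)\subseteq\mathbb{T}$ is the union of the set of accumulation points of the zeros of $B$ and the support of the singular measure associated with $S$. *)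

theory Defs
  imports "HOL-Probability.Probability"
begin

definition circle_meas :: "complex measure" where
  "circle_meas = distr (density (restrict_space lborel {0..<2*pi}) (\<lambda>_. ennreal (1/(2*pi))))
                       borel cis"

definition Hinf :: "(complex \<Rightarrow> complex) set" where
  "Hinf = {f. f holomorphic_on ball 0 1 \<and> bounded (f ` ball 0 1)}"

definition Hinf0 :: "(complex \<Rightarrow> complex) set" where
  "Hinf0 = {f \<in> Hinf. f 0 = 0}"

definition bdry :: "(complex \<Rightarrow> complex) \<Rightarrow> complex \<Rightarrow> complex" where
  "bdry f \<zeta> = (if (\<exists>L. ((\<lambda>r::real. f (of_real r * \<zeta>)) \<longlongrightarrow> L) (at_left 1))
               then Lim (at_left 1) (\<lambda>r::real. f (of_real r * \<zeta>)) else 0)"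

definition linf :: "(complex \<Rightarrow> complex) \<Rightarrow> real" where
  "linf g = Inf {C. C \<ge> 0 \<and> (AE \<zeta> in circle_meas. cmod (g \<zeta>) \<le> C)}"

definition saturated :: "(complex \<Rightarrow> complex) \<Rightarrow> bool" where
  "saturated \<phi> \<longleftrightarrow>
     linf (bdry \<phi>) = (INF f\<in>Hinf0. linf (\<lambda>\<zeta>. bdry \<phi> \<zeta> - cnj (bdry f \<zeta>)))"

definition inner :: "(complex \<Rightarrow> complex) \<Rightarrow> bool" where
  "inner I \<longleftrightarrow> I \<in> Hinf \<and> (AE \<zeta> in circle_meas. cmod (bdry I \<zeta>) = 1)"

definition outer :: "(complex \<Rightarrow> complex) \<Rightarrow> bool" where
  "outer F \<longleftrightarrow> (\<exists>c k. cmod c = 1 \<and> (\<forall>\<zeta>. k \<zeta> > 0) \<and>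
      integrable circle_meas (\<lambda>\<zeta>. ln (k \<zeta>)) \<and>
      (\<forall>z\<in>ball 0 1. F z = c * exp (integral\<^sup>L circle_meas
            (\<lambda>\<zeta>. (\<zeta> + z) / (\<zeta> - z) * of_real (ln (k \<zeta>))))))"

definition blaschke_factor :: "complex \<Rightarrow> complex \<Rightarrow> complex" where
  "blaschke_factor a z = (of_real (cmod a) / a) * (a - z) / (1 - cnj a * z)"

definition blaschke :: "(complex \<Rightarrow> complex) \<Rightarrow> bool" where
  "blaschke B \<longleftrightarrow> (\<exists>(m::nat) (N::nat set) (a::nat \<Rightarrow> complex).
      (\<forall>n\<in>N. a n \<noteq> 0 \<and> cmod (a n) < 1) \<and>
      summable (\<lambda>n. if n \<in> N then 1 - cmod (a n) else 0) \<and>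
      (\<forall>z\<in>ball 0 1. B z = z ^ m * (\<Prod>n. if n \<in> N then blaschke_factor (a n) z else 1)))"

definition singular_measure :: "complex measure \<Rightarrow> bool" where
  "singular_measure \<mu> \<longleftrightarrow> finite_measure \<mu> \<and> sets \<mu> = sets borel \<and>
      emeasure \<mu> (- sphere 0 1) = 0 \<and>
      (\<exists>N\<in>sets borel. emeasure circle_meas N = 0 \<and> emeasure \<mu> (- N) = 0)"

definition singular_inner :: "complex measure \<Rightarrow> complex \<Rightarrow> complex" where
  "singular_inner \<mu> z = exp (- integral\<^sup>L \<mu> (\<lambda>\<zeta>. (\<zeta> + z) / (\<zeta> - z)))"

definition measure_support :: "complex measure \<Rightarrow> complex set" where
  "measure_support \<mu> = {\<zeta>. \<forall>e>0. emeasure \<mu> (ball \<zeta> e) > 0}"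

text \<open>Spectrum of an inner function I = c B S: accumulation points of the zeros
  (of B, i.e. of I) together with the support of the singular measure of S.\<close>
definition inner_spectrum :: "(complex \<Rightarrow> complex) \<Rightarrow> complex set" where
  "inner_spectrum I =
     {\<zeta>. cmod \<zeta> = 1 \<and> \<zeta> islimpt {z\<in>ball 0 1. I z = 0}} \<union>
     {\<zeta>. \<exists>c B \<mu>. cmod c = 1 \<and> blaschke B \<and> singular_measure \<mu> \<and>
          (\<forall>z\<in>ball 0 1. I z = c * B z * singular_inner \<mu> z) \<and> \<zeta> \<in> measure_support \<mu>}"

definition superlevel :: "(complex \<Rightarrow> complex) \<Rightarrow> real \<Rightarrow> complex set" where
  "superlevel \<psi> \<delta> = {\<zeta>\<in>sphere 0 1. cmod (\<psi> \<zeta>) \<ge> linf \<psi> * \<delta>}"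

end

theory Submission
  imports Defs "HOL-Complex_Analysis.Complex_Analysis"
begin

text \<open>
  Write \<open>K\<close> for the set where \<open>h\<close> attains its maximum \<open>M\<close>. For \<open>f\<close> in \<open>Hinf0\<close> one has
  \<open>\<bar>\<phi> - cnj f\<bar>\<^sup>2 = \<bar>\<phi>\<bar>\<^sup>2 - 2 Re (\<phi> f) + \<bar>f\<bar>\<^sup>2\<close> on the circle, so \<open>\<phi>\<close> fails to be saturated exactly when
  \<open>Re (\<phi> f)\<close> is bounded below by a positive constant near \<open>K\<close> for some such \<open>f\<close>: a small multiple of \<open>f\<close>
  then pushes the norm below \<open>M\<close>.

  If \<open>K\<close> meets the spectrum of \<open>I\<close> at \<open>\<zeta>\<close>, then no \<open>f\<close> works: a lower bound for \<open>Re (\<phi> f)\<close> on an arc around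
  \<open>\<zeta>\<close> propagates into the disc by the Poisson integral, whereas \<open>I\<close>, hence \<open>\<phi> f\<close>, has lower limit \<open>0\<close> at \<open>\<zeta>\<close>.

  If \<open>K\<close> misses the spectrum, the canonical factorisation \<open>I = c B S\<close> shows that \<open>I\<close> extends analytically
  and without zeros across \<open>K\<close>. So does \<open>\<Phi> \<Psi>\<close>, where \<open>\<Psi>\<close> is outer of modulus \<open>1 / max h (M/2)\<close>. Since \<open>K\<close> is a
  proper closed subset of the circle, \<open>cnj (\<Phi> \<Psi> I)\<close> can be approximated uniformly on \<open>K\<close> by analytic
  functions \<open>p\<close> with \<open>p 0 = 0\<close>, and \<open>f = \<Psi> p\<close> has the required property.
\<close>

section \<open>The circle measure and the Poisson kernel\<close>

text \<open>The analytic functions live only in the open disc, and \<open>bdry\<close> records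
  radial limits that exist merely almost everywhere, so statements about the circle are reached
  through Poisson integrals. Two facts on finite measures carry this: a nonnegative harmonic real
  part is the Poisson integral of such a measure (Herglotz), and a measure whose Poisson integrals
  stay bounded near an open set is dominated there by a multiple of \<open>circle_meas\<close>. With
  the whole plane as open set, the second fact gives Fatou's theorem; with a small ball, it forces a
  singular inner function to be small near the support of its measure.

  Non-constancy of \<open>h\<close> is what makes \<open>K\<close> a proper subset of the circle. On
  the full circle \<open>cnj z = 1 / z\<close> is not a uniform limit of functions analytic in the
  disc; a gap in \<open>K\<close> is the door through which its pole is moved out.

  Any level strictly between \<open>0\<close> and \<open>M\<close> could replace \<open>M/2\<close>:
  the cutoff keeps \<open>\<Psi>\<close> bounded, and \<open>\<Phi> \<Psi>\<close> has modulus
  \<open>1\<close> on a whole neighbourhood of \<open>K\<close> in the circle, not only on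
  \<open>K\<close>, so the density of its Herglotz integral vanishes there.\<close>

definition angle_meas :: "real measure" where
  "angle_meas = density lborel (\<lambda>\<theta>. ennreal (1 / (2*pi)) * indicator {0..<2*pi} \<theta>)"

lemma sets_circle_meas [measurable_cong, simp]: "sets circle_meas = sets borel"
  and space_circle_meas [simp]: "space circle_meas = UNIV"
  by (simp_all add: circle_meas_def)

lemma sets_angle_meas [measurable_cong, simp]: "sets angle_meas = sets borel"
  and space_angle_meas [simp]: "space angle_meas = UNIV"
  by (simp_all add: angle_meas_def)

lemma borel_measurable_cis [measurable]: "cis \<in> borel_measurable borel"
  by (intro borel_measurable_continuous_onI continuous_intros)

text \<open>Replaces the restricted space in \<open>circle_meas\<close> by a density on the whole
  line, so that change of variables and measurability become routine.\<close>

lemma circle_meas_conv_angle_meas: "circle_meas = distr angle_meas borel cis"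
proof (rule measure_eqI)
  fix A assume "A \<in> sets circle_meas"
  then have A [measurable]: "A \<in> sets borel" by simp
  have cisA: "cis -` A \<in> sets borel"
    using measurable_sets[OF borel_measurable_cis A] by simp
  have "emeasure circle_meas A =
      emeasure (density (restrict_space lborel {0..<2*pi}) (\<lambda>_. ennreal (1/(2*pi)))) (cis -` A \<inter> {0..<2*pi})"
    unfolding circle_meas_def
    by (subst emeasure_distr) (auto simp: space_restrict_space intro!: measurable_restrict_space1)
  also have "\<dots> = (\<integral>\<^sup>+x. ennreal (1/(2*pi)) * indicator (cis -` A \<inter> {0..<2*pi}) x \<partial>restrict_space lborel {0..<2*pi})"
    using cisA by (subst emeasure_density) (auto simp: sets_restrict_space)
  also have "\<dots> = (\<integral>\<^sup>+x. ennreal (1/(2*pi)) * indicator {0..<2*pi} x * indicator (cis -` A) x \<partial>lborel)"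
    by (subst nn_integral_restrict_space) (auto intro!: nn_integral_cong simp: indicator_def)
  also have "\<dots> = emeasure (distr angle_meas borel cis) A"
    using cisA by (simp add: emeasure_distr angle_meas_def emeasure_density)
  finally show "emeasure circle_meas A = emeasure (distr angle_meas borel cis) A" .
qed simp

lemma prob_space_angle_meas: "prob_space angle_meas"
proof
  have "emeasure angle_meas (space angle_meas) = ennreal (1/(2*pi)) * ennreal (2*pi)"
    by (simp add: angle_meas_def emeasure_density nn_integral_cmult_indicator)
  also have "\<dots> = 1"
    by (subst ennreal_mult[symmetric]) auto
  finally show "emeasure angle_meas (space angle_meas) = 1" .
qed

interpretation angle_meas: prob_space angle_meas
  by (rule prob_space_angle_meas)

interpretation circle_meas: prob_space circle_meas
  unfolding circle_meas_conv_angle_meas by (intro angle_meas.prob_space_distr) simp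

lemma AE_circle_meas_norm: "AE \<zeta> in circle_meas. cmod \<zeta> = 1"
  unfolding circle_meas_conv_angle_meas by (subst AE_distr_iff) auto

lemma AE_circle_meas_sphere: "AE \<zeta> in circle_meas. \<zeta> \<in> sphere 0 1"
  using AE_circle_meas_norm by simp

text \<open>Bridge to the gauge integral over \<open>{0..2*pi}\<close>, the form in which contour
  integrals along \<open>circlepath\<close> are available.\<close>

lemma has_integral_circle_meas:
  fixes f :: "complex \<Rightarrow> 'a :: euclidean_space"
  assumes "continuous_on (sphere 0 1) f" "f \<in> borel_measurable borel"
  shows "((\<lambda>\<theta>. f (cis \<theta>)) has_integral (2*pi) *\<^sub>R integral\<^sup>L circle_meas f) {0..2*pi}"
proof -
  have c: "continuous_on {0..2*pi} (\<lambda>\<theta>. f (cis \<theta>))"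
    by (rule continuous_on_compose2[OF assms(1)]) (auto intro!: continuous_intros)
  have "integral\<^sup>L circle_meas f = integral\<^sup>L angle_meas (\<lambda>\<theta>. f (cis \<theta>))"
    unfolding circle_meas_conv_angle_meas using assms by (subst integral_distr) auto
  also have "\<dots> = (\<integral>\<theta>. (1/(2*pi)) *\<^sub>R (indicator {0..<2*pi} \<theta> *\<^sub>R f (cis \<theta>)) \<partial>lborel)"
  proof -
    have eq: "angle_meas = density lborel (\<lambda>\<theta>. ennreal (1/(2*pi) * indicator {0..<2*pi} \<theta>))"
      unfolding angle_meas_def by (rule arg_cong[of _ _ "density lborel"]) (auto simp: indicator_def)
    show ?thesis unfolding eq
      using assms by (subst integral_density) auto
  qed
  also have "\<dots> = (1/(2*pi)) *\<^sub>R (LINT \<theta>:{0..<2*pi}|lborel. f (cis \<theta>))"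
    unfolding set_lebesgue_integral_def by (rule integral_scaleR_right)
  \<comment> \<open>The half-open and the closed interval differ only in the null point
    \<open>2*pi\<close>.\<close>
  also have "(LINT \<theta>:{0..<2*pi}|lborel. f (cis \<theta>)) = (LINT \<theta>:{0..2*pi}|lborel. f (cis \<theta>))"
    unfolding set_lebesgue_integral_def
    using assms AE_lborel_singleton[of "2*pi"]
    by (intro integral_cong_AE) (auto elim!: eventually_mono simp: indicator_def)
  also have "\<dots> = integral {0..2*pi} (\<lambda>\<theta>. f (cis \<theta>))"
    by (rule set_borel_integral_eq_integral(2)) (rule borel_integrable_compact[OF _ c, folded set_integrable_def], simp)
  finally have "integral\<^sup>L circle_meas f = (1/(2*pi)) *\<^sub>R integral {0..2*pi} (\<lambda>\<theta>. f (cis \<theta>))" .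
  then have "(2*pi) *\<^sub>R integral\<^sup>L circle_meas f = integral {0..2*pi} (\<lambda>\<theta>. f (cis \<theta>))"
    by simp
  with integrable_continuous_real[OF c] show ?thesis
    by (simp add: has_integral_integral)
qed

lemma circle_meas_integrable_bounded:
  fixes f :: "complex \<Rightarrow> 'a :: {banach, second_countable_topology}"
  assumes "f \<in> borel_measurable borel" "AE \<zeta> in circle_meas. norm (f \<zeta>) \<le> B"
  shows "integrable circle_meas f"
  by (rule circle_meas.integrable_const_bound[OF assms(2)]) (use assms in simp)

text \<open>\<open>circle_meas\<close> lives on the Borel sets of the plane, so a function that is only continuous on the circle
  has to be extended by \<open>0\<close> to become measurable.\<close>
definition on_circle :: "(complex \<Rightarrow> 'a::zero) \<Rightarrow> complex \<Rightarrow> 'a" where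
  "on_circle f \<zeta> = (if cmod \<zeta> = 1 then f \<zeta> else 0)"

lemma borel_measurable_on_circle:
  fixes f :: "complex \<Rightarrow> 'a :: {real_normed_vector}"
  assumes "continuous_on (sphere 0 1) f"
  shows "on_circle f \<in> borel_measurable borel"
proof -
  have "(\<lambda>\<zeta>. if \<zeta> \<in> sphere 0 1 then f \<zeta> else 0) \<in> borel_measurable borel"
    by (rule borel_measurable_continuous_on_if) (use assms in auto)
  moreover have "(\<lambda>\<zeta>. if \<zeta> \<in> sphere 0 1 then f \<zeta> else 0) = on_circle f"
    by (auto simp: on_circle_def fun_eq_iff)
  ultimately show ?thesis by simp
qed

lemma continuous_on_on_circle:
  "continuous_on (sphere 0 1) f \<Longrightarrow> continuous_on (sphere 0 1) (on_circle f)"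
  by (subst continuous_on_cong[of _ "sphere 0 1" _ f]) (auto simp: on_circle_def)

section \<open>The Poisson kernel and the Poisson formula\<close>

definition poisson :: "complex \<Rightarrow> complex \<Rightarrow> real" where
  "poisson z \<zeta> = (1 - (cmod z)\<^sup>2) / (cmod (\<zeta> - z))\<^sup>2"

abbreviation poisson_int :: "(complex \<Rightarrow> real) \<Rightarrow> complex \<Rightarrow> real" where
  "poisson_int g z \<equiv> (\<integral>\<zeta>. poisson z \<zeta> * g \<zeta> \<partial>circle_meas)"

lemma poisson_nonneg: "cmod z \<le> 1 \<Longrightarrow> poisson z \<zeta> \<ge> 0"
  by (simp add: poisson_def power_le_one)

lemma borel_measurable_poisson [measurable (raw)]:
  assumes [measurable]: "f \<in> borel_measurable M" "g \<in> borel_measurable M"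
  shows "(\<lambda>x. poisson (f x) (g x)) \<in> borel_measurable M"
  unfolding poisson_def by measurable

lemma norm_diff_ge: "cmod \<zeta> = 1 \<Longrightarrow> cmod (\<zeta> - z) \<ge> 1 - cmod z"
  using norm_triangle_ineq2[of \<zeta> z] by simp

lemma poisson_eq_Re:
  assumes "cmod \<zeta> = 1" "z \<noteq> \<zeta>"
  shows "poisson z \<zeta> = Re ((\<zeta> + z) / (\<zeta> - z))"
proof -
  have "(\<zeta> + z) / (\<zeta> - z) = (\<zeta> + z) * cnj (\<zeta> - z) / of_real ((cmod (\<zeta> - z))\<^sup>2)"
    using complex_div_cnj[of "\<zeta> + z" "\<zeta> - z"] by (simp only: of_real_power)
  then have "Re ((\<zeta> + z) / (\<zeta> - z)) = Re ((\<zeta> + z) * cnj (\<zeta> - z)) / (cmod (\<zeta> - z))\<^sup>2"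
    by (simp only: Re_divide_of_real)
  moreover have "Re ((\<zeta> + z) * cnj (\<zeta> - z)) = (cmod \<zeta>)\<^sup>2 - (cmod z)\<^sup>2"
    unfolding cmod_power2 by (simp add: power2_eq_square algebra_simps)
  ultimately show ?thesis using assms by (simp add: poisson_def)
qed

lemma one_minus_norm_sq_le: "cmod z \<le> 1 \<Longrightarrow> 1 - (cmod z)\<^sup>2 \<le> 2 * (1 - cmod z)"
  using sum_squares_bound[of 1 "cmod z"] by (simp add: algebra_simps)

lemma poisson_le:
  assumes "cmod \<zeta> = 1" "cmod z < 1"
  shows "poisson z \<zeta> \<le> 2 / (1 - cmod z)"
proof -
  have "poisson z \<zeta> \<le> 2 * (1 - cmod z) / (1 - cmod z)\<^sup>2"
    unfolding poisson_def using assms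
    by (intro frac_le one_minus_norm_sq_le power_mono norm_diff_ge) auto
  also have "\<dots> = 2 / (1 - cmod z)" using assms by (simp add: power2_eq_square divide_simps)
  finally show ?thesis .
qed

lemma poisson_symm:
  assumes "cmod \<zeta> = 1" "cmod \<xi> = 1"
  shows "poisson (of_real r * \<zeta>) \<xi> = poisson (of_real r * \<xi>) \<zeta>"
proof -
  have "(cmod (\<xi> - of_real r * \<zeta>))\<^sup>2 = (cmod (\<zeta> - of_real r * \<xi>))\<^sup>2"
  proof -
    have a: "(Re \<zeta>)\<^sup>2 + (Im \<zeta>)\<^sup>2 = 1" "(Re \<xi>)\<^sup>2 + (Im \<xi>)\<^sup>2 = 1"
      using assms by (simp_all add: cmod_power2[symmetric])
    have "(cmod (\<xi> - of_real r * \<zeta>))\<^sup>2 - (cmod (\<zeta> - of_real r * \<xi>))\<^sup>2 =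
      (1 - r\<^sup>2) * (((Re \<xi>)\<^sup>2 + (Im \<xi>)\<^sup>2) - ((Re \<zeta>)\<^sup>2 + (Im \<zeta>)\<^sup>2))"
      unfolding cmod_power2 by (simp add: power2_eq_square algebra_simps)
    then show ?thesis using a by simp
  qed
  then show ?thesis using assms by (simp add: poisson_def norm_mult)
qed

lemma poisson_integrable:
  fixes w :: "complex \<Rightarrow> 'a::{banach, second_countable_topology}"
  assumes "AE \<zeta> in \<mu>. cmod \<zeta> = 1" "integrable \<mu> w" "sets \<mu> = sets borel" "cmod z < 1"
  shows "integrable \<mu> (\<lambda>\<zeta>. poisson z \<zeta> *\<^sub>R w \<zeta>)"
proof (rule Bochner_Integration.integrable_bound)
  show "integrable \<mu> (\<lambda>\<zeta>. (2 / (1 - cmod z)) *\<^sub>R w \<zeta>)" using assms by auto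
  have [measurable_cong]: "sets \<mu> = sets borel" by fact
  have [measurable]: "w \<in> borel_measurable \<mu>" using assms by auto
  have [measurable]: "(\<lambda>\<zeta>. \<zeta>) \<in> borel_measurable \<mu>"
    by (subst measurable_cong_sets[OF assms(3) refl]) simp
  show "(\<lambda>\<zeta>. poisson z \<zeta> *\<^sub>R w \<zeta>) \<in> borel_measurable \<mu>" by measurable
  show "AE \<zeta> in \<mu>. norm (poisson z \<zeta> *\<^sub>R w \<zeta>) \<le> norm ((2 / (1 - cmod z)) *\<^sub>R w \<zeta>)"
    using assms(1)
  proof eventually_elim
    case (elim \<zeta>)
    then show ?case using poisson_le[of \<zeta> z] poisson_nonneg[of z \<zeta>] assms
      by (simp only: norm_scaleR) (intro mult_right_mono, auto)
  qed
qed

lemma poisson_integrable_circle: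
  fixes w :: "complex \<Rightarrow> 'a::{banach, second_countable_topology}"
  shows "integrable circle_meas w \<Longrightarrow> cmod z < 1 \<Longrightarrow> integrable circle_meas (\<lambda>\<zeta>. poisson z \<zeta> *\<^sub>R w \<zeta>)"
  by (rule poisson_integrable[OF AE_circle_meas_norm]) auto

lemma compact_continuous_bounded:
  fixes f :: "'a::topological_space \<Rightarrow> 'b::real_normed_vector"
  assumes "compact S" "continuous_on S f"
  obtains B where "B > 0" "\<And>x. x \<in> S \<Longrightarrow> norm (f x) \<le> B"
  using compact_imp_bounded[OF compact_continuous_image[OF assms(2,1)]] unfolding bounded_pos by blast

lemma on_circle_integrable:
  fixes f :: "complex \<Rightarrow> 'a :: {banach, second_countable_topology}"
  assumes "continuous_on (sphere 0 1) f"
  shows "integrable circle_meas (on_circle f)"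
proof -
  obtain B where B: "\<And>x. x \<in> sphere 0 1 \<Longrightarrow> norm (f x) \<le> B"
    using compact_continuous_bounded[OF compact_sphere assms] by metis
  have "AE \<zeta> in circle_meas. norm (on_circle f \<zeta>) \<le> B"
    using AE_circle_meas_norm by eventually_elim (use B in \<open>auto simp: on_circle_def\<close>)
  then show ?thesis by (rule circle_meas_integrable_bounded[OF borel_measurable_on_circle[OF assms]])
qed

text \<open>Partial fractions, using \<open>cnj \<zeta> = 1 / \<zeta>\<close> on the circle. The
  first summand is the Cauchy kernel; the second is analytic in \<open>\<zeta>\<close> beyond the
  closed disc and vanishes at \<open>0\<close>, so its product with an analytic function has mean
  \<open>0\<close>.\<close>

lemma poisson_split:
  assumes "cmod \<zeta> = 1" "cmod z < 1"
  shows "of_real (poisson z \<zeta>) = \<zeta> / (\<zeta> - z) + cnj z * \<zeta> / (1 - cnj z * \<zeta>)"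
proof -
  have z: "\<zeta> \<noteq> 0" "\<zeta> - z \<noteq> 0" using assms by auto
  have c: "1 - cnj z * \<zeta> = \<zeta> * cnj (\<zeta> - z)"
  proof -
    have "\<zeta> * cnj \<zeta> = 1" using assms complex_norm_square[of \<zeta>] by simp
    then show ?thesis by (simp add: algebra_simps)
  qed
  have "cnj z * \<zeta> / (1 - cnj z * \<zeta>) = cnj z / cnj (\<zeta> - z)"
    unfolding c using z by simp
  moreover have "\<zeta> / (\<zeta> - z) + cnj z / cnj (\<zeta> - z) =
      (\<zeta> * cnj (\<zeta> - z) + cnj z * (\<zeta> - z)) / ((\<zeta> - z) * cnj (\<zeta> - z))"
    using z by (simp add: field_simps)
  moreover have "\<zeta> * cnj (\<zeta> - z) + cnj z * (\<zeta> - z) = of_real (1 - (cmod z)\<^sup>2)"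
    using assms complex_norm_square[of \<zeta>] complex_norm_square[of z] by (simp add: algebra_simps)
  moreover have "(\<zeta> - z) * cnj (\<zeta> - z) = of_real ((cmod (\<zeta> - z))\<^sup>2)"
    by (metis complex_norm_square of_real_power)
  ultimately show ?thesis by (simp add: poisson_def)
qed

lemma cauchy_circle_meas:
  assumes f: "f holomorphic_on ball 0 R" "R > 1" and z: "cmod z < 1"
  shows "integral\<^sup>L circle_meas (on_circle (\<lambda>\<zeta>. \<zeta> / (\<zeta> - z) * f \<zeta>)) = f z"
proof -
  have cont: "continuous_on (ball 0 R) f" using f holomorphic_on_imp_continuous_on by blast
  define F where "F = (\<lambda>\<zeta>. \<zeta> / (\<zeta> - z) * f \<zeta>)"
  have cs: "continuous_on (sphere 0 1) F" unfolding F_def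
    by (intro continuous_intros continuous_on_subset[OF cont]) (use f z in auto)
  have "((\<lambda>\<zeta>. f \<zeta> / (\<zeta> - z)) has_contour_integral 2 * of_real pi * \<i> * f z) (circlepath 0 1)"
    by (rule Cauchy_integral_circlepath)
       (use f z in \<open>auto intro: continuous_on_subset[OF cont] holomorphic_on_subset[of f "ball 0 R"]\<close>)
  then have "((\<lambda>t. f (cis t) / (cis t - z) * \<i> * cis t) has_integral 2 * of_real pi * \<i> * f z) {0..2*pi}"
    unfolding circlepath_def by (subst (asm) has_contour_integral_part_circlepath_iff) auto
  then have "((\<lambda>t. f (cis t) / (cis t - z) * \<i> * cis t * (-\<i>)) has_integral 2 * of_real pi * \<i> * f z * (-\<i>)) {0..2*pi}"
    by (rule has_integral_mult_left)
  then have 1: "((\<lambda>t. F (cis t)) has_integral 2 * of_real pi * f z) {0..2*pi}"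
    by (simp add: F_def algebra_simps)
  have "((\<lambda>t. on_circle F (cis t)) has_integral (2*pi) *\<^sub>R integral\<^sup>L circle_meas (on_circle F)) {0..2*pi}"
    by (intro has_integral_circle_meas borel_measurable_on_circle continuous_on_on_circle cs)
  then have 2: "((\<lambda>t. F (cis t)) has_integral (2*pi) *\<^sub>R integral\<^sup>L circle_meas (on_circle F)) {0..2*pi}"
    by (simp add: on_circle_def)
  show ?thesis using has_integral_unique[OF 1 2] by (simp add: scaleR_conv_of_real F_def)
qed

lemma mean_value_circle_meas:
  assumes "f holomorphic_on ball 0 R" "R > 1"
  shows "integral\<^sup>L circle_meas (on_circle f) = f 0"
proof -
  have "on_circle (\<lambda>\<zeta>. \<zeta> / (\<zeta> - 0) * f \<zeta>) = on_circle f" by (auto simp: on_circle_def)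
  then show ?thesis using cauchy_circle_meas[OF assms, of 0] by simp
qed

lemma poisson_formula:
  assumes f: "f holomorphic_on ball 0 R" "R > 1" and z: "cmod z < 1"
  shows "(\<integral>\<zeta>. poisson z \<zeta> *\<^sub>R on_circle f \<zeta> \<partial>circle_meas) = f z"
proof -
  have cont: "continuous_on (ball 0 R) f" using f holomorphic_on_imp_continuous_on by blast
  \<comment> \<open>The second summand of \<open>poisson_split\<close> has its pole at
    \<open>1 / cnj z\<close>; the radius is cut down to exclude it and still exceeds
    \<open>1\<close>.\<close>
  define R' where "R' = (if z = 0 then R else min R (1 / cmod z))"
  have R': "R' > 1" "R' \<le> R" using f z by (auto simp: R'_def field_simps)
  have nz: "1 - cnj z * \<zeta> \<noteq> 0" if "\<zeta> \<in> ball 0 R'" for \<zeta>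
  proof
    assume "1 - cnj z * \<zeta> = 0"
    then have "cmod (cnj z * \<zeta>) = 1" by (metis eq_iff_diff_eq_0 norm_one)
    then have "cmod z * cmod \<zeta> = 1" by (simp add: norm_mult)
    moreover from this have "z \<noteq> 0" by auto
    moreover have "cmod \<zeta> < 1 / cmod z" using that \<open>z \<noteq> 0\<close> by (auto simp: R'_def)
    ultimately show False by (simp add: field_simps)
  qed
  define g where "g = (\<lambda>\<zeta>. cnj z * \<zeta> / (1 - cnj z * \<zeta>) * f \<zeta>)"
  have hg: "g holomorphic_on ball 0 R'" unfolding g_def
    by (intro holomorphic_intros holomorphic_on_subset[OF f(1)]) (use nz R' in auto)
  have cg: "continuous_on (sphere 0 1) g"
    by (rule continuous_on_subset[OF holomorphic_on_imp_continuous_on[OF hg]]) (use R' in auto)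
  have c1: "continuous_on (sphere 0 1) (\<lambda>\<zeta>. \<zeta> / (\<zeta> - z) * f \<zeta>)"
    by (intro continuous_intros continuous_on_subset[OF cont]) (use f z in auto)
  have "(\<integral>\<zeta>. poisson z \<zeta> *\<^sub>R on_circle f \<zeta> \<partial>circle_meas) =
     (\<integral>\<zeta>. on_circle (\<lambda>\<zeta>. \<zeta> / (\<zeta> - z) * f \<zeta>) \<zeta> + on_circle g \<zeta> \<partial>circle_meas)"
    by (intro Bochner_Integration.integral_cong refl)
       (auto simp: on_circle_def g_def poisson_split[OF _ z] scaleR_conv_of_real ring_distribs)
  also have "\<dots> = f z + g 0"
    using on_circle_integrable[OF cg] on_circle_integrable[OF c1]
    by (simp only: Bochner_Integration.integral_add cauchy_circle_meas[OF f z] mean_value_circle_meas[OF hg R'(1)])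
  finally show ?thesis by (simp add: g_def)
qed

lemma integral_poisson:
  assumes "cmod z < 1" shows "(\<integral>\<zeta>. poisson z \<zeta> \<partial>circle_meas) = 1"
proof -
  have "(\<integral>\<zeta>. poisson z \<zeta> *\<^sub>R on_circle (\<lambda>_. 1::complex) \<zeta> \<partial>circle_meas) = 1"
    by (rule poisson_formula[of _ 2]) (use assms in auto)
  also have "(\<integral>\<zeta>. poisson z \<zeta> *\<^sub>R on_circle (\<lambda>_. 1::complex) \<zeta> \<partial>circle_meas) =
     (\<integral>\<zeta>. complex_of_real (poisson z \<zeta>) \<partial>circle_meas)"
    by (rule integral_cong_AE)
       (use borel_measurable_on_circle[of "\<lambda>_. 1::complex"] AE_circle_meas_norm
        in \<open>auto elim!: eventually_mono simp: on_circle_def scaleR_conv_of_real\<close>)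
  also have "\<dots> = complex_of_real (\<integral>\<zeta>. poisson z \<zeta> \<partial>circle_meas)"
    by (rule integral_complex_of_real)
  finally show ?thesis by (metis of_real_eq_1_iff)
qed

lemma integrable_poisson: "cmod z < 1 \<Longrightarrow> integrable circle_meas (poisson z)"
  using poisson_integrable_circle[of "\<lambda>_. 1::real" z] by simp

text \<open>The Poisson kernel at \<open>(1 - s) \<zeta>\<close> has mean \<open>1\<close> and is at
  least \<open>s / (2 s)^2 = 1 / (4 s)\<close> on the part of the circle inside the ball, so that
  part cannot have measure above \<open>4 s\<close>.\<close>

lemma measure_circle_ball_le:
  assumes "cmod \<zeta> = 1" "s > 0"
  shows "measure circle_meas (ball \<zeta> s) \<le> 4 * s"
proof (cases "s < 1")
  case False
  then show ?thesis using circle_meas.prob_le_1[of "ball \<zeta> s"] by linarith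
next
  case True
  define z where "z = of_real (1 - s) * \<zeta>"
  have nz: "cmod z = 1 - s" using True assms by (simp only: z_def norm_mult norm_of_real) simp
  have low: "1 / (4 * s) \<le> poisson z \<xi>" if "\<xi> \<in> ball \<zeta> s" "cmod \<xi> = 1" for \<xi>
  proof -
    have "cmod (\<zeta> - z) = s"
    proof -
      have "\<zeta> - z = of_real s * \<zeta>" by (simp add: z_def algebra_simps)
      then show ?thesis using assms by (simp add: norm_mult)
    qed
    then have "cmod (\<xi> - z) \<le> 2 * s"
      using that norm_triangle_ineq[of "\<xi> - \<zeta>" "\<zeta> - z"] by (simp add: dist_norm norm_minus_commute)
    moreover have "0 < cmod (\<xi> - z)" using norm_diff_ge[of \<xi> z] that nz assms by linarith
    moreover have "s \<le> 1 - (cmod z)\<^sup>2" unfolding nz using True assms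
      by (simp add: power2_eq_square algebra_simps)
    ultimately have "s / (2 * s)\<^sup>2 \<le> poisson z \<xi>"
      unfolding poisson_def using assms by (intro frac_le power_mono) auto
    then show ?thesis using assms by (simp add: power2_eq_square field_simps)
  qed
  have "measure circle_meas (ball \<zeta> s) * (1 / (4 * s)) = (\<integral>\<xi>. indicator (ball \<zeta> s) \<xi> * (1 / (4 * s)) \<partial>circle_meas)"
    by simp
  also have "\<dots> \<le> (\<integral>\<xi>. poisson z \<xi> \<partial>circle_meas)"
  proof (rule integral_mono_AE)
    show "AE \<xi> in circle_meas. indicator (ball \<zeta> s) \<xi> * (1 / (4 * s)) \<le> poisson z \<xi>"
      using AE_circle_meas_norm
      by eventually_elim (use low poisson_nonneg[of z] nz assms in \<open>auto simp: indicator_def\<close>)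
  qed (use integrable_poisson[of z] nz assms in \<open>auto simp: circle_meas.emeasure_eq_measure intro!: integrable_mult_left integrable_real_indicator simp del: times_divide_eq_right\<close>)
  also have "\<dots> = 1" using nz assms by (intro integral_poisson) auto
  finally show ?thesis using assms by (simp add: field_simps)
qed

text \<open>Where \<open>dist \<zeta> \<zeta>0 \<ge> d\<close>, a point \<open>z\<close> within
  \<open>d/2\<close> of \<open>\<zeta>0\<close> is at distance at least \<open>d/2\<close> from
  \<open>\<zeta>\<close>, so the kernel is at most \<open>4 (1 - |z|^2) / d^2\<close>. This gives
  the pointwise bound \<open>c P - e (|g| + |c|) \<le> P g\<close> on both ranges, which is then
  integrated.\<close>

lemma poisson_integral_ge:
  fixes g :: "complex \<Rightarrow> real"
  assumes g: "integrable circle_meas g" and d: "d > 0"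
    and low: "AE \<zeta> in circle_meas. dist \<zeta> \<zeta>0 < d \<longrightarrow> c \<le> g \<zeta>"
    and z: "cmod z < 1" "dist z \<zeta>0 \<le> d / 2"
  shows "poisson_int g z \<ge>
    c - (1 - (cmod z)\<^sup>2) * (4 / d\<^sup>2) * ((\<integral>\<zeta>. \<bar>g \<zeta>\<bar> \<partial>circle_meas) + \<bar>c\<bar>)"
proof -
  define e where "e = (1 - (cmod z)\<^sup>2) * (4 / d\<^sup>2)"
  have e0: "e \<ge> 0" unfolding e_def using z by (intro mult_nonneg_nonneg) (auto simp: power_le_one)
  have far: "poisson z \<zeta> \<le> e" if "dist \<zeta> \<zeta>0 \<ge> d" for \<zeta>
  proof -
    have "d / 2 \<le> cmod (\<zeta> - z)"
      using that z dist_triangle[of \<zeta> \<zeta>0 z] by (simp add: dist_norm)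
    then have "(d / 2)\<^sup>2 \<le> (cmod (\<zeta> - z))\<^sup>2" using d by (intro power_mono) auto
    then have "poisson z \<zeta> \<le> (1 - (cmod z)\<^sup>2) / (d / 2)\<^sup>2"
      unfolding poisson_def using z d by (intro divide_left_mono) (auto simp: power_le_one intro!: mult_pos_pos)
    then show ?thesis by (simp add: e_def power2_eq_square)
  qed
  have ig: "integrable circle_meas (\<lambda>\<zeta>. poisson z \<zeta> * g \<zeta>)"
    using poisson_integrable_circle[OF g z(1)] by simp
  have "c - e * ((\<integral>\<zeta>. \<bar>g \<zeta>\<bar> \<partial>circle_meas) + \<bar>c\<bar>) =
      (\<integral>\<zeta>. c * poisson z \<zeta> - e * (\<bar>g \<zeta>\<bar> + \<bar>c\<bar>) \<partial>circle_meas)"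
    using g integrable_poisson[OF z(1)] by (simp add: integral_poisson z circle_meas.prob_space[simplified])
  also have "\<dots> \<le> poisson_int g z"
  proof (rule integral_mono_AE)
    show "AE \<zeta> in circle_meas. c * poisson z \<zeta> - e * (\<bar>g \<zeta>\<bar> + \<bar>c\<bar>) \<le> poisson z \<zeta> * g \<zeta>"
      using low
    proof eventually_elim
      case (elim \<zeta>)
      have p0: "poisson z \<zeta> \<ge> 0" using poisson_nonneg z by simp
      show ?case
      proof (cases "dist \<zeta> \<zeta>0 < d")
        case True
        then have "poisson z \<zeta> * c \<le> poisson z \<zeta> * g \<zeta>" using elim p0 by (intro mult_left_mono) auto
        moreover have "e * (\<bar>g \<zeta>\<bar> + \<bar>c\<bar>) \<ge> 0" using e0 by simp
        ultimately show ?thesis by (simp add: mult.commute)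
      next
        case False
        then have "poisson z \<zeta> * (\<bar>g \<zeta>\<bar> + \<bar>c\<bar>) \<le> e * (\<bar>g \<zeta>\<bar> + \<bar>c\<bar>)"
          using far by (intro mult_right_mono) auto
        moreover have "poisson z \<zeta> * (c - g \<zeta>) \<le> poisson z \<zeta> * (\<bar>g \<zeta>\<bar> + \<bar>c\<bar>)"
          using p0 by (intro mult_left_mono) auto
        ultimately show ?thesis by (simp add: algebra_simps)
      qed
    qed
  qed (use g ig integrable_poisson[OF z(1)] in auto)
  finally show ?thesis unfolding e_def .
qed

section \<open>Radial limits of Poisson integrals\<close>

text \<open>The error term carries the factor \<open>1 - |z|^2\<close> and dies at the circle. The
  one-sided form is what the saturation argument uses, where a product is controlled only from below
  on an arc; two-sided limits follow by applying it to \<open>- g\<close> as well.\<close>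

lemma poisson_eventually_ge:
  fixes g :: "complex \<Rightarrow> real"
  assumes g: "integrable circle_meas g" and d: "d > 0" and \<zeta>0: "cmod \<zeta>0 = 1"
    and low: "AE \<zeta> in circle_meas. dist \<zeta> \<zeta>0 < d \<longrightarrow> c \<le> g \<zeta>" and c': "c' < c"
  shows "eventually (\<lambda>z. c' < poisson_int g z) (at \<zeta>0 within ball 0 1)"
proof -
  let ?C = "(4 / d\<^sup>2) * ((\<integral>\<zeta>. \<bar>g \<zeta>\<bar> \<partial>circle_meas) + \<bar>c\<bar>)"
  have "((\<lambda>z. c - (1 - (cmod z)\<^sup>2) * ?C) \<longlongrightarrow> c - (1 - (cmod \<zeta>0)\<^sup>2) * ?C) (at \<zeta>0 within ball 0 1)"
    by (intro tendsto_intros)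
  then have "eventually (\<lambda>z. c' < c - (1 - (cmod z)\<^sup>2) * ?C) (at \<zeta>0 within ball 0 1)"
    by (rule order_tendstoD(1)) (use \<zeta>0 c' in simp)
  moreover have "eventually (\<lambda>z. dist z \<zeta>0 \<le> d / 2) (at \<zeta>0 within ball 0 1)"
    unfolding eventually_at using d by (intro exI[of _ "d/2"]) auto
  moreover have "eventually (\<lambda>z. z \<in> ball 0 1) (at \<zeta>0 within ball 0 1)"
    by (simp add: eventually_at_filter)
  ultimately show ?thesis
  proof eventually_elim
    case (elim z)
    then have "cmod z < 1" by simp
    from poisson_integral_ge[OF g d low this elim(2)] elim(1) show ?case
      by (simp only: mult.assoc)
  qed
qed

lemma poisson_tendsto:
  fixes g :: "complex \<Rightarrow> real"
  assumes g: "integrable circle_meas g" and \<zeta>0: "cmod \<zeta>0 = 1"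
    and lim: "\<And>e. e > 0 \<Longrightarrow> \<exists>d>0. AE \<zeta> in circle_meas. dist \<zeta> \<zeta>0 < d \<longrightarrow> \<bar>g \<zeta> - L\<bar> \<le> e"
  shows "(poisson_int g \<longlongrightarrow> L) (at \<zeta>0 within ball 0 1)"
proof (rule order_tendstoI)
  fix a assume a: "a < L"
  obtain d where d: "d > 0" "AE \<zeta> in circle_meas. dist \<zeta> \<zeta>0 < d \<longrightarrow> \<bar>g \<zeta> - L\<bar> \<le> (L - a) / 2"
    using lim[of "(L - a) / 2"] a by auto
  show "\<forall>\<^sub>F z in at \<zeta>0 within ball 0 1. a < poisson_int g z"
  proof (rule poisson_eventually_ge[OF g d(1) \<zeta>0])
    show "AE \<zeta> in circle_meas. dist \<zeta> \<zeta>0 < d \<longrightarrow> (L + a) / 2 \<le> g \<zeta>"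
      using d(2) by eventually_elim (auto simp only: abs_le_iff field_sum_of_halves; argo)
  qed (use a in auto)
next
  fix a assume a: "L < a"
  obtain d where d: "d > 0" "AE \<zeta> in circle_meas. dist \<zeta> \<zeta>0 < d \<longrightarrow> \<bar>g \<zeta> - L\<bar> \<le> (a - L) / 2"
    using lim[of "(a - L) / 2"] a by auto
  have "\<forall>\<^sub>F z in at \<zeta>0 within ball 0 1. -a < poisson_int (\<lambda>\<zeta>. - g \<zeta>) z"
  proof (rule poisson_eventually_ge[OF _ d(1) \<zeta>0])
    show "AE \<zeta> in circle_meas. dist \<zeta> \<zeta>0 < d \<longrightarrow> - ((L + a) / 2) \<le> - g \<zeta>"
      using d(2) by eventually_elim (auto simp only: abs_le_iff field_sum_of_halves; argo)
  qed (use a g in auto)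
  then show "\<forall>\<^sub>F z in at \<zeta>0 within ball 0 1. poisson_int g z < a"
    by simp
qed

abbreviation radial_limit :: "(complex \<Rightarrow> 'a::topological_space) \<Rightarrow> complex \<Rightarrow> 'a \<Rightarrow> bool" where
  "radial_limit f \<zeta> L \<equiv> ((\<lambda>r::real. f (of_real r * \<zeta>)) \<longlongrightarrow> L) (at_left 1)"

lemma eventually_radius:
  assumes "cmod \<zeta> = 1" shows "eventually (\<lambda>r. of_real r * \<zeta> \<in> ball 0 1) (at_left (1::real))"
proof -
  have "eventually (\<lambda>r. r \<in> {0<..<1}) (at_left (1::real))" by (rule eventually_at_left_real) simp
  then show ?thesis by eventually_elim (use assms in \<open>auto simp: norm_mult\<close>)
qed

lemma filterlim_radius:
  assumes "cmod \<zeta> = 1"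
  shows "filterlim (\<lambda>r. of_real r * \<zeta>) (at \<zeta> within ball 0 1) (at_left (1::real))"
proof -
  have "radial_limit (\<lambda>z. z) \<zeta> (of_real 1 * \<zeta>)" by (intro tendsto_intros)
  moreover have "eventually (\<lambda>r. of_real r * \<zeta> \<in> ball 0 1 \<and> of_real r * \<zeta> \<noteq> \<zeta>) (at_left (1::real))"
    using eventually_radius[OF assms] by eventually_elim (use assms in auto)
  ultimately show ?thesis by (auto simp: filterlim_at elim: eventually_mono)
qed

lemma poisson_tendsto_continuous:
  fixes g :: "complex \<Rightarrow> real"
  assumes g: "continuous_on UNIV g" "integrable circle_meas g" and \<zeta>0: "cmod \<zeta>0 = 1"
  shows "radial_limit (poisson_int g) \<zeta>0 (g \<zeta>0)"
proof (rule filterlim_compose[OF poisson_tendsto[OF g(2) \<zeta>0] filterlim_radius[OF \<zeta>0]])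
  fix e :: real assume "e > 0"
  moreover have "isCont g \<zeta>0" using g(1) by (simp add: continuous_on_eq_continuous_at)
  ultimately obtain d where "d > 0" "\<And>\<zeta>. dist \<zeta> \<zeta>0 < d \<Longrightarrow> dist (g \<zeta>) (g \<zeta>0) < e"
    unfolding continuous_at_eps_delta by blast
  then show "\<exists>d>0. AE \<zeta> in circle_meas. dist \<zeta> \<zeta>0 < d \<longrightarrow> \<bar>g \<zeta> - g \<zeta>0\<bar> \<le> e"
    by (intro exI[of _ d]) (force simp: dist_real_def)
qed

section \<open>Hardy-Littlewood maximal estimates and radial limits almost everywhere\<close>

text \<open>Weak-type estimate for the maximal function, by Vitali covering: \<open>20\<close> is
  the enlargement factor \<open>5\<close> times the constant \<open>4\<close> of
  \<open>measure_circle_ball_le\<close>. An open superset of the level set is produced, which makes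
  measurability immediate.\<close>

lemma maximal_function_cover:
  fixes \<nu> :: "complex measure"
  assumes "finite_measure \<nu>" and sets [simp]: "sets \<nu> = sets borel" and L: "L > 0"
  obtains W where "open W" "{\<zeta>. cmod \<zeta> = 1 \<and> (\<exists>s>0. measure \<nu> (ball \<zeta> s) > L * s)} \<subseteq> W"
    "measure circle_meas W \<le> 20 * measure \<nu> UNIV / L"
proof -
  interpret \<nu>: finite_measure \<nu> by fact
  have sp: "space \<nu> = UNIV" using sets_eq_imp_space_eq[OF sets] by simp
  have le: "measure \<nu> A \<le> measure \<nu> UNIV" for A
    using \<nu>.bounded_measure[of A] by (simp add: sp)
  define K where "K = {(\<zeta>, s). cmod \<zeta> = 1 \<and> s > 0 \<and> measure \<nu> (ball \<zeta> s) > L * s}"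
  \<comment> \<open>Vitali covering asks for bounded radii; they are bounded here because
    \<open>\<nu>\<close> has finite mass.\<close>
  have KB: "0 < snd i \<and> snd i \<le> measure \<nu> UNIV / L" if "i \<in> K" for i
  proof -
    have "L * snd i \<le> measure \<nu> UNIV" "0 < snd i"
      using that le[of "ball (fst i) (snd i)"] by (auto simp: K_def)
    then show ?thesis using L by (simp add: field_simps)
  qed
  obtain C where C: "countable C" "C \<subseteq> K"
     "pairwise (\<lambda>i j. disjnt (ball (fst i) (snd i)) (ball (fst j) (snd j))) C"
     "{\<zeta>. cmod \<zeta> = 1 \<and> (\<exists>s>0. measure \<nu> (ball \<zeta> s) > L * s)} \<subseteq> (\<Union>i\<in>C. ball (fst i) (5 * snd i))"
  proof (rule Vitali_covering_lemma_balls[of _ fst snd K, OF _ KB])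
    show "{\<zeta>. cmod \<zeta> = 1 \<and> (\<exists>s>0. measure \<nu> (ball \<zeta> s) > L * s)} \<subseteq> (\<Union>i\<in>K. ball (fst i) (snd i))"
      by (force simp: K_def)
  qed auto
  have fin: "measure circle_meas (\<Union>i\<in>F. ball (fst i) (5 * snd i)) \<le> 20 * measure \<nu> UNIV / L"
    if F: "finite F" "F \<subseteq> C" for F
  proof -
    have "measure circle_meas (\<Union>i\<in>F. ball (fst i) (5 * snd i)) \<le> (\<Sum>i\<in>F. measure circle_meas (ball (fst i) (5 * snd i)))"
      using F by (intro measure_UNION_le) auto
    also have "\<dots> \<le> (\<Sum>i\<in>F. 20 / L * measure \<nu> (ball (fst i) (snd i)))"
    proof (rule sum_mono)
      fix i assume "i \<in> F"
      then have i: "cmod (fst i) = 1" "snd i > 0" "L * snd i < measure \<nu> (ball (fst i) (snd i))"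
        using F C by (auto simp: K_def)
      have "measure circle_meas (ball (fst i) (5 * snd i)) \<le> 20 * snd i"
        using measure_circle_ball_le[of "fst i" "5 * snd i"] i by simp
      also have "\<dots> \<le> 20 / L * measure \<nu> (ball (fst i) (snd i))"
        using i L by (simp add: field_simps)
      finally show "measure circle_meas (ball (fst i) (5 * snd i)) \<le> 20 / L * measure \<nu> (ball (fst i) (snd i))" .
    qed
    also have "\<dots> = 20 / L * (\<Sum>i\<in>F. measure \<nu> (ball (fst i) (snd i)))"
      by (simp add: sum_distrib_left)
    also have "(\<Sum>i\<in>F. measure \<nu> (ball (fst i) (snd i))) = measure \<nu> (\<Union>i\<in>F. ball (fst i) (snd i))"
    proof (rule \<nu>.finite_measure_finite_Union[symmetric])
      show "disjoint_family_on (\<lambda>i. ball (fst i) (snd i)) F"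
        unfolding disjoint_family_on_def
        using C(3) F(2) unfolding pairwise_def disjnt_def by blast
    qed (use F in auto)
    also have "20 / L * \<dots> \<le> 20 / L * measure \<nu> UNIV"
      using L by (intro mult_left_mono le) auto
    finally show ?thesis by simp
  qed
  define W where "W = (\<Union>i\<in>C. ball (fst i) (5 * snd i))"
  have "measure circle_meas W \<le> 20 * measure \<nu> UNIV / L"
  proof (cases "C = {}")
    case True
    then show ?thesis using L by (simp add: W_def)
  next
    case False
    \<comment> \<open>The additivity argument in \<open>fin\<close> is for finite subfamilies; an
      increasing exhaustion of the countable family carries its bound over to
      \<open>W\<close>.\<close>
    define A where "A n = (\<Union>i\<in>from_nat_into C ` {..<n}. ball (fst i) (5 * snd i))" for n :: nat
    have "W = (\<Union>n. A n)"
    proof -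
      have "C = from_nat_into C ` UNIV" using False C(1) by (metis range_from_nat_into)
      also have "\<dots> = (\<Union>n. from_nat_into C ` {..<n})" by blast
      finally have "C = (\<Union>n. from_nat_into C ` {..<n})" .
      then show ?thesis unfolding W_def A_def by blast
    qed
    moreover have "(\<lambda>n. measure circle_meas (A n)) \<longlonglongrightarrow> measure circle_meas (\<Union>n. A n)"
      by (rule circle_meas.finite_Lim_measure_incseq) (auto simp: A_def incseq_def, meson lessThan_iff order_less_le_trans)
    moreover have "measure circle_meas (A n) \<le> 20 * measure \<nu> UNIV / L" for n
      unfolding A_def by (rule fin) (use False in \<open>auto intro: from_nat_into\<close>)
    ultimately show ?thesis by (metis LIMSEQ_le_const2)
  qed
  then show ?thesis using C(4) by (intro that[of W]) (auto simp: W_def)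
qed

text \<open>Dominates the kernel by weighted indicators of balls whose radii double from
  \<open>1 - r\<close> upwards. The hypothesis on \<open>n\<close> makes the largest ball contain
  the whole circle.\<close>

lemma poisson_le_dyadic:
  assumes \<zeta>: "cmod \<zeta> = 1" "cmod \<xi> = 1" and r: "0 \<le> r" "r < 1" and n: "2 < 2 ^ n * (1 - r)"
  shows "poisson (of_real r * \<zeta>) \<xi> \<le> (\<Sum>k\<le>n. 32 / (4 ^ k * (1 - r)) * indicator (ball \<zeta> (2 ^ k * (1 - r))) \<xi>)"
    (is "_ \<le> sum ?t _")
proof -
  define \<delta> where "\<delta> = 1 - r"
  have \<delta>: "\<delta> > 0" using r by (simp add: \<delta>_def)
  have nr: "cmod (of_real r * \<zeta>) = r" using r \<zeta> by (simp add: norm_mult)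
  define P where "P k \<longleftrightarrow> dist \<zeta> \<xi> < 2 ^ k * \<delta>" for k
  have "dist \<zeta> \<xi> \<le> 2" using norm_triangle_ineq4[of \<zeta> \<xi>] \<zeta> by (simp add: dist_norm)
  then have Pn: "P n" using n by (simp add: P_def \<delta>_def)
  \<comment> \<open>Minimality of \<open>k = Suc j\<close> gives
    \<open>dist \<zeta> \<xi> \<ge> 2^j \<delta>\<close>, hence distance at least
    \<open>2^j \<delta> / 2\<close> from \<open>r \<zeta>\<close>, and the kernel is at most
    \<open>8 / (4^j \<delta>) = 32 / (4^k \<delta>)\<close>. One term of the sum is thus already
    enough.\<close>
  define k where "k = (LEAST k. P k)"
  have k: "P k" "k \<le> n" using LeastI[of P n] Least_le[of P n] Pn by (auto simp: k_def)
  have "poisson (of_real r * \<zeta>) \<xi> \<le> 32 / (4 ^ k * \<delta>)"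
  proof (cases k)
    case 0
    have "poisson (of_real r * \<zeta>) \<xi> \<le> 2 / \<delta>"
      using poisson_le[of \<xi> "of_real r * \<zeta>"] \<zeta> r nr by (simp add: \<delta>_def)
    also have "\<dots> \<le> 32 / \<delta>" using \<delta> by (simp add: divide_right_mono)
    finally show ?thesis using 0 by simp
  next
    case (Suc j)
    then have "\<not> P j" unfolding k_def by (metis lessI not_less_Least)
    then have dj: "2 ^ j * \<delta> \<le> dist \<zeta> \<xi>" by (simp add: P_def)
    have "cmod (\<zeta> - of_real r * \<zeta>) = \<delta>"
    proof -
      have "\<zeta> - of_real r * \<zeta> = of_real \<delta> * \<zeta>" by (simp add: \<delta>_def algebra_simps)
      then show ?thesis using \<zeta> \<delta> by (simp add: norm_mult)
    qed
    moreover have "\<delta> \<le> cmod (\<xi> - of_real r * \<zeta>)"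
      using norm_diff_ge[of \<xi> "of_real r * \<zeta>"] \<zeta> nr by (simp add: \<delta>_def)
    ultimately have "dist \<zeta> \<xi> \<le> 2 * cmod (\<xi> - of_real r * \<zeta>)"
      using norm_triangle_ineq4[of "\<zeta> - of_real r * \<zeta>" "\<xi> - of_real r * \<zeta>"] by (simp add: dist_norm)
    then have "2 ^ j * \<delta> / 2 \<le> cmod (\<xi> - of_real r * \<zeta>)" using dj by simp
    then have "(2 ^ j * \<delta> / 2)\<^sup>2 \<le> (cmod (\<xi> - of_real r * \<zeta>))\<^sup>2"
      using \<delta> by (intro power_mono) auto
    moreover have "1 - (cmod (of_real r * \<zeta>))\<^sup>2 \<le> 2 * \<delta>"
      using one_minus_norm_sq_le[of "of_real r * \<zeta>"] nr r by (simp add: \<delta>_def)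
    ultimately have "poisson (of_real r * \<zeta>) \<xi> \<le> 2 * \<delta> / (2 ^ j * \<delta> / 2)\<^sup>2"
      unfolding poisson_def using \<delta> by (intro frac_le) auto
    also have "\<dots> = 32 / (4 ^ k * \<delta>)"
    proof -
      have "(4::real) ^ j = 2 ^ j * 2 ^ j" by (simp flip: power_mult_distrib)
      then have "(2 ^ j * \<delta> / 2)\<^sup>2 = 4 ^ j * \<delta>\<^sup>2 / 4"
        by (simp add: power2_eq_square)
      then show ?thesis using \<delta> unfolding Suc by (simp add: power2_eq_square)
    qed
    finally show ?thesis .
  qed
  also have "\<dots> = ?t k" using k by (simp add: P_def \<delta>_def indicator_def)
  also have "\<dots> \<le> sum ?t {..n}"
    using k r by (intro member_le_sum) (auto intro!: mult_nonneg_nonneg divide_nonneg_nonneg)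
  finally show ?thesis .
qed

text \<open>Integrating the dyadic bound gives terms \<open>32 / (4^k (1 - r))\<close> times
  \<open>L 2^k (1 - r)\<close>, that is \<open>32 L / 2^k\<close>, a geometric series with sum below
  \<open>64 L\<close>.\<close>

lemma poisson_maximal_le:
  fixes \<nu> :: "complex measure"
  assumes "finite_measure \<nu>" and sets [simp]: "sets \<nu> = sets borel" and AE: "AE \<zeta> in \<nu>. cmod \<zeta> = 1"
    and \<zeta>: "cmod \<zeta> = 1" and r: "0 \<le> r" "r < 1"
    and max: "\<And>s. s > 0 \<Longrightarrow> measure \<nu> (ball \<zeta> s) \<le> L * s"
  shows "(\<integral>\<xi>. poisson (of_real r * \<zeta>) \<xi> \<partial>\<nu>) \<le> 64 * L"
proof -
  interpret \<nu>: finite_measure \<nu> by fact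
  have L0: "L \<ge> 0" using max[of 1] measure_nonneg[of \<nu> "ball \<zeta> 1"] by linarith
  obtain n where "2 / (1 - r) < 2 ^ n" using real_arch_pow[of 2 "2 / (1 - r)"] by auto
  then have n: "2 < 2 ^ n * (1 - r)" using r by (simp add: field_simps)
  have "(\<integral>\<xi>. poisson (of_real r * \<zeta>) \<xi> \<partial>\<nu>) \<le>
    (\<integral>\<xi>. (\<Sum>k\<le>n. 32 / (4 ^ k * (1 - r)) * indicator (ball \<zeta> (2 ^ k * (1 - r))) \<xi>) \<partial>\<nu>)"
  proof (rule integral_mono_AE)
    show "integrable \<nu> (poisson (of_real r * \<zeta>))"
      using poisson_integrable[OF AE, of "\<lambda>_. 1::real" "of_real r * \<zeta>"] \<zeta> r by (simp add: norm_mult)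
    show "AE \<xi> in \<nu>. poisson (of_real r * \<zeta>) \<xi> \<le> (\<Sum>k\<le>n. 32 / (4 ^ k * (1 - r)) * indicator (ball \<zeta> (2 ^ k * (1 - r))) \<xi>)"
      using AE by eventually_elim (intro poisson_le_dyadic \<zeta> r n)
  qed (auto simp: \<nu>.emeasure_eq_measure intro!: Bochner_Integration.integrable_sum integrable_mult_right integrable_real_indicator)
  also have "\<dots> = (\<Sum>k\<le>n. 32 / (4 ^ k * (1 - r)) * measure \<nu> (ball \<zeta> (2 ^ k * (1 - r))))"
    by (subst Bochner_Integration.integral_sum)
       (auto simp: \<nu>.emeasure_eq_measure intro!: integrable_mult_right integrable_real_indicator)
  also have "\<dots> \<le> (\<Sum>k\<le>n. 32 / (4 ^ k * (1 - r)) * (L * (2 ^ k * (1 - r))))"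
    using r by (intro sum_mono mult_left_mono max) auto
  also have "\<dots> = (\<Sum>k\<le>n. 32 * L * (1/2) ^ k)"
  proof (rule sum.cong)
    fix k :: nat
    have "(4::real) ^ k = 2 ^ k * 2 ^ k" by (simp flip: power_mult_distrib)
    then show "32 / (4 ^ k * (1 - r)) * (L * (2 ^ k * (1 - r))) = 32 * L * (1/2) ^ k"
      using r by (simp add: field_simps)
  qed simp
  also have "\<dots> = 32 * L * (\<Sum>k\<le>n. (1/2) ^ k)" by (simp add: sum_distrib_left)
  also have "\<dots> \<le> 32 * L * 2"
  proof (rule mult_left_mono)
    have "(\<Sum>k\<le>n. (1/2::real) ^ k) \<le> (\<Sum>k. (1/2) ^ k)"
      by (intro sum_le_suminf) auto
    then show "(\<Sum>k\<le>n. (1/2::real) ^ k) \<le> 2" by (simp add: suminf_geometric)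
  qed (use L0 in auto)
  finally show ?thesis by simp
qed

text \<open>For an indicator, regularity squeezes \<open>A\<close> between a compact and an open set
  of nearly equal measure, and a Urysohn function between the two differs from the indicator only on
  their difference. Sums and dominated limits extend this to all integrable functions.\<close>

lemma circle_L1_continuous_dense:
  fixes g :: "complex \<Rightarrow> real"
  assumes "integrable circle_meas g" "e > 0"
  shows "\<exists>c. continuous_on UNIV c \<and> integrable circle_meas c \<and> (\<integral>\<zeta>. \<bar>g \<zeta> - c \<zeta>\<bar> \<partial>circle_meas) < e"
  using assms
proof (induction arbitrary: e rule: integrable_induct)
  case (base A a)
  then have A: "A \<in> sets borel" by simp
  \<comment> \<open>The final error is at most \<open>2 \<eta> |a|\<close>; the \<open>+ 1\<close>
    keeps the quotient defined for \<open>a = 0\<close> and the estimate strict.\<close>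
  define \<eta> where "\<eta> = e / (2 * (\<bar>a\<bar> + 1))"
  have \<eta>: "\<eta> > 0" using base by (simp add: \<eta>_def)
  have fin: "emeasure circle_meas (space circle_meas) \<noteq> \<infinity>" by simp
  obtain K where K: "K \<subseteq> A" "compact K" "measure circle_meas A < measure circle_meas K + \<eta>"
  proof -
    have lt: "emeasure circle_meas A < (SUP K\<in>{K. K \<subseteq> A \<and> compact K}. emeasure circle_meas K) + ennreal \<eta>"
      using inner_regular[OF sets_circle_meas fin A] \<eta>
      by (metis circle_meas.emeasure_eq_measure ennreal_less_top ennreal_add_left_cancel_less ennreal_less_zero_iff add.right_neutral infinity_ennreal_def less_irrefl top.not_eq_extremum)
    then obtain K where "K \<subseteq> A" "compact K" "emeasure circle_meas A < emeasure circle_meas K + ennreal \<eta>"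
    proof -
      have "(SUP K\<in>{K. K \<subseteq> A \<and> compact K}. emeasure circle_meas K) + ennreal \<eta>
          = (SUP K\<in>{K. K \<subseteq> A \<and> compact K}. emeasure circle_meas K + ennreal \<eta>)"
        by (intro ennreal_SUP_add_left[symmetric]) auto
      then show thesis using that lt by (auto simp: less_SUP_iff)
    qed
    then show thesis using that \<eta>
      by (simp add: circle_meas.emeasure_eq_measure ennreal_less_iff flip: ennreal_plus)
  qed
  obtain U where U: "A \<subseteq> U" "open U" "measure circle_meas U < measure circle_meas A + \<eta>"
  proof -
    have "(INF U\<in>{U. A \<subseteq> U \<and> open U}. emeasure circle_meas U) < emeasure circle_meas A + ennreal \<eta>"
      using outer_regular[OF sets_circle_meas fin A] \<eta>
      by (metis circle_meas.emeasure_eq_measure ennreal_less_top ennreal_add_left_cancel_less ennreal_less_zero_iff add.right_neutral infinity_ennreal_def less_irrefl top.not_eq_extremum)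
    then obtain U where "A \<subseteq> U" "open U" "emeasure circle_meas U < emeasure circle_meas A + ennreal \<eta>"
      by (auto simp: INF_less_iff)
    then show thesis using that \<eta>
      by (simp add: circle_meas.emeasure_eq_measure ennreal_less_iff flip: ennreal_plus)
  qed
  obtain f :: "complex \<Rightarrow> real" where f: "continuous_on UNIV f" "\<And>x. f x \<in> closed_segment 1 0"
     "\<And>x. x \<in> K \<Longrightarrow> f x = 1" "\<And>x. x \<in> - U \<Longrightarrow> f x = 0"
    by (rule Urysohn[of K "- U" 1 0]) (use K U in \<open>auto intro: compact_imp_closed\<close>)
  have f01: "0 \<le> f x" "f x \<le> 1" for x using f(2)[of x] by (auto simp: closed_segment_eq_real_ivl)
  have [measurable]: "f \<in> borel_measurable borel" by (rule borel_measurable_continuous_onI[OF f(1)])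
  have if': "integrable circle_meas f"
    by (rule circle_meas_integrable_bounded[where B=1]) (use f01 in auto)
  have [measurable]: "K \<in> sets borel" "U \<in> sets borel" "A \<in> sets borel" using K U A by (auto intro: borel_compact)
  have "(\<integral>\<zeta>. \<bar>indicator A \<zeta> *\<^sub>R a - a * f \<zeta>\<bar> \<partial>circle_meas) \<le> (\<integral>\<zeta>. \<bar>a\<bar> * indicator (U - K) \<zeta> \<partial>circle_meas)"
  proof (rule integral_mono)
    fix \<zeta>
    have "\<bar>indicator A \<zeta> *\<^sub>R a - a * f \<zeta>\<bar> = \<bar>a\<bar> * \<bar>indicator A \<zeta> - f \<zeta>\<bar>"
      by (simp add: abs_mult[symmetric] algebra_simps)
    also have "\<bar>indicator A \<zeta> - f \<zeta>\<bar> \<le> indicator (U - K) \<zeta>"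
      using f(3,4)[of \<zeta>] f01[of \<zeta>] K(1) U(1) by (auto simp: indicator_def)
    finally show "\<bar>indicator A \<zeta> *\<^sub>R a - a * f \<zeta>\<bar> \<le> \<bar>a\<bar> * indicator (U - K) \<zeta>"
      by (simp add: mult_left_mono)
  qed (use if' in \<open>auto simp: circle_meas.emeasure_eq_measure\<close>)
  also have "\<dots> = \<bar>a\<bar> * measure circle_meas (U - K)" by simp
  also have "measure circle_meas (U - K) = measure circle_meas U - measure circle_meas K"
    using K U by (intro circle_meas.finite_measure_Diff) auto
  also have "\<bar>a\<bar> * \<dots> \<le> \<bar>a\<bar> * (2 * \<eta>)" using K U by (intro mult_left_mono) auto
  also have "\<dots> < e"
  proof -
    have "\<bar>a\<bar> * e < e * (\<bar>a\<bar> + 1)" using base by (simp add: algebra_simps)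
    then show ?thesis unfolding \<eta>_def by (simp add: field_simps)
  qed
  finally show ?case using f(1) if'
    by (intro exI[of _ "\<lambda>x. a * f x"]) (auto intro!: continuous_intros)
next
  case (add f g)
  obtain c1 where c1: "continuous_on UNIV c1" "integrable circle_meas c1" "(\<integral>\<zeta>. \<bar>f \<zeta> - c1 \<zeta>\<bar> \<partial>circle_meas) < e/2"
    using add.IH(1)[of "e/2"] add.prems by auto
  obtain c2 where c2: "continuous_on UNIV c2" "integrable circle_meas c2" "(\<integral>\<zeta>. \<bar>g \<zeta> - c2 \<zeta>\<bar> \<partial>circle_meas) < e/2"
    using add.IH(2)[of "e/2"] add.prems by auto
  have "(\<integral>\<zeta>. \<bar>(f \<zeta> + g \<zeta>) - (c1 \<zeta> + c2 \<zeta>)\<bar> \<partial>circle_meas) \<le>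
     (\<integral>\<zeta>. \<bar>f \<zeta> - c1 \<zeta>\<bar> + \<bar>g \<zeta> - c2 \<zeta>\<bar> \<partial>circle_meas)"
    by (rule integral_mono) (use add c1 c2 in auto)
  also have "\<dots> = (\<integral>\<zeta>. \<bar>f \<zeta> - c1 \<zeta>\<bar> \<partial>circle_meas) + (\<integral>\<zeta>. \<bar>g \<zeta> - c2 \<zeta>\<bar> \<partial>circle_meas)"
    by (rule Bochner_Integration.integral_add) (use add c1 c2 in auto)
  also have "\<dots> < e" using c1 c2 by simp
  finally show ?case using c1 c2
    by (intro exI[of _ "\<lambda>x. c1 x + c2 x"]) (auto intro!: continuous_intros)
next
  case (lim f s)
  have "(\<lambda>i. \<integral>\<zeta>. \<bar>s i \<zeta> - f \<zeta>\<bar> \<partial>circle_meas) \<longlonglongrightarrow> (\<integral>\<zeta>. 0 \<partial>circle_meas)"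
  \<comment> \<open>The induction rule supplies \<open>|s i| \<le> 2 |f|\<close>, whence the factor
    \<open>3\<close>.\<close>
  proof (rule integral_dominated_convergence[where w="\<lambda>\<zeta>. 3 * \<bar>f \<zeta>\<bar>"])
    show "AE \<zeta> in circle_meas. (\<lambda>i. \<bar>s i \<zeta> - f \<zeta>\<bar>) \<longlonglongrightarrow> 0"
      using lim.hyps(2) by (auto intro!: tendsto_rabs_zero simp: LIM_zero_iff)
    show "AE \<zeta> in circle_meas. norm \<bar>s i \<zeta> - f \<zeta>\<bar> \<le> 3 * \<bar>f \<zeta>\<bar>" for i
      by (rule AE_I2) (use lim.hyps(3)[of _ i] in \<open>fastforce simp: abs_le_iff\<close>)
  qed (use lim in auto)
  then have "eventually (\<lambda>i. (\<integral>\<zeta>. \<bar>s i \<zeta> - f \<zeta>\<bar> \<partial>circle_meas) < e/2) sequentially"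
    by (rule order_tendstoD(2)) (use lim in auto)
  then obtain i where i: "(\<integral>\<zeta>. \<bar>s i \<zeta> - f \<zeta>\<bar> \<partial>circle_meas) < e/2" by (auto simp: eventually_sequentially)
  obtain c where c: "continuous_on UNIV c" "integrable circle_meas c" "(\<integral>\<zeta>. \<bar>s i \<zeta> - c \<zeta>\<bar> \<partial>circle_meas) < e/2"
    using lim.IH[of "e/2" i] lim.prems by auto
  have "(\<integral>\<zeta>. \<bar>f \<zeta> - c \<zeta>\<bar> \<partial>circle_meas) \<le> (\<integral>\<zeta>. \<bar>s i \<zeta> - f \<zeta>\<bar> + \<bar>s i \<zeta> - c \<zeta>\<bar> \<partial>circle_meas)"
    by (rule integral_mono) (use lim c in auto)
  also have "\<dots> = (\<integral>\<zeta>. \<bar>s i \<zeta> - f \<zeta>\<bar> \<partial>circle_meas) + (\<integral>\<zeta>. \<bar>s i \<zeta> - c \<zeta>\<bar> \<partial>circle_meas)"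
    by (rule Bochner_Integration.integral_add) (use lim c in auto)
  also have "\<dots> < e" using c i by simp
  finally show ?case using c by blast
qed

text \<open>Write \<open>g\<close> as a continuous \<open>c\<close> plus an error \<open>D\<close>
  that is small in the mean. The radial limit is known for \<open>c\<close>; outside
  \<open>W1\<close> the maximal function of \<open>D\<close> is small, so its Poisson integrals are
  small, and outside \<open>W2\<close> the error itself is small.\<close>

lemma poisson_radial_limit_approx:
  fixes g :: "complex \<Rightarrow> real"
  assumes g: "integrable circle_meas g" and e: "e > 0" "\<eta> > 0"
  shows "\<exists>W\<in>sets borel. measure circle_meas W \<le> \<eta> \<and>
    (\<forall>\<zeta>\<in>sphere 0 1 - W. eventually (\<lambda>r. \<bar>poisson_int g (of_real r * \<zeta>) - g \<zeta>\<bar> < e) (at_left 1))"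
proof -
  \<comment> \<open>The two exceptional sets have measure at most \<open>5120 \<tau> / e\<close> and
    \<open>4 \<tau> / e\<close>, and \<open>6000\<close> exceeds the sum of the factors. The level
    \<open>e/256\<close> used for \<open>W1\<close> becomes \<open>e/4\<close> after the factor
    \<open>64\<close> of \<open>poisson_maximal_le\<close>.\<close>
  define \<tau> where "\<tau> = \<eta> * e / 6000"
  have \<tau>: "\<tau> > 0" using e by (simp add: \<tau>_def)
  obtain c where c: "continuous_on UNIV c" "integrable circle_meas c" "(\<integral>\<zeta>. \<bar>g \<zeta> - c \<zeta>\<bar> \<partial>circle_meas) < \<tau>"
    using circle_L1_continuous_dense[OF g \<tau>] by blast
  define D where "D \<zeta> = \<bar>g \<zeta> - c \<zeta>\<bar>" for \<zeta>
  have D: "integrable circle_meas D" unfolding D_def using g c by auto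
  have Dm: "D \<in> borel_measurable borel" "D \<in> borel_measurable circle_meas" using D by auto
  have D0: "D \<zeta> \<ge> 0" for \<zeta> by (simp add: D_def)
  define \<nu> where "\<nu> = density circle_meas D"
  have emU: "emeasure \<nu> UNIV = ennreal (\<integral>\<zeta>. D \<zeta> \<partial>circle_meas)"
    unfolding \<nu>_def using Dm D D0 by (simp add: emeasure_density nn_integral_eq_integral)
  have fin: "finite_measure \<nu>"
    by (rule finite_measureI) (use emU in \<open>simp add: \<nu>_def\<close>)
  have mU: "measure \<nu> UNIV < \<tau>"
    using emU c(3) D0 by (simp add: measure_def D_def integral_nonneg_AE)
  have AE\<nu>: "AE \<zeta> in \<nu>. cmod \<zeta> = 1"
    unfolding \<nu>_def using AE_circle_meas_norm Dm by (subst AE_density) auto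
  obtain W1 where W1: "open W1" "{\<zeta>. cmod \<zeta> = 1 \<and> (\<exists>s>0. measure \<nu> (ball \<zeta> s) > e/256 * s)} \<subseteq> W1"
    "measure circle_meas W1 \<le> 20 * measure \<nu> UNIV / (e/256)"
    by (rule maximal_function_cover[OF fin, of "e/256"]) (use e in \<open>auto simp: \<nu>_def\<close>)
  define W2 where "W2 = {\<zeta>. e/4 \<le> D \<zeta>}"
  have W2s: "W2 \<in> sets borel" unfolding W2_def using Dm by measurable
  have "measure circle_meas W2 \<le> (\<integral>\<zeta>. D \<zeta> \<partial>circle_meas) / (e/4)"
    using integral_Markov_inequality_measure[OF D, of UNIV "e/4"] D0 e by (simp add: W2_def)
  also have "\<dots> \<le> \<tau> / (e/4)" using c(3) e by (intro divide_right_mono) (auto simp: D_def)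
  finally have m2: "measure circle_meas W2 \<le> \<tau> / (e/4)" .
  have m1: "measure circle_meas W1 \<le> 20 * \<tau> / (e/256)"
    by (rule order_trans[OF W1(3)]) (use mU e in \<open>auto intro!: divide_right_mono\<close>)
  show ?thesis
  proof (intro bexI[of _ "W1 \<union> W2"] conjI ballI)
    show "W1 \<union> W2 \<in> sets borel" using W1 W2s by auto
    have "measure circle_meas (W1 \<union> W2) \<le> measure circle_meas W1 + measure circle_meas W2"
      using W1(1) W2s by (intro measure_Un_le) auto
    also have "\<dots> \<le> 20 * \<tau> / (e/256) + \<tau> / (e/4)" using m1 m2 by simp
    also have "\<dots> \<le> \<eta>" using e by (simp add: \<tau>_def field_simps)
    finally show "measure circle_meas (W1 \<union> W2) \<le> \<eta>" .
    fix \<zeta> assume "\<zeta> \<in> sphere 0 1 - (W1 \<union> W2)"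
    then have \<zeta>: "cmod \<zeta> = 1" "\<zeta> \<notin> W1" "D \<zeta> < e/4" by (auto simp: W2_def)
    have mx: "measure \<nu> (ball \<zeta> s) \<le> e/256 * s" if "s > 0" for s
      using \<zeta> W1(2) that by force
    have "eventually (\<lambda>r. \<bar>poisson_int c (of_real r * \<zeta>) - c \<zeta>\<bar> < e/4) (at_left 1)"
      using tendstoD[OF poisson_tendsto_continuous[OF c(1,2) \<zeta>(1)], of "e/4"] e by (simp add: dist_real_def)
    moreover have "eventually (\<lambda>r. r \<in> {0<..<1}) (at_left (1::real))"
      by (rule eventually_at_left_real) simp
    ultimately show "eventually (\<lambda>r. \<bar>poisson_int g (of_real r * \<zeta>) - g \<zeta>\<bar> < e) (at_left 1)"
    proof eventually_elim
      case (elim r)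
      have nr: "cmod (of_real r * \<zeta>) < 1" using elim \<zeta> by (simp add: norm_mult)
      define P where "P = poisson (of_real r * \<zeta>)"
      have P0: "P \<xi> \<ge> 0" for \<xi> unfolding P_def using poisson_nonneg nr by simp
      have i: "integrable circle_meas (\<lambda>\<xi>. P \<xi> * g \<xi>)" "integrable circle_meas (\<lambda>\<xi>. P \<xi> * c \<xi>)"
           "integrable circle_meas (\<lambda>\<xi>. P \<xi> * D \<xi>)"
        using poisson_integrable_circle[OF g nr] poisson_integrable_circle[OF c(2) nr]
          poisson_integrable_circle[OF D nr] by (simp_all add: P_def)
      have Pm: "P \<in> borel_measurable circle_meas" unfolding P_def by measurable
      have "\<bar>(\<integral>\<xi>. P \<xi> * g \<xi> \<partial>circle_meas) - (\<integral>\<xi>. P \<xi> * c \<xi> \<partial>circle_meas)\<bar>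
         = \<bar>\<integral>\<xi>. P \<xi> * g \<xi> - P \<xi> * c \<xi> \<partial>circle_meas\<bar>"
        using i by simp
      also have "\<dots> \<le> (\<integral>\<xi>. \<bar>P \<xi> * g \<xi> - P \<xi> * c \<xi>\<bar> \<partial>circle_meas)"
        by (rule integral_abs_bound)
      also have "\<dots> = (\<integral>\<xi>. D \<xi> * P \<xi> \<partial>circle_meas)"
        by (intro Bochner_Integration.integral_cong refl)
           (simp add: D_def P0 abs_mult right_diff_distrib[symmetric])
      also have "\<dots> = (\<integral>\<xi>. P \<xi> \<partial>\<nu>)"
        unfolding \<nu>_def using Dm Pm D0 by (subst integral_density) auto
      also have "\<dots> \<le> 64 * (e/256)" unfolding P_def
        by (rule poisson_maximal_le[OF fin _ AE\<nu> \<zeta>(1)]) (use elim mx in \<open>auto simp: \<nu>_def\<close>)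
      finally show ?case using elim(1) \<zeta>(3) unfolding D_def P_def by linarith
    qed
  qed
qed

theorem poisson_radial_limit:
  fixes g :: "complex \<Rightarrow> real"
  assumes g: "integrable circle_meas g"
  shows "AE \<zeta> in circle_meas.
    radial_limit (poisson_int g) \<zeta> (g \<zeta>)"
proof -
  let ?Q = "\<lambda>e \<zeta>. eventually (\<lambda>r. \<bar>poisson_int g (of_real r * \<zeta>) - g \<zeta>\<bar> < e) (at_left 1)"
  have ae: "AE \<zeta> in circle_meas. ?Q e \<zeta>" if "e > 0" for e
  proof -
    \<comment> \<open>For a fixed tolerance the exceptional set can be made arbitrarily small, so
      the intersection over all \<open>n\<close> is null.\<close>
    have "\<exists>W. \<forall>n::nat. W n \<in> sets borel \<and> measure circle_meas (W n) \<le> 1 / Suc n \<and> (\<forall>\<zeta>\<in>sphere 0 1 - W n. ?Q e \<zeta>)"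
      by (rule choice) (use poisson_radial_limit_approx[OF g that, of "1 / Suc _"] in auto)
    then obtain W where W: "\<And>n. W n \<in> sets borel" "\<And>n. measure circle_meas (W n) \<le> 1 / Suc n"
      "\<And>n \<zeta>. \<zeta> \<in> sphere 0 1 - W n \<Longrightarrow> ?Q e \<zeta>" by blast
    have "measure circle_meas (\<Inter>n. W n) \<le> 1 / Suc n" for n
      by (rule order_trans[OF circle_meas.finite_measure_mono W(2)[of n]]) (use W(1) in auto)
    then have "measure circle_meas (\<Inter>n. W n) \<le> 0"
      using LIMSEQ_le_const[OF LIMSEQ_inverse_real_of_nat, of "measure circle_meas (\<Inter>n. W n)"]
      by (auto simp: inverse_eq_divide)
    then have "measure circle_meas (\<Inter>n. W n) = 0" using measure_nonneg[of circle_meas] by (simp add: order_antisym)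
    then have "(\<Inter>n. W n) \<in> null_sets circle_meas"
      using W(1) by (auto simp: null_sets_def circle_meas.emeasure_eq_measure)
    then have "AE \<zeta> in circle_meas. \<zeta> \<notin> (\<Inter>n. W n)" by (rule AE_not_in)
    then show ?thesis using AE_circle_meas_sphere
      by eventually_elim (use W(3) in blast)
  qed
  have "AE \<zeta> in circle_meas. \<forall>n::nat. ?Q (1 / Suc n) \<zeta>"
    by (subst AE_all_countable) (use ae in auto)
  then show ?thesis
  proof eventually_elim
    case (elim \<zeta>)
    show ?case
    proof (rule tendstoI)
      fix e :: real assume "e > 0"
      then obtain n where n: "1 / Suc n < e" using nat_approx_posE by blast
      show "\<forall>\<^sub>F r in at_left 1. dist (poisson_int g (of_real r * \<zeta>)) (g \<zeta>) < e"
        using spec[OF elim, of n] by (rule eventually_mono) (use n in \<open>auto simp: dist_real_def\<close>)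
    qed
  qed
qed

section \<open>Herglotz integrals and the Herglotz representation\<close>

text \<open>The kernel has to be bounded only where the weight is nonzero. This is what lets
  Herglotz integrals make sense at points of the circle that the weighted measure avoids.\<close>

lemma integral_mult_bounded:
  fixes w k :: "complex \<Rightarrow> complex" and \<mu> :: "complex measure"
  assumes w: "integrable \<mu> w" and k: "k \<in> borel_measurable \<mu>"
    and B: "AE \<zeta> in \<mu>. w \<zeta> = 0 \<or> cmod (k \<zeta>) \<le> B" "B \<ge> 0"
  shows "integrable \<mu> (\<lambda>\<zeta>. k \<zeta> * w \<zeta>)"
    and "cmod (\<integral>\<zeta>. k \<zeta> * w \<zeta> \<partial>\<mu>) \<le> B * (\<integral>\<zeta>. cmod (w \<zeta>) \<partial>\<mu>)"
proof -
  have le: "AE \<zeta> in \<mu>. cmod (k \<zeta> * w \<zeta>) \<le> B * cmod (w \<zeta>)"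
    using B(1) by eventually_elim (auto simp: norm_mult intro: mult_right_mono)
  have iw: "integrable \<mu> (\<lambda>\<zeta>. B * cmod (w \<zeta>))" by (intro integrable_mult_right integrable_norm w)
  show i: "integrable \<mu> (\<lambda>\<zeta>. k \<zeta> * w \<zeta>)"
  proof (rule Bochner_Integration.integrable_bound[OF iw])
    show "(\<lambda>\<zeta>. k \<zeta> * w \<zeta>) \<in> borel_measurable \<mu>" using w k by measurable
    show "AE \<zeta> in \<mu>. cmod (k \<zeta> * w \<zeta>) \<le> norm (B * cmod (w \<zeta>))" using le B(2) by simp
  qed
  have "cmod (\<integral>\<zeta>. k \<zeta> * w \<zeta> \<partial>\<mu>) \<le> (\<integral>\<zeta>. B * cmod (w \<zeta>) \<partial>\<mu>)"
    by (rule order_trans[OF integral_norm_bound integral_mono_AE[OF integrable_norm[OF i] iw le]])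
  then show "cmod (\<integral>\<zeta>. k \<zeta> * w \<zeta> \<partial>\<mu>) \<le> B * (\<integral>\<zeta>. cmod (w \<zeta>) \<partial>\<mu>)"
    by (simp only: integral_mult_right_zero)
qed

abbreviation herglotz :: "complex measure \<Rightarrow> (complex \<Rightarrow> complex) \<Rightarrow> complex \<Rightarrow> complex" where
  "herglotz \<mu> w z \<equiv> (\<integral>\<zeta>. (\<zeta> + z) / (\<zeta> - z) * w \<zeta> \<partial>\<mu>)"

text \<open>The complement of the closed support of \<open>w\<close> times \<open>\<mu>\<close>.
  Keeping the weight separate covers both uses: \<open>w = 1\<close> with a singular measure, and
  \<open>circle_meas\<close> with a density that vanishes on an arc.\<close>

definition away :: "complex measure \<Rightarrow> (complex \<Rightarrow> complex) \<Rightarrow> complex set" where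
  "away \<mu> w = {z. \<exists>d>0. AE \<zeta> in \<mu>. w \<zeta> = 0 \<or> d \<le> dist \<zeta> z}"

lemma awayI: "d > 0 \<Longrightarrow> AE \<zeta> in \<mu>. w \<zeta> = 0 \<or> d \<le> dist \<zeta> z \<Longrightarrow> z \<in> away \<mu> w"
  by (auto simp: away_def)

lemma open_away: "open (away \<mu> w)"
  unfolding open_contains_ball
proof
  fix z assume "z \<in> away \<mu> w"
  then obtain d where d: "d > 0" "AE \<zeta> in \<mu>. w \<zeta> = 0 \<or> d \<le> dist \<zeta> z" by (auto simp: away_def)
  have "y \<in> away \<mu> w" if y: "y \<in> ball z (d/2)" for y
  proof (rule awayI)
    show "AE \<zeta> in \<mu>. w \<zeta> = 0 \<or> d/2 \<le> dist \<zeta> y"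
      using d(2)
    proof eventually_elim
      case (elim \<zeta>)
      then show ?case using y dist_triangle[of \<zeta> z y] by (auto simp: dist_commute)
    qed
  qed (use d in simp)
  then show "\<exists>e>0. ball z e \<subseteq> away \<mu> w" using d(1) by (intro exI[of _ "d/2"]) auto
qed

lemma disc_subset_away:
  assumes "AE \<zeta> in \<mu>. cmod \<zeta> = 1" shows "ball 0 1 \<subseteq> away \<mu> w"
proof
  fix z :: complex assume "z \<in> ball 0 1"
  moreover have "AE \<zeta> in \<mu>. w \<zeta> = 0 \<or> 1 - cmod z \<le> dist \<zeta> z"
    using assms by eventually_elim (use norm_diff_ge in \<open>auto simp: dist_norm\<close>)
  ultimately show "z \<in> away \<mu> w" by (intro awayI[of "1 - cmod z"]) auto
qed

lemma herglotz_kernel_integrable: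
  assumes w: "integrable \<mu> w" and sets: "sets \<mu> = sets borel" and AE: "AE \<zeta> in \<mu>. cmod \<zeta> = 1"
    and z: "z \<in> away \<mu> w"
  shows "integrable \<mu> (\<lambda>\<zeta>. (\<zeta> + z) / (\<zeta> - z) * w \<zeta>)"
proof -
  obtain d where d: "d > 0" "AE \<zeta> in \<mu>. w \<zeta> = 0 \<or> d \<le> dist \<zeta> z" using z by (auto simp: away_def)
  have [measurable_cong]: "sets \<mu> = sets borel" by fact
  have "AE \<zeta> in \<mu>. w \<zeta> = 0 \<or> cmod ((\<zeta> + z) / (\<zeta> - z)) \<le> (1 + cmod z) / d"
    using d(2) AE
  proof eventually_elim
    case (elim \<zeta>)
    have "cmod ((\<zeta> + z) / (\<zeta> - z)) \<le> (1 + cmod z) / d" if "d \<le> dist \<zeta> z"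
      unfolding norm_divide using that d(1) elim(2) norm_triangle_ineq[of \<zeta> z]
      by (intro frac_le) (auto simp: dist_norm)
    then show ?case using elim(1) by blast
  qed
  then show ?thesis by (intro integral_mult_bounded(1)[OF w]) (use d in \<open>measurable, auto\<close>)
qed

text \<open>Differentiation under the integral, with an explicit remainder of order
  \<open>h\<close>. The domain \<open>away\<close> reaches across arcs of the circle, which provides
  the analytic continuations needed later.\<close>

theorem herglotz_holomorphic:
  assumes w: "integrable \<mu> w" and sets: "sets \<mu> = sets borel" and AE: "AE \<zeta> in \<mu>. cmod \<zeta> = 1"
  shows "herglotz \<mu> w holomorphic_on away \<mu> w"
proof -
  have [measurable_cong]: "sets \<mu> = sets borel" by fact
  have [measurable]: "w \<in> borel_measurable \<mu>" using w by auto
  have "(herglotz \<mu> w has_field_derivative (\<integral>\<zeta>. 2 * \<zeta> / (\<zeta> - z)\<^sup>2 * w \<zeta> \<partial>\<mu>)) (at z)" if z: "z \<in> away \<mu> w" for z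
  proof -
    obtain d where d: "d > 0" "AE \<zeta> in \<mu>. w \<zeta> = 0 \<or> d \<le> dist \<zeta> z" using z by (auto simp: away_def)
    obtain e0 where e0: "e0 > 0" "ball z e0 \<subseteq> away \<mu> w" using open_away z by (meson open_contains_ball)
    define e where "e = min e0 (d/2)"
    have e: "e > 0" using d e0 by (simp add: e_def)
    have int2: "integrable \<mu> (\<lambda>\<zeta>. 2 * \<zeta> / (\<zeta> - z)\<^sup>2 * w \<zeta>)"
    proof (rule integral_mult_bounded(1)[OF w])
      show "AE \<zeta> in \<mu>. w \<zeta> = 0 \<or> cmod (2 * \<zeta> / (\<zeta> - z)\<^sup>2) \<le> 2 / d\<^sup>2"
        using d(2) AE
      proof eventually_elim
        case (elim \<zeta>)
        have "cmod (2 * \<zeta> / (\<zeta> - z)\<^sup>2) \<le> 2 / d\<^sup>2" if "d \<le> dist \<zeta> z"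
          unfolding norm_divide norm_power norm_mult using that d elim(2)
          by (intro frac_le power_mono) (auto simp: dist_norm)
        then show ?case using elim(1) by blast
      qed
    qed (use d in auto)
    have bound: "cmod ((herglotz \<mu> w (z + h) - herglotz \<mu> w z) / h - (\<integral>\<zeta>. 2 * \<zeta> / (\<zeta> - z)\<^sup>2 * w \<zeta> \<partial>\<mu>))
        \<le> cmod h * (4 / d ^ 3) * (\<integral>\<zeta>. cmod (w \<zeta>) \<partial>\<mu>)"
      if h: "cmod h < e" "h \<noteq> 0" for h
    proof -
      let ?k = "\<lambda>\<zeta>. ((\<zeta> + (z + h)) / (\<zeta> - (z + h)) - (\<zeta> + z) / (\<zeta> - z)) / h - 2 * \<zeta> / (\<zeta> - z)\<^sup>2"
      have "z + h \<in> away \<mu> w" using h e0 by (intro subsetD[OF e0(2)]) (simp add: e_def dist_norm)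
      note int1 = herglotz_kernel_integrable[OF w sets AE this] herglotz_kernel_integrable[OF w sets AE z]
      have eq: "(herglotz \<mu> w (z + h) - herglotz \<mu> w z) / h - (\<integral>\<zeta>. 2 * \<zeta> / (\<zeta> - z)\<^sup>2 * w \<zeta> \<partial>\<mu>) = (\<integral>\<zeta>. ?k \<zeta> * w \<zeta> \<partial>\<mu>)"
        using int1 int2 by (simp only: left_diff_distrib times_divide_eq_left[of _ h] Bochner_Integration.integral_diff
            integrable_divide Bochner_Integration.integrable_diff integral_divide_zero)
      show ?thesis unfolding eq
      proof (rule integral_mult_bounded(2)[OF w])
        show "AE \<zeta> in \<mu>. w \<zeta> = 0 \<or> cmod (?k \<zeta>) \<le> cmod h * (4 / d ^ 3)"
          using d(2) AE
        proof eventually_elim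
          case (elim \<zeta>)
          have "cmod (?k \<zeta>) \<le> cmod h * (4 / d ^ 3)" if "d \<le> dist \<zeta> z"
          proof -
            define p where "p = \<zeta> - z"
            have a: "d \<le> cmod p" using that by (simp add: p_def dist_norm)
            then have b: "d / 2 \<le> cmod (p - h)"
              using h norm_triangle_ineq2[of p h] by (simp add: e_def)
            have nz: "p \<noteq> 0" "p - h \<noteq> 0" using a b d by auto
            \<comment> \<open>In terms of \<open>p\<close> the kernel is
              \<open>2 \<zeta> / p - 1\<close>, so only the difference quotient of the reciprocal
              has to be estimated.\<close>
            have "((2 * \<zeta> - p + h) / (p - h) - (2 * \<zeta> - p) / p) / h - 2 * \<zeta> / p\<^sup>2 = 2 * \<zeta> * h / ((p - h) * p\<^sup>2)"
              using nz h by (simp add: divide_simps power2_eq_square) (simp add: algebra_simps)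
            moreover have "2 * \<zeta> - p + h = \<zeta> + (z + h)" "p - h = \<zeta> - (z + h)" "2 * \<zeta> - p = \<zeta> + z"
              by (simp_all add: p_def)
            ultimately have "?k \<zeta> = 2 * \<zeta> * h / ((p - h) * p\<^sup>2)" by (simp only: p_def)
            also have "cmod \<dots> \<le> 2 * cmod h / (d / 2 * d\<^sup>2)"
              unfolding norm_divide norm_mult norm_power using a b d elim(2)
              by (intro frac_le mult_mono power_mono) auto
            also have "\<dots> = cmod h * (4 / d ^ 3)"
              by (simp add: power2_eq_square power3_eq_cube mult.commute mult.assoc)
            finally show ?thesis .
          qed
          then show ?case using elim(1) by blast
        qed
      qed (use d in auto)
    qed
    define C where "C = (4 / d ^ 3) * (\<integral>\<zeta>. cmod (w \<zeta>) \<partial>\<mu>)"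
    have "((\<lambda>h. (herglotz \<mu> w (z + h) - herglotz \<mu> w z) / h - (\<integral>\<zeta>. 2 * \<zeta> / (\<zeta> - z)\<^sup>2 * w \<zeta> \<partial>\<mu>)) \<longlongrightarrow> 0) (at 0)"
    proof (rule Lim_null_comparison)
      show "eventually (\<lambda>h. cmod ((herglotz \<mu> w (z + h) - herglotz \<mu> w z) / h -
          (\<integral>\<zeta>. 2 * \<zeta> / (\<zeta> - z)\<^sup>2 * w \<zeta> \<partial>\<mu>)) \<le> cmod h * C) (at 0)"
        unfolding eventually_at C_def using e bound[unfolded mult.assoc] by (intro exI[of _ e]) auto
      have "((\<lambda>h. cmod h * C) \<longlongrightarrow> cmod 0 * C) (at 0)" by (intro tendsto_intros)
      then show "((\<lambda>h. cmod h * C) \<longlongrightarrow> 0) (at (0::complex))" by simp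
    qed
    then show ?thesis unfolding DERIV_def by (simp add: LIM_zero_iff)
  qed
  then show ?thesis unfolding holomorphic_on_open[OF open_away] by blast
qed

section \<open>The Herglotz representation\<close>

lemma integral_circle_angle:
  fixes g :: "complex \<Rightarrow> 'a :: {banach, second_countable_topology}"
  assumes "g \<in> borel_measurable borel"
  shows "integral\<^sup>L circle_meas g = (\<integral>\<theta>. g (cis \<theta>) \<partial>angle_meas)"
  unfolding circle_meas_conv_angle_meas using assms by (subst integral_distr) auto

text \<open>\<open>f\<close> itself may have no values on the circle, but its dilation by
  \<open>r\<close> is analytic in the disc of radius \<open>1/r > 1\<close>, where the Poisson
  formula applies.\<close>

lemma poisson_formula_dilate:
  assumes f: "f holomorphic_on ball 0 1" and r: "0 < r" "r < 1" and z: "cmod z < 1"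
  shows "(\<integral>\<theta>. poisson z (cis \<theta>) * Re (f (of_real r * cis \<theta>)) \<partial>angle_meas) = Re (f (of_real r * z))"
proof -
  define fr where "fr = (\<lambda>\<zeta>. f (of_real r * \<zeta>))"
  have hol: "fr holomorphic_on ball 0 (1/r)"
    unfolding fr_def using r
    by (intro holomorphic_on_compose_gen[OF _ f, unfolded o_def])
       (auto intro!: holomorphic_intros simp: norm_mult field_simps)
  have cont: "continuous_on (sphere 0 1) fr"
    by (rule continuous_on_subset[OF holomorphic_on_imp_continuous_on[OF hol]]) (use r in \<open>auto simp: field_simps\<close>)
  have "(\<integral>\<zeta>. poisson z \<zeta> *\<^sub>R on_circle fr \<zeta> \<partial>circle_meas) = fr z"
    by (rule poisson_formula[OF hol _ z]) (use r in \<open>auto simp: field_simps\<close>)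
  moreover have int: "integrable circle_meas (\<lambda>\<zeta>. poisson z \<zeta> *\<^sub>R on_circle fr \<zeta>)"
    by (intro poisson_integrable_circle on_circle_integrable cont z)
  ultimately have "(\<integral>\<zeta>. Re (poisson z \<zeta> *\<^sub>R on_circle fr \<zeta>) \<partial>circle_meas) = Re (fr z)"
    by (subst integral_Re) auto
  also have "(\<integral>\<zeta>. Re (poisson z \<zeta> *\<^sub>R on_circle fr \<zeta>) \<partial>circle_meas) =
      (\<integral>\<theta>. Re (poisson z (cis \<theta>) *\<^sub>R on_circle fr (cis \<theta>)) \<partial>angle_meas)"
    by (rule integral_circle_angle)
       (use int borel_measurable_on_circle[OF cont] in measurable)
  finally show ?thesis by (simp add: on_circle_def fr_def)
qed

text \<open>The real parts of the dilates are nonnegative densities whose common mass is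
  \<open>Re (f 0)\<close> by the mean value property. A weak limit of these measures along a
  subsequence represents \<open>Re f\<close>, since for fixed \<open>z\<close> the Poisson kernel is
  a bounded continuous test function. The limit is taken on the line of angles and then pushed to
  the circle.\<close>

theorem herglotz_representation:
  assumes f: "f holomorphic_on ball 0 1" and pos: "\<And>z. z \<in> ball 0 1 \<Longrightarrow> Re (f z) \<ge> 0"
  obtains \<mu> :: "complex measure" where "finite_measure \<mu>" "sets \<mu> = sets borel"
    "emeasure \<mu> (- sphere 0 1) = 0" "AE \<zeta> in \<mu>. cmod \<zeta> = 1"
    "\<And>z. z \<in> ball 0 1 \<Longrightarrow> Re (f z) = (\<integral>\<zeta>. poisson z \<zeta> \<partial>\<mu>)"
proof -
  define r where "r n = 1 - 1 / (real n + 2)" for n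
  have r: "0 < r n" "r n < 1" for n by (auto simp: r_def field_simps)
  have rlim: "r \<longlonglongrightarrow> 1"
  proof -
    have "(\<lambda>n. 1 - 1 / (real n + 2)) \<longlonglongrightarrow> 1 - 0"
      by (intro tendsto_intros real_tendsto_divide_at_top[of _ 1] filterlim_tendsto_add_at_top[OF _ filterlim_real_sequentially, of _ 2, simplified add.commute])
    then show ?thesis by (simp add: r_def[abs_def])
  qed
  define u where "u n \<theta> = Re (f (of_real (r n) * cis \<theta>))" for n \<theta>
  have inb: "of_real (r n) * cis \<theta> \<in> ball 0 1" for n \<theta> using r[of n] by (simp add: norm_mult)
  have u0: "u n \<theta> \<ge> 0" for n \<theta> unfolding u_def by (rule pos[OF inb])
  have ucont: "continuous_on UNIV (u n)" for n
    unfolding u_def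
    by (intro continuous_intros continuous_on_compose2[OF holomorphic_on_imp_continuous_on[OF f]])
       (use inb in \<open>auto intro!: continuous_intros\<close>)
  have [measurable]: "u n \<in> borel_measurable borel" for n
    by (rule borel_measurable_continuous_onI[OF ucont])
  have form: "(\<integral>\<theta>. poisson z (cis \<theta>) * u n \<theta> \<partial>angle_meas) = Re (f (of_real (r n) * z))" if "z \<in> ball 0 1" for n z
    unfolding u_def by (rule poisson_formula_dilate[OF f r]) (use that in auto)
  have fsub: "(\<lambda>n. Re (f (of_real (r n) * z))) \<longlonglongrightarrow> Re (f z)" if "z \<in> ball 0 1" for z
  proof -
    have "(\<lambda>n. of_real (r n) * z) \<longlonglongrightarrow> of_real 1 * z" by (intro tendsto_intros rlim)
    moreover have "isCont f z"
      using f that by (metis continuous_on_eq_continuous_at holomorphic_on_imp_continuous_on open_ball)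
    ultimately show ?thesis by (intro tendsto_Re) (auto intro: isCont_tendsto_compose)
  qed
  have ubd: "\<exists>B. \<forall>\<theta>. u n \<theta> \<le> B" for n
  proof -
    have "continuous_on (cball 0 (r n)) f"
      by (rule continuous_on_subset[OF holomorphic_on_imp_continuous_on[OF f]]) (use r[of n] in auto)
    then obtain B where B: "\<And>x. x \<in> cball 0 (r n) \<Longrightarrow> cmod (f x) \<le> B"
      using compact_continuous_bounded[OF compact_cball] by metis
    have "u n \<theta> \<le> B" for \<theta>
      unfolding u_def using B[of "of_real (r n) * cis \<theta>"] r[of n] complex_Re_le_cmod[of "f (of_real (r n) * cis \<theta>)"]
      by (simp add: norm_mult)
    then show ?thesis by blast
  qed
  have uint: "integrable angle_meas (u n)" for n
  proof -
    obtain B where "\<And>\<theta>. u n \<theta> \<le> B" using ubd by blast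
    then show ?thesis by (intro angle_meas.integrable_const_bound[where B=B]) (use u0 in auto)
  qed
  define A where "A = Re (f 0)"
  have intu: "(\<integral>\<theta>. u n \<theta> \<partial>angle_meas) = A" for n
    using form[of 0 n] by (simp add: poisson_def A_def)
  have A0: "A \<ge> 0" using pos[of 0] by (simp add: A_def)
  show thesis
  proof (cases "A = 0")
    \<comment> \<open>Mass \<open>0\<close> cannot be normalised; here every nonnegative density
      \<open>u n\<close> vanishes almost everywhere and the null measure serves.\<close>
    case True
    have "AE \<theta> in angle_meas. u n \<theta> = 0" for n
      using integral_nonneg_eq_0_iff_AE[OF uint[of n]] u0 intu[of n] True by auto
    have "Re (f (of_real (r n) * z)) = 0" if "z \<in> ball 0 1" for z n
    proof -
      have "(\<integral>\<theta>. poisson z (cis \<theta>) * u n \<theta> \<partial>angle_meas) = (\<integral>\<theta>. 0 \<partial>angle_meas)"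
        by (rule integral_cong_AE) (use \<open>AE \<theta> in angle_meas. u n \<theta> = 0\<close> in \<open>auto elim: eventually_mono\<close>)
      then show ?thesis using form[OF that] by simp
    qed
    then have "Re (f z) = 0" if "z \<in> ball 0 1" for z
      using fsub[OF that] that by (simp add: LIMSEQ_const_iff)
    then show thesis
      by (intro that[of "null_measure borel"]) (auto simp: integral_null_measure intro!: finite_measureI AE_I[of _ _ UNIV])
  next
    case False
    with A0 have A: "A > 0" by simp
    \<comment> \<open>Division by \<open>A\<close> makes these probability measures, as the
      selection theorem for \<open>real_distribution\<close> demands.\<close>
    define \<mu> where "\<mu> n = density angle_meas (\<lambda>\<theta>. ennreal (u n \<theta> / A))" for n
    have sp\<mu> [simp]: "space (\<mu> n) = UNIV" "sets (\<mu> n) = sets borel" for n by (auto simp: \<mu>_def)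
    have em: "emeasure (\<mu> n) (space (\<mu> n)) = 1" for n
    proof -
      have "emeasure (\<mu> n) (space (\<mu> n)) = (\<integral>\<^sup>+\<theta>. ennreal (u n \<theta> / A) \<partial>angle_meas)"
        by (simp add: \<mu>_def emeasure_density)
      also have "\<dots> = ennreal (\<integral>\<theta>. u n \<theta> / A \<partial>angle_meas)"
        using uint u0 A by (intro nn_integral_eq_integral) auto
      also have "\<dots> = 1" using intu[of n] A by simp
      finally show ?thesis .
    qed
    have rd: "real_distribution (\<mu> n)" for n
      unfolding real_distribution_def real_distribution_axioms_def using em by (auto intro: prob_spaceI)
    interpret rd: real_distribution "\<mu> n" for n by (rule rd)
    have tight: "tight \<mu>"
      unfolding tight_def
    proof (intro conjI allI impI rd)
      fix \<epsilon> :: real assume \<epsilon>: "\<epsilon> > 0"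
      \<comment> \<open>Tightness speaks of intervals that are open on the left, so the left end
        lies below \<open>0\<close> to include the angle \<open>0\<close>.\<close>
      have "measure (\<mu> n) {-1<..2*pi} = 1" for n
      proof -
        have "AE \<theta> in angle_meas. \<theta> \<in> {-1<..2*pi}"
          unfolding angle_meas_def by (subst AE_density) (auto simp: indicator_def intro!: AE_I2)
        then have "AE \<theta> in \<mu> n. \<theta> \<in> {-1<..2*pi}"
          unfolding \<mu>_def by (subst AE_density) (auto elim: eventually_mono)
        then show ?thesis by (subst rd.prob_eq_1) auto
      qed
      then show "\<exists>a b. a < b \<and> (\<forall>n. measure (\<mu> n) {a<..b} > 1 - \<epsilon>)"
        using \<epsilon> by (intro exI[of _ "-1"] exI[of _ "2*pi"]) (auto intro: order_less_trans[of _ 0])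
    qed
    obtain s M where sM: "strict_mono (s :: nat \<Rightarrow> nat)" "real_distribution M" "weak_conv_m (\<mu> \<circ> id \<circ> s) M"
      using tight_imp_convergent_subsubsequence[OF tight strict_mono_id] by blast
    interpret M: real_distribution M by fact
    \<comment> \<open>The mass \<open>A\<close> is restored. Mass that the weak limit may have
      placed at \<open>2*pi\<close> is carried by \<open>cis\<close> to the same point as mass at
      \<open>0\<close>.\<close>
    define \<mu>' where "\<mu>' = density (distr M borel cis) (\<lambda>_. ennreal A)"
    have sets': "sets \<mu>' = sets borel" by (simp add: \<mu>'_def)
    have AE': "AE \<zeta> in \<mu>'. cmod \<zeta> = 1"
      unfolding \<mu>'_def by (subst AE_density) (auto simp: AE_distr_iff)
    have fin': "finite_measure \<mu>'"
    proof (rule finite_measureI)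
      have "emeasure \<mu>' (space \<mu>') = ennreal A * emeasure M (cis -` UNIV \<inter> space M)"
        unfolding \<mu>'_def by (simp add: emeasure_density emeasure_distr nn_integral_cmult)
      then show "emeasure \<mu>' (space \<mu>') \<noteq> \<infinity>" by (simp add: ennreal_mult_eq_top_iff)
    qed
    have sph': "emeasure \<mu>' (- sphere 0 1) = 0"
      using AE' by (subst AE_iff_measurable[symmetric, of _ _ "\<lambda>\<zeta>. cmod \<zeta> = 1"]) (auto simp: sets' \<mu>'_def)
    have rep: "Re (f z) = (\<integral>\<zeta>. poisson z \<zeta> \<partial>\<mu>')" if z: "z \<in> ball 0 1" for z
    proof -
      define P where "P \<theta> = poisson z (cis \<theta>)" for \<theta>
      have P0: "P \<theta> \<ge> 0" for \<theta> unfolding P_def using z by (intro poisson_nonneg) auto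
      have Pcont: "isCont P \<theta>" for \<theta>
      proof -
        have "continuous_on UNIV P" unfolding P_def poisson_def using z
          by (intro continuous_intros) (auto dest: arg_cong[where f=cmod])
        then show ?thesis by (simp add: continuous_on_eq_continuous_at)
      qed
      have [measurable]: "P \<in> borel_measurable borel" unfolding P_def by measurable
      have "(\<lambda>n. integral\<^sup>L ((\<mu> \<circ> id \<circ> s) n) P) \<longlonglongrightarrow> integral\<^sup>L M P"
      proof (rule weak_conv_imp_integral_bdd_continuous_conv[where B="2 / (1 - cmod z)"])
        show "norm (P \<theta>) \<le> 2 / (1 - cmod z)" for \<theta>
          using P0[of \<theta>] poisson_le[of "cis \<theta>" z] z by (simp add: P_def)
      qed (use sM rd Pcont in \<open>auto simp: o_def\<close>)
      moreover have "integral\<^sup>L (\<mu> n) P = Re (f (of_real (r n) * z)) / A" for n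
      proof -
        have "integral\<^sup>L (\<mu> n) P = (\<integral>\<theta>. (u n \<theta> / A) * P \<theta> \<partial>angle_meas)"
          unfolding \<mu>_def using u0 A by (subst integral_density) auto
        also have "\<dots> = (\<integral>\<theta>. (P \<theta> * u n \<theta>) / A \<partial>angle_meas)"
          by (simp add: mult.commute)
        also have "\<dots> = Re (f (of_real (r n) * z)) / A"
          using form[OF z, of n] by (simp add: P_def)
        finally show ?thesis .
      qed
      ultimately have "(\<lambda>n. Re (f (of_real (r (s n)) * z)) / A) \<longlonglongrightarrow> integral\<^sup>L M P" by simp
      moreover have "(\<lambda>n. Re (f (of_real (r (s n)) * z)) / A) \<longlonglongrightarrow> Re (f z) / A"
        by (intro tendsto_divide tendsto_const)
           (use LIMSEQ_subseq_LIMSEQ[OF fsub[OF z] sM(1)] A in \<open>auto simp: o_def\<close>)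
      ultimately have "integral\<^sup>L M P = Re (f z) / A" using LIMSEQ_unique by blast
      moreover have "(\<integral>\<zeta>. poisson z \<zeta> \<partial>\<mu>') = A * integral\<^sup>L M P"
        unfolding \<mu>'_def using A by (simp add: integral_density integral_distr P_def[abs_def])
      ultimately show ?thesis using A by simp
    qed
    show thesis by (rule that[OF fin' sets' sph' AE' rep])
  qed
qed

section \<open>Fatou's theorem for bounded analytic functions\<close>

lemma AE_norm_eq_1:
  assumes "sets \<mu> = sets borel" "emeasure \<mu> (- sphere (0::complex) 1) = 0"
  shows "AE \<zeta> in \<mu>. cmod \<zeta> = 1"
  by (rule AE_I[of _ _ "- sphere 0 1"]) (use assms in auto)

text \<open>By Fubini and the symmetry of the Poisson kernel, the \<open>\<mu>\<close>-integral of a continuous \<open>g\<close> is the limit for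
  \<open>r \<rightarrow> 1\<close> of the \<open>circle_meas\<close>-integrals of \<open>g \<zeta>\<close> times the Poisson integral of \<open>\<mu>\<close> at \<open>r \<zeta>\<close>.\<close>
lemma emeasure_open_le_of_poisson_le:
  fixes \<mu> :: "complex measure"
  assumes fin: "finite_measure \<mu>" and sets: "sets \<mu> = sets borel" and AE: "AE \<zeta> in \<mu>. cmod \<zeta> = 1"
    and V: "open V" and e: "e > 0" and M: "M \<ge> 0"
    and bd: "\<And>z x. z \<in> ball 0 1 \<Longrightarrow> x \<in> V \<Longrightarrow> dist x z < e \<Longrightarrow> (\<integral>\<zeta>. poisson z \<zeta> \<partial>\<mu>) \<le> M"
  shows "emeasure \<mu> V \<le> ennreal M * emeasure circle_meas V"
proof -
  interpret \<mu>: finite_measure \<mu> by fact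
  have [measurable_cong, simp]: "sets \<mu> = sets borel" by fact
  have sp: "space \<mu> = UNIV" using sets_eq_imp_space_eq[OF sets] by simp
  interpret pair_sigma_finite \<mu> circle_meas by unfold_locales
  \<comment> \<open>Besides tending to \<open>1\<close>, the radii satisfy
    \<open>1 - r n < e\<close>, so that for \<open>\<zeta>\<close> in \<open>V\<close> on the circle
    the point \<open>r n \<zeta>\<close> already lies in the range of the bound
    \<open>M\<close>.\<close>
  define r where "r n = 1 - min e 1 / (real n + 2)" for n
  have r: "0 < r n" "r n < 1" "1 - r n < e" for n
  proof -
    have "0 < min e 1 / (real n + 2)" using e by simp
    moreover have "min e 1 / (real n + 2) \<le> min e 1 / 2" using e by (intro divide_left_mono) auto
    moreover have "min e 1 / 2 < e" "min e 1 / 2 < 1" using e by auto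
    ultimately show "0 < r n" "r n < 1" "1 - r n < e" unfolding r_def by linarith+
  qed
  have rlim: "filterlim r (at_left 1) sequentially"
  proof -
    have "(\<lambda>n. 1 - min e 1 / (real n + 2)) \<longlonglongrightarrow> 1 - 0"
      by (intro tendsto_intros real_tendsto_divide_at_top[of _ "min e 1"] filterlim_tendsto_add_at_top[OF _ filterlim_real_sequentially, of _ 2, simplified add.commute])
    then have "r \<longlonglongrightarrow> 1" by (simp add: r_def[abs_def])
    then show ?thesis unfolding filterlim_at using r by (auto simp: less_imp_neq)
  qed
  have main: "(\<integral>\<^sup>+\<xi>. ennreal (g \<xi>) \<partial>\<mu>) \<le> ennreal M * emeasure circle_meas V"
    if g: "continuous_on UNIV g" "\<And>x. 0 \<le> g x" "\<And>x. g x \<le> 1" "\<And>x. x \<notin> V \<Longrightarrow> g x = 0" for g :: "complex \<Rightarrow> real"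
  proof -
    have [measurable]: "g \<in> borel_measurable borel" by (rule borel_measurable_continuous_onI[OF g(1)])
    have gi: "integrable circle_meas g"
      by (rule circle_meas_integrable_bounded[where B=1]) (use g in auto)
    define J where "J n \<xi> = (\<integral>\<^sup>+\<zeta>. ennreal (poisson (of_real (r n) * \<xi>) \<zeta> * g \<zeta>) \<partial>circle_meas)" for n \<xi>
    have [measurable]: "J n \<in> borel_measurable \<mu>" for n unfolding J_def by measurable
    have Jlim: "AE \<xi> in \<mu>. ennreal (g \<xi>) = liminf (\<lambda>n. J n \<xi>)" using AE
    proof eventually_elim
      case (elim \<xi>)
      have "J n \<xi> = ennreal (poisson_int g (of_real (r n) * \<xi>))" for n
        unfolding J_def using poisson_integrable_circle[OF gi, of "of_real (r n) * \<xi>"] r[of n] elim g(2)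
        by (intro nn_integral_eq_integral) (auto simp: norm_mult intro!: mult_nonneg_nonneg poisson_nonneg)
      moreover have "(\<lambda>n. ennreal (poisson_int g (of_real (r n) * \<xi>))) \<longlonglongrightarrow> ennreal (g \<xi>)"
        by (intro tendsto_ennrealI filterlim_compose[OF poisson_tendsto_continuous[OF g(1) gi elim] rlim])
      ultimately show ?case by (simp add: lim_imp_Liminf)
    qed
    have "(\<integral>\<^sup>+\<xi>. ennreal (g \<xi>) \<partial>\<mu>) = (\<integral>\<^sup>+\<xi>. liminf (\<lambda>n. J n \<xi>) \<partial>\<mu>)"
      by (rule nn_integral_cong_AE[OF Jlim])
    also have "\<dots> \<le> liminf (\<lambda>n. \<integral>\<^sup>+\<xi>. J n \<xi> \<partial>\<mu>)" by (rule nn_integral_liminf) measurable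
    also have "\<dots> \<le> liminf (\<lambda>n::nat. ennreal M * emeasure circle_meas V)"
    proof (rule Liminf_mono, rule always_eventually, rule allI)
      fix n
      have "(\<integral>\<^sup>+\<xi>. J n \<xi> \<partial>\<mu>) = (\<integral>\<^sup>+\<zeta>. \<integral>\<^sup>+\<xi>. ennreal (poisson (of_real (r n) * \<xi>) \<zeta> * g \<zeta>) \<partial>\<mu> \<partial>circle_meas)"
        unfolding J_def by (rule Fubini'[symmetric]) measurable
      also have "\<dots> \<le> (\<integral>\<^sup>+\<zeta>. ennreal M * indicator V \<zeta> \<partial>circle_meas)"
      proof (rule nn_integral_mono_AE)
        show "AE \<zeta> in circle_meas. (\<integral>\<^sup>+\<xi>. ennreal (poisson (of_real (r n) * \<xi>) \<zeta> * g \<zeta>) \<partial>\<mu>) \<le> ennreal M * indicator V \<zeta>"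
          using AE_circle_meas_norm
        proof eventually_elim
          case (elim \<zeta>)
          show ?case
          proof (cases "\<zeta> \<in> V")
            case False
            then show ?thesis by (simp add: g(4))
          next
            case True
            have nr: "cmod (of_real (r n) * \<zeta>) < 1" using r[of n] elim by (simp add: norm_mult)
            have "\<zeta> - of_real (r n) * \<zeta> = of_real (1 - r n) * \<zeta>" by (simp add: algebra_simps)
            then have "dist \<zeta> (of_real (r n) * \<zeta>) = 1 - r n" using elim r[of n]
              by (simp only: dist_norm norm_mult norm_of_real) simp
            then have le: "(\<integral>\<xi>. poisson (of_real (r n) * \<zeta>) \<xi> \<partial>\<mu>) \<le> M"
              using bd[of "of_real (r n) * \<zeta>" \<zeta>] True nr r[of n] by simp
            have "(\<integral>\<^sup>+\<xi>. ennreal (poisson (of_real (r n) * \<xi>) \<zeta> * g \<zeta>) \<partial>\<mu>) \<le>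
                (\<integral>\<^sup>+\<xi>. ennreal (poisson (of_real (r n) * \<zeta>) \<xi>) \<partial>\<mu>)"
            proof (rule nn_integral_mono_AE)
              show "AE \<xi> in \<mu>. ennreal (poisson (of_real (r n) * \<xi>) \<zeta> * g \<zeta>) \<le> ennreal (poisson (of_real (r n) * \<zeta>) \<xi>)"
                using AE
              proof eventually_elim
                case (elim \<xi>)
                then have "poisson (of_real (r n) * \<xi>) \<zeta> = poisson (of_real (r n) * \<zeta>) \<xi>"
                  using \<open>cmod \<zeta> = 1\<close> by (intro poisson_symm)
                moreover have "poisson (of_real (r n) * \<zeta>) \<xi> \<ge> 0" using nr by (intro poisson_nonneg) simp
                ultimately show ?case using g(2,3)[of \<zeta>] by (intro ennreal_leI) (simp add: mult_left_le)
              qed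
            qed
            also have "\<dots> = ennreal (\<integral>\<xi>. poisson (of_real (r n) * \<zeta>) \<xi> \<partial>\<mu>)"
              using poisson_integrable[OF AE, of "\<lambda>_. 1::real" "of_real (r n) * \<zeta>"] nr
              by (intro nn_integral_eq_integral) (auto intro!: poisson_nonneg)
            also have "\<dots> \<le> ennreal M" using le by (rule ennreal_leI)
            finally show ?thesis using True by simp
          qed
        qed
      qed
      also have "\<dots> = ennreal M * emeasure circle_meas V"
        using V by (subst nn_integral_cmult_indicator) auto
      finally show "(\<integral>\<^sup>+\<xi>. J n \<xi> \<partial>\<mu>) \<le> ennreal M * emeasure circle_meas V" .
    qed
    finally show ?thesis by (subst (asm) Liminf_const) auto
  qed
  have "emeasure \<mu> V = (SUP K\<in>{K. K \<subseteq> V \<and> compact K}. emeasure \<mu> K)"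
    by (rule inner_regular) (use V in \<open>auto simp: \<mu>.emeasure_eq_measure\<close>)
  also have "\<dots> \<le> ennreal M * emeasure circle_meas V"
  proof (rule SUP_least)
    fix K assume "K \<in> {K. K \<subseteq> V \<and> compact K}"
    then have K: "K \<subseteq> V" "compact K" by auto
    obtain g :: "complex \<Rightarrow> real" where g: "continuous_on UNIV g" "\<And>x. g x \<in> closed_segment 1 0"
       "\<And>x. x \<in> K \<Longrightarrow> g x = 1" "\<And>x. x \<in> - V \<Longrightarrow> g x = 0"
      by (rule Urysohn[of K "- V" 1 0]) (use K V in \<open>auto intro: compact_imp_closed\<close>)
    have g01: "0 \<le> g x" "g x \<le> 1" for x using g(2)[of x] by (auto simp: closed_segment_eq_real_ivl)
    have "emeasure \<mu> K = (\<integral>\<^sup>+\<xi>. indicator K \<xi> \<partial>\<mu>)" using borel_compact[OF K(2)] by simp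
    also have "\<dots> \<le> (\<integral>\<^sup>+\<xi>. ennreal (g \<xi>) \<partial>\<mu>)"
      by (rule nn_integral_mono) (use g(3) in \<open>auto simp: indicator_def\<close>)
    also have "\<dots> \<le> ennreal M * emeasure circle_meas V" by (rule main) (use g g01 in auto)
    finally show "emeasure \<mu> K \<le> ennreal M * emeasure circle_meas V" .
  qed
  finally show ?thesis .
qed

text \<open>Outer regularity encloses the null set in open sets of arbitrarily small
  \<open>circle_meas\<close>, to which the comparison on open sets applies. It is used with the
  whole plane to obtain densities, and with a small ball to show that a singular measure has no mass
  there.\<close>

lemma null_set_of_poisson_le:
  fixes \<mu> :: "complex measure"
  assumes fin: "finite_measure \<mu>" and sets: "sets \<mu> = sets borel" and AE: "AE \<zeta> in \<mu>. cmod \<zeta> = 1"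
    and V: "open V" and e: "e > 0" and M: "M \<ge> 0"
    and bd: "\<And>z x. z \<in> ball 0 1 \<Longrightarrow> x \<in> V \<Longrightarrow> dist x z < e \<Longrightarrow> (\<integral>\<zeta>. poisson z \<zeta> \<partial>\<mu>) \<le> M"
    and N: "N \<in> sets borel" "emeasure circle_meas N = 0" "N \<subseteq> V"
  shows "emeasure \<mu> N = 0"
proof -
  have "emeasure \<mu> N \<le> 0"
  proof (rule ennreal_le_epsilon)
    fix \<epsilon> :: real assume \<epsilon>: "\<epsilon> > 0"
    have "emeasure circle_meas N = (INF U\<in>{U. N \<subseteq> U \<and> open U}. emeasure circle_meas U)"
      by (rule outer_regular) (use N in auto)
    then have "(INF U\<in>{U. N \<subseteq> U \<and> open U}. emeasure circle_meas U) < ennreal (\<epsilon> / (M + 1))"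
      using N \<epsilon> M by simp
    then obtain U where U: "N \<subseteq> U" "open U" "emeasure circle_meas U < ennreal (\<epsilon> / (M + 1))"
      by (auto simp: INF_less_iff)
    have "emeasure \<mu> N \<le> emeasure \<mu> (U \<inter> V)" using N U V sets by (intro emeasure_mono) auto
    also have "\<dots> \<le> ennreal M * emeasure circle_meas (U \<inter> V)"
      by (rule emeasure_open_le_of_poisson_le[OF fin sets AE _ e M]) (use U V bd in auto)
    also have "\<dots> \<le> ennreal M * ennreal (\<epsilon> / (M + 1))"
      using emeasure_mono[of "U \<inter> V" U circle_meas] U V by (intro mult_left_mono) auto
    also have "\<dots> = ennreal (M * (\<epsilon> / (M + 1)))" using M \<epsilon> by (intro ennreal_mult[symmetric]) auto
    also have "\<dots> \<le> ennreal \<epsilon>" using M \<epsilon> by (intro ennreal_leI) (simp add: field_simps)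
    finally show "emeasure \<mu> N \<le> 0 + ennreal \<epsilon>" by simp
  qed
  then show ?thesis by simp
qed

lemma absolutely_continuous_real_density:
  fixes \<mu> :: "complex measure"
  assumes fin: "finite_measure \<mu>" and sets: "sets \<mu> = sets borel"
    and ac: "\<And>N. N \<in> sets borel \<Longrightarrow> emeasure circle_meas N = 0 \<Longrightarrow> emeasure \<mu> N = 0"
  obtains g :: "complex \<Rightarrow> real" where "integrable circle_meas g" "\<And>\<zeta>. g \<zeta> \<ge> 0"
    "\<mu> = density circle_meas (\<lambda>\<zeta>. ennreal (g \<zeta>))"
proof -
  interpret \<mu>: finite_measure \<mu> by fact
  have sp: "space \<mu> = UNIV" using sets_eq_imp_space_eq[OF sets] by simp
  have "absolutely_continuous circle_meas \<mu>"
    unfolding absolutely_continuous_def null_sets_def using ac sets by auto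
  then obtain w where w: "w \<in> borel_measurable circle_meas" "density circle_meas w = \<mu>"
    using circle_meas.Radon_Nikodym[of \<mu>] sets by auto
  have iw: "integral\<^sup>N circle_meas w = emeasure \<mu> UNIV"
    unfolding w(2)[symmetric] using w(1) by (simp add: emeasure_density)
  have "AE \<zeta> in circle_meas. w \<zeta> \<noteq> \<infinity>"
    by (rule nn_integral_noteq_infinite[OF w(1)]) (use iw \<mu>.emeasure_finite in auto)
  then have AEw: "AE \<zeta> in circle_meas. w \<zeta> = ennreal (enn2real (w \<zeta>))"
    by eventually_elim (simp add: less_top)
  have m: "(\<lambda>\<zeta>. enn2real (w \<zeta>)) \<in> borel_measurable circle_meas" using w(1) by measurable
  show thesis
  proof (rule that[of "\<lambda>\<zeta>. enn2real (w \<zeta>)"])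
    show "\<mu> = density circle_meas (\<lambda>\<zeta>. ennreal (enn2real (w \<zeta>)))"
      unfolding w(2)[symmetric] by (rule density_cong) (use w(1) m AEw in auto)
    show "integrable circle_meas (\<lambda>\<zeta>. enn2real (w \<zeta>))"
    proof (rule integrableI_nonneg[OF m])
      have "(\<integral>\<^sup>+\<zeta>. ennreal (enn2real (w \<zeta>)) \<partial>circle_meas) = integral\<^sup>N circle_meas w"
        by (rule nn_integral_cong_AE) (use AEw in \<open>auto elim: eventually_mono\<close>)
      then show "(\<integral>\<^sup>+\<zeta>. ennreal (enn2real (w \<zeta>)) \<partial>circle_meas) < \<infinity>"
        using iw by (simp add: \<mu>.emeasure_eq_measure)
    qed auto
  qed auto
qed

text \<open>If \<open>|f| \<le> C\<close>, then \<open>Re f + C\<close> lies between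
  \<open>0\<close> and \<open>2 C\<close>: the lower bound provides a Herglotz measure, the upper
  one makes it absolutely continuous. The shift is undone at the end because the kernel has mean
  \<open>1\<close>.\<close>

lemma Hinf_Re_poisson:
  assumes f: "f \<in> Hinf"
  obtains g :: "complex \<Rightarrow> real" where "integrable circle_meas g"
    "\<And>z. z \<in> ball 0 1 \<Longrightarrow> Re (f z) = poisson_int g z"
proof -
  have hol: "f holomorphic_on ball 0 1" using f by (simp add: Hinf_def)
  obtain C where "\<forall>x\<in>f ` ball 0 1. cmod x \<le> C" using f by (auto simp: Hinf_def bounded_iff)
  then have C: "cmod (f z) \<le> C" if "z \<in> ball 0 1" for z using that by blast
  have C0: "C \<ge> 0" using C[of 0] norm_ge_zero[of "f 0"] by (simp del: norm_ge_zero)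
  have low: "Re (f z) \<ge> - C" "Re (f z) \<le> C" if "z \<in> ball 0 1" for z
    using C[OF that] abs_Re_le_cmod[of "f z"] by auto
  obtain \<mu> where \<mu>: "finite_measure \<mu>" "sets \<mu> = sets borel" "AE \<zeta> in \<mu>. cmod \<zeta> = 1"
    "\<And>z. z \<in> ball 0 1 \<Longrightarrow> Re (f z + of_real C) = (\<integral>\<zeta>. poisson z \<zeta> \<partial>\<mu>)"
    by (rule herglotz_representation[of "\<lambda>z. f z + of_real C"])
       (use hol low in \<open>fastforce intro!: holomorphic_intros\<close>)+
  obtain g :: "complex \<Rightarrow> real" where g: "integrable circle_meas g" "\<And>\<zeta>. g \<zeta> \<ge> 0" "\<mu> = density circle_meas (\<lambda>\<zeta>. ennreal (g \<zeta>))"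
  proof (rule absolutely_continuous_real_density[OF \<mu>(1,2)])
    fix N :: "complex set" assume N: "N \<in> sets borel" "emeasure circle_meas N = 0"
    show "emeasure \<mu> N = 0"
      by (rule null_set_of_poisson_le[OF \<mu>(1,2,3) open_UNIV zero_less_one _ _ N, of "2 * C"])
         (use low C0 \<mu>(4)[symmetric] in auto)
  qed auto
  show thesis
  proof (rule that[of "\<lambda>\<zeta>. g \<zeta> - C"])
    show "integrable circle_meas (\<lambda>\<zeta>. g \<zeta> - C)" using g by auto
    fix z :: complex assume z: "z \<in> ball 0 1"
    have nz: "cmod z < 1" using z by simp
    have ig: "integrable circle_meas (\<lambda>\<zeta>. poisson z \<zeta> * g \<zeta>)"
      using poisson_integrable_circle[OF g(1) nz] by simp
    have "Re (f z) + C = (\<integral>\<zeta>. poisson z \<zeta> \<partial>\<mu>)" using \<mu>(4)[OF z] by simp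
    also have "\<dots> = (\<integral>\<zeta>. g \<zeta> * poisson z \<zeta> \<partial>circle_meas)"
      unfolding g(3) using g by (subst integral_density) auto
    finally have "Re (f z) = poisson_int g z - C" by (simp add: mult.commute)
    also have "\<dots> = (\<integral>\<zeta>. poisson z \<zeta> * g \<zeta> - poisson z \<zeta> * C \<partial>circle_meas)"
      using ig integrable_poisson[OF nz] integral_poisson[OF nz] by simp
    finally show "Re (f z) = poisson_int (\<lambda>\<zeta>. g \<zeta> - C) z"
      by (simp add: right_diff_distrib)
  qed
qed

lemma bdry_eqI:
  assumes "radial_limit f \<zeta> L"
  shows "bdry f \<zeta> = L"
proof -
  have "\<exists>L. radial_limit f \<zeta> L" using assms by blast
  moreover have "Lim (at_left 1) (\<lambda>r::real. f (of_real r * \<zeta>)) = L"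
    by (rule tendsto_Lim[OF _ assms]) simp
  ultimately show ?thesis by (simp only: bdry_def if_True)
qed

text \<open>Fatou's theorem, from the real parts of \<open>f\<close> and of \<open>- \<i> f\<close>.
  The function \<open>g\<close> is a Borel representative of \<open>bdry f\<close>, which is given
  only through pointwise limits.\<close>

theorem Hinf_poisson_bdry:
  assumes f: "f \<in> Hinf"
  obtains g :: "complex \<Rightarrow> complex" where "integrable circle_meas g"
    "AE \<zeta> in circle_meas. bdry f \<zeta> = g \<zeta> \<and> radial_limit f \<zeta> (g \<zeta>)"
    "\<And>z. z \<in> ball 0 1 \<Longrightarrow> f z = (\<integral>\<zeta>. poisson z \<zeta> *\<^sub>R g \<zeta> \<partial>circle_meas)"
proof -
  obtain g1 :: "complex \<Rightarrow> real" where g1: "integrable circle_meas g1"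
    "\<And>z. z \<in> ball 0 1 \<Longrightarrow> Re (f z) = poisson_int g1 z"
    using Hinf_Re_poisson[OF f] by blast
  have "(\<lambda>z. - \<i> * f z) \<in> Hinf"
    using f unfolding Hinf_def by (auto intro!: holomorphic_intros simp: bounded_iff norm_mult)
  then obtain g2 :: "complex \<Rightarrow> real" where g2: "integrable circle_meas g2"
    "\<And>z. z \<in> ball 0 1 \<Longrightarrow> Re (- \<i> * f z) = poisson_int g2 z"
    using Hinf_Re_poisson by blast
  define g where "g \<zeta> = of_real (g1 \<zeta>) + \<i> * of_real (g2 \<zeta>)" for \<zeta>
  have fz: "f z = of_real (poisson_int g1 z) + \<i> * of_real (poisson_int g2 z)"
    if "z \<in> ball 0 1" for z
    using g1(2)[OF that] g2(2)[OF that] by (intro complex_eqI) auto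
  show thesis
  proof (rule that[of g])
    show "integrable circle_meas g" unfolding g_def using g1 g2 by auto
    show "AE \<zeta> in circle_meas. bdry f \<zeta> = g \<zeta> \<and> radial_limit f \<zeta> (g \<zeta>)"
      using poisson_radial_limit[OF g1(1)] poisson_radial_limit[OF g2(1)] AE_circle_meas_norm
    proof eventually_elim
      case (elim \<zeta>)
      have "((\<lambda>r::real. of_real (poisson_int g1 (of_real r * \<zeta>)) +
          \<i> * of_real (poisson_int g2 (of_real r * \<zeta>))) \<longlongrightarrow> g \<zeta>) (at_left 1)"
        unfolding g_def by (intro tendsto_intros elim)
      moreover have "eventually (\<lambda>r::real. of_real (poisson_int g1 (of_real r * \<zeta>)) +
          \<i> * of_real (poisson_int g2 (of_real r * \<zeta>)) = f (of_real r * \<zeta>)) (at_left 1)"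
        using eventually_radius[OF elim(3)] by eventually_elim (simp only: fz)
      ultimately have "radial_limit f \<zeta> (g \<zeta>)"
        by (rule Lim_transform_eventually)
      with bdry_eqI[OF this] show ?case by simp
    qed
    fix z :: complex assume z: "z \<in> ball 0 1"
    then have nz: "cmod z < 1" by simp
    have i: "integrable circle_meas (\<lambda>\<zeta>. poisson z \<zeta> * g1 \<zeta>)" "integrable circle_meas (\<lambda>\<zeta>. poisson z \<zeta> * g2 \<zeta>)"
      using poisson_integrable_circle[OF g1(1) nz] poisson_integrable_circle[OF g2(1) nz] by simp_all
    have "(\<integral>\<zeta>. poisson z \<zeta> *\<^sub>R g \<zeta> \<partial>circle_meas) =
      (\<integral>\<zeta>. of_real (poisson z \<zeta> * g1 \<zeta>) + \<i> * of_real (poisson z \<zeta> * g2 \<zeta>) \<partial>circle_meas)"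
      by (intro Bochner_Integration.integral_cong) (auto simp: g_def scaleR_conv_of_real algebra_simps)
    also have "\<dots> = of_real (poisson_int g1 z) + \<i> * of_real (poisson_int g2 z)"
      using i by (subst Bochner_Integration.integral_add) (auto simp del: of_real_mult simp: integral_complex_of_real)
    finally show "f z = (\<integral>\<zeta>. poisson z \<zeta> *\<^sub>R g \<zeta> \<partial>circle_meas)" using fz[OF z] by simp
  qed
qed

corollary Hinf_radial_limit:
  assumes "f \<in> Hinf"
  shows "AE \<zeta> in circle_meas. radial_limit f \<zeta> (bdry f \<zeta>)"
proof -
  obtain g :: "complex \<Rightarrow> complex" where
    "AE \<zeta> in circle_meas. bdry f \<zeta> = g \<zeta> \<and> radial_limit f \<zeta> (g \<zeta>)"
    using Hinf_poisson_bdry[OF assms] by blast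
  then show ?thesis by eventually_elim simp
qed

text \<open>Maximum principle for bounds known only almost everywhere: \<open>f z\<close> is an
  average of its boundary values against a positive kernel of mean \<open>1\<close>.\<close>

lemma Hinf_norm_le:
  assumes f: "f \<in> Hinf" and C: "AE \<zeta> in circle_meas. cmod (bdry f \<zeta>) \<le> C" and z: "z \<in> ball 0 1"
  shows "cmod (f z) \<le> C"
proof -
  obtain g :: "complex \<Rightarrow> complex" where g: "integrable circle_meas g"
    "AE \<zeta> in circle_meas. bdry f \<zeta> = g \<zeta> \<and> radial_limit f \<zeta> (g \<zeta>)"
    "\<And>z. z \<in> ball 0 1 \<Longrightarrow> f z = (\<integral>\<zeta>. poisson z \<zeta> *\<^sub>R g \<zeta> \<partial>circle_meas)"
    using Hinf_poisson_bdry[OF f] by blast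
  have nz: "cmod z < 1" using z by simp
  have "cmod (f z) \<le> poisson_int (\<lambda>_. C) z"
    unfolding g(3)[OF z]
  proof (rule order_trans[OF integral_norm_bound integral_mono_AE])
    show "AE \<zeta> in circle_meas. cmod (poisson z \<zeta> *\<^sub>R g \<zeta>) \<le> poisson z \<zeta> * C"
      using g(2) C by eventually_elim (use nz poisson_nonneg[of z] in \<open>auto intro!: mult_left_mono\<close>)
    show "integrable circle_meas (\<lambda>\<zeta>. cmod (poisson z \<zeta> *\<^sub>R g \<zeta>))"
      by (intro integrable_norm poisson_integrable_circle g(1) nz)
  qed (use integrable_poisson[OF nz] in auto)
  also have "\<dots> = C" using integral_poisson[OF nz] by simp
  finally show ?thesis .
qed

section \<open>Blaschke products\<close>

text \<open>The Blaschke factor without its unimodular constant. That constant involves division by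
  \<open>a\<close>, whereas this form is also correct for a zero at the origin.\<close>

definition disc_factor :: "complex \<Rightarrow> complex \<Rightarrow> complex" where
  "disc_factor a z = (a - z) / (1 - cnj a * z)"

lemma blaschke_factor_conv: "blaschke_factor a z = (of_real (cmod a) / a) * disc_factor a z"
  by (simp add: blaschke_factor_def disc_factor_def)

lemma norm_blaschke_factor: "a \<noteq> 0 \<Longrightarrow> cmod (blaschke_factor a z) = cmod (disc_factor a z)"
  by (simp add: blaschke_factor_conv norm_mult norm_divide)

lemma one_minus_cnj_mult_nz:
  assumes "cmod a < 1" "cmod z \<le> 1" shows "1 - cnj a * z \<noteq> 0"
proof
  assume "1 - cnj a * z = 0"
  then have "cmod (cnj a * z) = 1" by (metis eq_iff_diff_eq_0 norm_one)
  then have "cmod a * cmod z = 1" by (simp add: norm_mult)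
  moreover have "cmod a * cmod z \<le> cmod a * 1" using assms by (intro mult_left_mono) auto
  ultimately show False using assms by simp
qed

lemma norm_disc_factor_sq:
  assumes "1 - cnj a * z \<noteq> 0"
  shows "1 - (cmod (disc_factor a z))\<^sup>2 = (1 - (cmod a)\<^sup>2) * (1 - (cmod z)\<^sup>2) / (cmod (1 - cnj a * z))\<^sup>2"
proof -
  have "(cmod (1 - cnj a * z))\<^sup>2 - (cmod (a - z))\<^sup>2 = (1 - (cmod a)\<^sup>2) * (1 - (cmod z)\<^sup>2)"
    unfolding cmod_power2 by (simp add: power2_eq_square algebra_simps)
  moreover have "(cmod (1 - cnj a * z))\<^sup>2 \<noteq> 0" using assms by simp
  ultimately show ?thesis
    by (simp add: disc_factor_def norm_divide power_divide diff_divide_distrib[symmetric] divide_simps)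
qed

lemma norm_disc_factor_le_1:
  assumes "cmod a < 1" "cmod z \<le> 1" shows "cmod (disc_factor a z) \<le> 1"
proof -
  have "0 \<le> (1 - (cmod a)\<^sup>2) * (1 - (cmod z)\<^sup>2) / (cmod (1 - cnj a * z))\<^sup>2"
    using assms by (intro divide_nonneg_nonneg mult_nonneg_nonneg) (auto simp: power_le_one)
  then have "(cmod (disc_factor a z))\<^sup>2 \<le> 1\<^sup>2"
    using norm_disc_factor_sq[OF one_minus_cnj_mult_nz[OF assms]] by simp
  then show ?thesis by (rule power2_le_imp_le) simp
qed

lemma norm_disc_factor_eq_1:
  assumes "cmod a < 1" "cmod z = 1" shows "cmod (disc_factor a z) = 1"
proof -
  have "(cmod (disc_factor a z))\<^sup>2 = 1"
    using norm_disc_factor_sq[OF one_minus_cnj_mult_nz[of a z]] assms by simp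
  then show ?thesis by (metis norm_ge_zero power2_eq_1_iff neg_0_le_iff_le not_one_le_zero)
qed

lemma disc_factor_holomorphic:
  assumes "\<And>z. z \<in> U \<Longrightarrow> 1 - cnj a * z \<noteq> 0"
  shows "disc_factor a holomorphic_on U"
  unfolding disc_factor_def using assms by (intro holomorphic_intros) auto

lemma disc_factor_eq_0_iff: "cmod a < 1 \<Longrightarrow> cmod z \<le> 1 \<Longrightarrow> disc_factor a z = 0 \<longleftrightarrow> a = z"
  using one_minus_cnj_mult_nz[of a z] by (auto simp: disc_factor_def)

lemma disc_factor_analytic:
  assumes "cmod a < 1" "cmod z < 1" shows "disc_factor a analytic_on {z}"
proof -
  have "disc_factor a holomorphic_on ball 0 1"
    by (rule disc_factor_holomorphic) (use assms one_minus_cnj_mult_nz in auto)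
  then show ?thesis unfolding analytic_at using assms by (intro exI[of _ "ball 0 1"]) auto
qed

lemma zorder_disc_factor:
  assumes "cmod a < 1" "cmod w < 1"
  shows "zorder (disc_factor a) w = (if a = w then 1 else 0)"
proof (cases "a = w")
  case True
  have nz: "1 - cnj a * z \<noteq> 0" if "z \<in> ball 0 1" for z using one_minus_cnj_mult_nz assms that by auto
  have "zorder (disc_factor a) w = 1"
  proof (rule zorder_eqI[of "ball 0 1" _ "\<lambda>z. - 1 / (1 - cnj a * z)"])
    show "(\<lambda>z. - 1 / (1 - cnj a * z)) holomorphic_on ball 0 1" using nz by (intro holomorphic_intros) auto
  qed (use assms nz True in \<open>auto simp: disc_factor_def divide_simps\<close>)
  then show ?thesis using True by simp
next
  case False
  then show ?thesis using assms
    by (simp add: zorder_eq_0I disc_factor_analytic disc_factor_eq_0_iff)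
qed

text \<open>The factor has modulus \<open>1\<close> on the circle, so dividing by it does not change
  boundary moduli; the bound inside the disc then returns through
  \<open>Hinf_norm_le\<close>.\<close>

lemma divide_disc_factor:
  assumes f: "f holomorphic_on ball 0 1" "\<And>z. z \<in> ball 0 1 \<Longrightarrow> cmod (f z) \<le> 1"
    and a: "cmod a < 1" "f a = 0"
  obtains g where "g holomorphic_on ball 0 1" "\<And>z. z \<in> ball 0 1 \<Longrightarrow> cmod (g z) \<le> 1"
    "\<And>z. z \<in> ball 0 1 \<Longrightarrow> f z = disc_factor a z * g z"
proof -
  define q where "q z = (if z = a then deriv f a else f z / (z - a))" for z
  have q: "q holomorphic_on ball 0 1"
  proof -
    have "(\<lambda>z. if z = a then deriv f a else f z / (z - a) - f a / (z - a)) holomorphic_on ball 0 1"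
      by (rule pole_theorem_open[OF f(1)]) auto
    then show ?thesis using a(2) by (simp add: q_def[abs_def] cong: if_cong)
  qed
  define g where "g z = - (1 - cnj a * z) * q z" for z
  have g: "g holomorphic_on ball 0 1" unfolding g_def by (intro holomorphic_intros q)
  have fg: "f z = disc_factor a z * g z" if "z \<in> ball 0 1" for z
  proof -
    have nz: "1 - cnj a * z \<noteq> 0" using one_minus_cnj_mult_nz a that by auto
    have "disc_factor a z * g z = (z - a) * q z"
      using nz by (simp add: disc_factor_def g_def divide_simps) (simp add: algebra_simps)
    also have "\<dots> = f z" using a by (auto simp: q_def)
    finally show ?thesis by simp
  qed
  \<comment> \<open>A crude bound comes first, because radial limits are available only for members
    of \<open>Hinf\<close>: compactness near \<open>a\<close>, and \<open>|z - a| \<ge> d\<close>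
    elsewhere.\<close>
  define d where "d = (1 - cmod a) / 2"
  have d: "d > 0" using a by (simp add: d_def)
  have sub: "cball a d \<subseteq> ball 0 1"
  proof
    fix z assume "z \<in> cball a d"
    then have "cmod (z - a) \<le> (1 - cmod a) / 2" by (simp add: d_def dist_norm norm_minus_commute)
    then show "z \<in> ball 0 1" using norm_triangle_ineq[of "z - a" a] a by simp
  qed
  obtain C where C: "\<And>x. x \<in> cball a d \<Longrightarrow> cmod (q x) \<le> C"
    using compact_continuous_bounded[OF compact_cball continuous_on_subset[OF holomorphic_on_imp_continuous_on[OF q] sub]]
    by metis
  have qb: "cmod (q z) \<le> max C (1 / d)" if z: "z \<in> ball 0 1" for z
  proof (cases "z \<in> cball a d")
    case True
    then show ?thesis using C by (simp add: le_max_iff_disj)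
  next
    case False
    then have "d \<le> cmod (z - a)" by (simp add: dist_norm norm_minus_commute)
    moreover have "cmod (f z) \<le> 1" using f z by auto
    ultimately have "cmod (f z / (z - a)) \<le> 1 / d" unfolding norm_divide using d by (intro frac_le) auto
    moreover have "z \<noteq> a" using False d by auto
    ultimately show ?thesis by (simp add: q_def le_max_iff_disj)
  qed
  have gb: "cmod (g z) \<le> 2 * max C (1 / d)" if z: "z \<in> ball 0 1" for z
  proof -
    have "cmod (cnj a * z) \<le> 1 * 1" unfolding norm_mult using a z by (intro mult_mono) auto
    then have "cmod (1 - cnj a * z) \<le> 2" using norm_triangle_ineq4[of 1 "cnj a * z"] by simp
    moreover have "cmod (g z) = cmod (1 - cnj a * z) * cmod (q z)"
      by (simp only: g_def norm_mult norm_minus_cancel)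
    ultimately show ?thesis using qb[OF z] by (simp only:) (intro mult_mono, auto)
  qed
  have gH: "g \<in> Hinf" unfolding Hinf_def bounded_iff using g gb by blast
  have "AE \<zeta> in circle_meas. cmod (bdry g \<zeta>) \<le> 1"
    using Hinf_radial_limit[OF gH] AE_circle_meas_norm
  proof eventually_elim
    case (elim \<zeta>)
    have nz: "1 - cnj a * (of_real 1 * \<zeta>) \<noteq> 0" using one_minus_cnj_mult_nz[of a \<zeta>] a elim by simp
    have "((\<lambda>r::real. disc_factor a (of_real r * \<zeta>)) \<longlongrightarrow> disc_factor a (of_real 1 * \<zeta>)) (at_left 1)"
      unfolding disc_factor_def using nz by (intro tendsto_intros)
    then have "((\<lambda>r::real. cmod (disc_factor a (of_real r * \<zeta>) * g (of_real r * \<zeta>))) \<longlongrightarrow>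
       cmod (disc_factor a (of_real 1 * \<zeta>) * bdry g \<zeta>)) (at_left 1)"
      by (intro tendsto_intros elim(1))
    moreover have "eventually (\<lambda>r::real. cmod (disc_factor a (of_real r * \<zeta>) * g (of_real r * \<zeta>)) \<le> 1) (at_left 1)"
      using eventually_radius[OF elim(2)] by eventually_elim (use fg f(2) in metis)
    ultimately have "cmod (disc_factor a (of_real 1 * \<zeta>) * bdry g \<zeta>) \<le> 1"
      by (intro tendsto_upperbound) auto
    then show ?case using norm_disc_factor_eq_1[of a \<zeta>] a elim by (simp add: norm_mult)
  qed
  then have "cmod (g z) \<le> 1" if "z \<in> ball 0 1" for z using Hinf_norm_le[OF gH _ that] by blast
  then show thesis using that g fg by blast
qed

lemma eventually_nonzero_disc:
  assumes f: "f holomorphic_on ball 0 1" "z0 \<in> ball 0 1" "f z0 \<noteq> 0" and w: "w \<in> ball 0 1"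
  shows "eventually (\<lambda>z. f z \<noteq> 0 \<and> z \<in> ball 0 1) (at w)"
proof -
  obtain r where r: "r > 0" "cball w r \<subseteq> ball 0 1"
    "\<forall>z\<in>cball w r. f z = zor_poly f w z * (z - w) ^ nat (zorder f w) \<and> zor_poly f w z \<noteq> 0"
    using zorder_exist_zero[OF f(1) open_ball connected_ball w] f(2,3) by blast
  have "f z \<noteq> 0 \<and> z \<in> ball 0 1" if "z \<noteq> w" "dist z w < r" for z
  proof -
    have "z \<in> cball w r" using that by (simp add: dist_commute)
    then show ?thesis using r that by (metis mult_eq_0_iff power_not_zero right_minus_eq subsetD)
  qed
  then show ?thesis unfolding eventually_at using r(1) by blast
qed

lemma zorder_prod_disc_factor:
  assumes "finite F" "\<And>i. i \<in> F \<Longrightarrow> cmod (a i) < 1" "cmod w < 1"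
  shows "zorder (\<lambda>z. \<Prod>i\<in>F. disc_factor (a i) z) w = int (card {i\<in>F. a i = w})"
proof -
  have "eventually (\<lambda>z. z \<in> ball 0 1 - a ` F - {w}) (at w)"
  proof -
    have "open (ball 0 1 - (a ` F - {w}))" using assms by (intro open_Diff finite_imp_closed) auto
    then have "eventually (\<lambda>z. z \<in> ball 0 1 - (a ` F - {w})) (at w)"
      by (rule eventually_at_in_open') (use assms in auto)
    moreover have "eventually (\<lambda>z. z \<noteq> w) (at w)" by (simp add: eventually_at_filter)
    ultimately show ?thesis by eventually_elim auto
  qed
  then have ev: "eventually (\<lambda>z. (\<Prod>i\<in>F. disc_factor (a i) z) \<noteq> 0) (at w)"
  proof eventually_elim
    case (elim z)
    then show ?case using assms disc_factor_eq_0_iff[of _ z] by (auto simp: less_imp_le)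
  qed
  have "zorder (\<lambda>z. \<Prod>i\<in>F. disc_factor (a i) z) w = (\<Sum>i\<in>F. zorder (disc_factor (a i)) w)"
    by (rule zorder_prod_analytic[OF _ ev]) (use assms disc_factor_analytic in auto)
  also have "\<dots> = (\<Sum>i\<in>F. if a i = w then 1 else 0)"
    using assms by (intro sum.cong) (auto simp: zorder_disc_factor)
  also have "\<dots> = int (card {i\<in>F. a i = w})" using assms by (simp add: sum.If_cases Int_def conj_commute)
  finally show ?thesis .
qed

text \<open>Factors are split off one index at a time. If the quotient no longer vanished at
  \<open>a j\<close>, then \<open>zorder f (a j)\<close> would equal the number of indices already
  used for that point, which is less than the number demanded by \<open>mult\<close>.\<close>

lemma divide_disc_factors:
  assumes f: "f holomorphic_on ball 0 1" "\<And>z. z \<in> ball 0 1 \<Longrightarrow> cmod (f z) \<le> 1" "z0 \<in> ball 0 1" "f z0 \<noteq> 0"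
    and F: "finite F" "\<And>i. i \<in> F \<Longrightarrow> cmod (a i) < 1"
    and mult: "\<And>w. w \<in> ball 0 1 \<Longrightarrow> int (card {i\<in>F. a i = w}) \<le> zorder f w"
  shows "\<exists>g. g holomorphic_on ball 0 1 \<and> (\<forall>z\<in>ball 0 1. cmod (g z) \<le> 1) \<and>
    (\<forall>z\<in>ball 0 1. f z = (\<Prod>i\<in>F. disc_factor (a i) z) * g z)"
  using F mult
proof (induction F rule: finite_induct)
  case empty
  then show ?case using f by auto
next
  case (insert j F)
  have le: "int (card {i\<in>F. a i = w}) \<le> zorder f w" if "w \<in> ball 0 1" for w
  proof -
    have "card {i\<in>F. a i = w} \<le> card {i\<in>insert j F. a i = w}" using insert by (intro card_mono) auto
    then show ?thesis using insert.prems(2)[OF that] by linarith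
  qed
  obtain g where g: "g holomorphic_on ball 0 1" "\<And>z. z \<in> ball 0 1 \<Longrightarrow> cmod (g z) \<le> 1"
    "\<And>z. z \<in> ball 0 1 \<Longrightarrow> f z = (\<Prod>i\<in>F. disc_factor (a i) z) * g z"
    using insert.IH le insert.prems by blast
  have aj: "cmod (a j) < 1" using insert by simp
  have "g (a j) = 0"
  proof (rule ccontr)
    assume "g (a j) \<noteq> 0"
    moreover have ga: "g analytic_on {a j}" unfolding analytic_at using g aj by (intro exI[of _ "ball 0 1"]) auto
    ultimately have zg: "zorder g (a j) = 0" by (intro zorder_eq_0I)
    have ev: "eventually (\<lambda>z. f z \<noteq> 0 \<and> z \<in> ball 0 1) (at (a j))"
      by (rule eventually_nonzero_disc[OF f(1,3,4)]) (use aj in auto)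
    have "zorder f (a j) = zorder (\<lambda>z. (\<Prod>i\<in>F. disc_factor (a i) z) * g z) (a j)"
      by (rule zorder_cong) (use ev g(3) in \<open>auto elim: eventually_mono\<close>)
    also have "\<dots> = zorder (\<lambda>z. \<Prod>i\<in>F. disc_factor (a i) z) (a j) + zorder g (a j)"
    proof (rule zorder_times_analytic)
      show "(\<lambda>z. \<Prod>i\<in>F. disc_factor (a i) z) analytic_on {a j}"
        by (intro analytic_intros disc_factor_analytic) (use insert in auto)
      show "\<forall>\<^sub>F z in at (a j). (\<Prod>i\<in>F. disc_factor (a i) z) * g z \<noteq> 0"
        using ev by eventually_elim (use g(3) in auto)
    qed fact
    also have "\<dots> = int (card {i\<in>F. a i = a j})"
      using zg insert aj by (subst zorder_prod_disc_factor) auto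
    also have "\<dots> < int (card {i\<in>insert j F. a i = a j})"
      using insert by (intro of_nat_less_iff[THEN iffD2] psubset_card_mono) auto
    finally show False using insert.prems(2)[of "a j"] aj by simp
  qed
  then obtain g' where g': "g' holomorphic_on ball 0 1" "\<And>z. z \<in> ball 0 1 \<Longrightarrow> cmod (g' z) \<le> 1"
    "\<And>z. z \<in> ball 0 1 \<Longrightarrow> g z = disc_factor (a j) z * g' z"
    using divide_disc_factor[OF g(1,2) aj] by blast
  show ?case using g' g(3) insert by (intro exI[of _ g']) auto
qed

text \<open>Multiple zeros are listed repeatedly, as in the definition of \<open>blaschke\<close>.
  Countability comes from exhausting the disc by compact sets, each containing finitely many
  zeros.\<close>

lemma disc_zeros_enumeration:
  assumes f: "f holomorphic_on ball 0 1" "z0 \<in> ball 0 1" "f z0 \<noteq> 0"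
  obtains N :: "nat set" and a where "\<And>n. n \<in> N \<Longrightarrow> cmod (a n) < 1 \<and> f (a n) = 0"
    "\<And>w. w \<in> ball 0 1 \<Longrightarrow> finite {n\<in>N. a n = w} \<and> int (card {n\<in>N. a n = w}) = zorder f w"
proof -
  have zo: "if f w = 0 then zorder f w > 0 else zorder f w = 0" if "w \<in> ball 0 1" for w
    using zorder_exist_zero[OF f(1) open_ball connected_ball that] f(2,3) by blast
  define Z where "Z = {z\<in>ball 0 1. f z = 0}"
  have "countable Z"
  proof (cases "f constant_on ball 0 1")
    case True
    then have "Z = {}" using f by (auto simp: Z_def constant_on_def)
    then show ?thesis by simp
  next
    case False
    obtain C :: "nat \<Rightarrow> complex set" where C: "\<And>n. compact (C n)" "\<And>n. C n \<subseteq> ball 0 1" "(\<Union>n. C n) = ball 0 1"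
      using open_Union_compact_subsets[of "ball (0::complex) 1"] by (metis open_ball)
    have "finite {z\<in>C n. f z = 0}" for n
      by (rule holomorphic_compact_finite_zeros[OF f(1)]) (use C False in auto)
    then have "countable (\<Union>n. {z\<in>C n. f z = 0})" by (intro countable_UN) (auto intro: countable_finite)
    moreover have "Z = (\<Union>n. {z\<in>C n. f z = 0})" using C(3) by (auto simp: Z_def)
    ultimately show ?thesis by simp
  qed
  \<comment> \<open>The second component numbers the copies of a zero; coding the pairs as natural
    numbers gives the index set.\<close>
  define P where "P = (SIGMA w:Z. {..<nat (zorder f w)})"
  have cP: "countable P" unfolding P_def using \<open>countable Z\<close> by (intro countable_SIGMA) auto
  define N where "N = to_nat_on P ` P"
  define a where "a n = fst (from_nat_into P n)" for n
  have inj: "inj_on (to_nat_on P) P" by (rule inj_on_to_nat_on[OF cP])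
  have ap: "a (to_nat_on P p) = fst p" if "p \<in> P" for p using that cP by (simp add: a_def)
  show thesis
  proof (rule that[of N a])
    fix n assume "n \<in> N"
    then obtain p where "p \<in> P" "n = to_nat_on P p" by (auto simp: N_def)
    then show "cmod (a n) < 1 \<and> f (a n) = 0" using ap by (auto simp: P_def Z_def)
  next
    fix w :: complex assume w: "w \<in> ball 0 1"
    have "{n\<in>N. a n = w} = to_nat_on P ` {p\<in>P. fst p = w}" using ap by (auto simp: N_def)
    moreover have "{p\<in>P. fst p = w} = Pair w ` {..<nat (zorder f w)}"
      using zo[OF w] w by (auto simp: P_def Z_def split: if_splits)
    moreover have "inj_on (to_nat_on P) (Pair w ` {..<nat (zorder f w)})"
      using inj \<open>{p\<in>P. fst p = w} = _\<close> by (metis (no_types, lifting) inj_on_subset mem_Collect_eq subsetI)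
    ultimately show "finite {n\<in>N. a n = w} \<and> int (card {n\<in>N. a n = w}) = zorder f w"
      using zo[OF w] by (auto simp: card_image inj_on_def split: if_splits)
  qed
qed

text \<open>Dividing by finitely many factors keeps the bound \<open>1\<close>, which is the first
  claim. Taking logarithms of it at a point where \<open>f\<close> is nonzero bounds all finite sums
  of \<open>1 - |a i|\<close> uniformly.\<close>

lemma blaschke_condition:
  assumes f: "f holomorphic_on ball 0 1" "\<And>z. z \<in> ball 0 1 \<Longrightarrow> cmod (f z) \<le> 1" "z0 \<in> ball 0 1" "f z0 \<noteq> 0"
    and a: "\<And>n. n \<in> N \<Longrightarrow> cmod (a n) < 1"
    and mult: "\<And>w. w \<in> ball 0 1 \<Longrightarrow> finite {n\<in>N. a n = w} \<and> int (card {n\<in>N. a n = w}) = zorder f w"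
  shows "\<And>F z. finite F \<Longrightarrow> F \<subseteq> N \<Longrightarrow> z \<in> ball 0 1 \<Longrightarrow> cmod (f z) \<le> (\<Prod>i\<in>F. cmod (disc_factor (a i) z))"
    and "summable (\<lambda>n. if n \<in> N then 1 - cmod (a n) else 0)"
proof -
  show prod: "cmod (f z) \<le> (\<Prod>i\<in>F. cmod (disc_factor (a i) z))"
    if F: "finite F" "F \<subseteq> N" and z: "z \<in> ball 0 1" for F z
  proof -
    have "int (card {i\<in>F. a i = w}) \<le> zorder f w" if w: "w \<in> ball 0 1" for w
    proof -
      have "card {i\<in>F. a i = w} \<le> card {n\<in>N. a n = w}" using F mult[OF w] by (intro card_mono) auto
      then show ?thesis using mult[OF w] by simp
    qed
    then obtain g where g: "\<And>z. z \<in> ball 0 1 \<Longrightarrow> cmod (g z) \<le> 1"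
      "\<And>z. z \<in> ball 0 1 \<Longrightarrow> f z = (\<Prod>i\<in>F. disc_factor (a i) z) * g z"
      using divide_disc_factors[OF f F(1), of a] a F(2) by blast
    have "cmod (f z) = (\<Prod>i\<in>F. cmod (disc_factor (a i) z)) * cmod (g z)"
      using g(2)[OF z] by (simp add: norm_mult prod_norm)
    also have "\<dots> \<le> (\<Prod>i\<in>F. cmod (disc_factor (a i) z)) * 1"
      using g(1)[OF z] by (intro mult_left_mono prod_nonneg) auto
    finally show ?thesis by simp
  qed
  have z0: "cmod z0 < 1" using f by simp
  \<comment> \<open>\<open>|1 - cnj a z0| \<le> 2\<close> and
    \<open>1 - |a|^2 \<ge> 1 - |a|\<close>, so by \<open>norm_disc_factor_sq\<close> the quantity
    \<open>\<kappa> (1 - |a|)\<close> is at most one minus the squared modulus of the factor at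
    \<open>z0\<close>.\<close>
  define \<kappa> where "\<kappa> = (1 - (cmod z0)\<^sup>2) / 4"
  have \<kappa>: "\<kappa> > 0" using z0 by (simp add: \<kappa>_def power_less_one_iff abs_square_less_1)
  have key: "(\<Sum>i\<in>F. 1 - cmod (a i)) \<le> - 2 * ln (cmod (f z0)) / \<kappa>" if F: "finite F" "F \<subseteq> N" for F
  proof -
    have pos: "cmod (f z0) \<le> (\<Prod>i\<in>F. cmod (disc_factor (a i) z0))" by (rule prod[OF F f(3)])
    then have nz: "(\<Prod>i\<in>F. cmod (disc_factor (a i) z0)) > 0" using f(4) by (meson order_less_le_trans zero_less_norm_iff)
    then have nzi: "cmod (disc_factor (a i) z0) > 0" if "i \<in> F" for i
      using that F(1) by (metis less_irrefl norm_ge_zero order_le_less prod_zero)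
    have "(\<Sum>i\<in>F. \<kappa> * (1 - cmod (a i))) \<le> (\<Sum>i\<in>F. - 2 * ln (cmod (disc_factor (a i) z0)))"
    proof (rule sum_mono)
      fix i assume i: "i \<in> F"
      have ai: "cmod (a i) < 1" using a i F by auto
      have nzd: "1 - cnj (a i) * z0 \<noteq> 0" using one_minus_cnj_mult_nz ai z0 by simp
      have "cmod (1 - cnj (a i) * z0) \<le> 2"
      proof -
        have "cmod (cnj (a i) * z0) \<le> 1 * 1" unfolding norm_mult using ai z0 by (intro mult_mono) auto
        then show ?thesis using norm_triangle_ineq4[of 1 "cnj (a i) * z0"] by simp
      qed
      then have b4: "(cmod (1 - cnj (a i) * z0))\<^sup>2 \<le> 4"
        using power_mono[of "cmod (1 - cnj (a i) * z0)" 2 2] by simp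
      have "(cmod (a i))\<^sup>2 \<le> cmod (a i)" using ai by (simp add: power2_eq_square mult_left_le)
      then have "\<kappa> * (1 - cmod (a i)) \<le> (1 - (cmod (a i))\<^sup>2) * (1 - (cmod z0)\<^sup>2) / 4"
        using \<kappa> by (simp add: \<kappa>_def mult.commute mult_left_mono)
      also have "\<dots> \<le> (1 - (cmod (a i))\<^sup>2) * (1 - (cmod z0)\<^sup>2) / (cmod (1 - cnj (a i) * z0))\<^sup>2"
        using b4 nzd ai z0 by (intro divide_left_mono mult_nonneg_nonneg mult_pos_pos) (auto simp: power_le_one)
      also have "\<dots> = 1 - (cmod (disc_factor (a i) z0))\<^sup>2" using norm_disc_factor_sq[OF nzd] by simp
      also have "\<dots> \<le> - ln ((cmod (disc_factor (a i) z0))\<^sup>2)"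
        using ln_le_minus_one[of "(cmod (disc_factor (a i) z0))\<^sup>2"] nzi[OF i] by simp
      also have "\<dots> = - 2 * ln (cmod (disc_factor (a i) z0))" using nzi[OF i] by (simp add: ln_realpow)
      finally show "\<kappa> * (1 - cmod (a i)) \<le> - 2 * ln (cmod (disc_factor (a i) z0))" .
    qed
    also have "\<dots> = - 2 * ln (\<Prod>i\<in>F. cmod (disc_factor (a i) z0))"
      using nzi F(1) by (subst ln_prod) (auto simp: sum_distrib_left)
    also have "\<dots> \<le> - 2 * ln (cmod (f z0))" using pos nz f(4) by simp
    finally have "\<kappa> * (\<Sum>i\<in>F. 1 - cmod (a i)) \<le> - 2 * ln (cmod (f z0))" by (simp add: sum_distrib_left)
    then show ?thesis using \<kappa> by (simp add: field_simps)
  qed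
  show "summable (\<lambda>n. if n \<in> N then 1 - cmod (a n) else 0)"
  proof (rule summableI_nonneg_bounded)
    show "0 \<le> (if n \<in> N then 1 - cmod (a n) else 0)" for n using a[of n] by auto
    fix n
    have "(\<Sum>i<n. if i \<in> N then 1 - cmod (a i) else 0) = (\<Sum>i\<in>{..<n} \<inter> N. 1 - cmod (a i))"
      by (simp add: sum.inter_restrict)
    also have "\<dots> \<le> - 2 * ln (cmod (f z0)) / \<kappa>" by (rule key) auto
    finally show "(\<Sum>i<n. if i \<in> N then 1 - cmod (a i) else 0) \<le> - 2 * ln (cmod (f z0)) / \<kappa>" .
  qed
qed

section \<open>Convergence and continuation of infinite Blaschke products\<close>

locale blaschke_zeros =
  fixes N :: "nat set" and a :: "nat \<Rightarrow> complex"
  assumes a: "\<And>n. n \<in> N \<Longrightarrow> a n \<noteq> 0 \<and> cmod (a n) < 1"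
    and summable_a: "summable (\<lambda>n. if n \<in> N then 1 - cmod (a n) else 0)"
begin

definition factor :: "nat \<Rightarrow> complex \<Rightarrow> complex" where
  "factor n z = (if n \<in> N then blaschke_factor (a n) z else 1)"

definition bprod :: "complex \<Rightarrow> complex" where
  "bprod z = (\<Prod>n. factor n z)"

text \<open>The points that the reflected zeros \<open>1 / cnj (a n)\<close>, the poles of the factors, stay away from.\<close>
definition regular :: "complex set" where
  "regular = {z. \<exists>e>0. \<forall>w\<in>ball z e. \<forall>n\<in>N. e \<le> cmod (1 - cnj (a n) * w)}"

lemma open_regular: "open regular"
  unfolding open_contains_ball
proof
  fix z assume "z \<in> regular"
  then obtain e where e: "e > 0" "\<forall>w\<in>ball z e. \<forall>n\<in>N. e \<le> cmod (1 - cnj (a n) * w)"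
    by (auto simp: regular_def)
  have "y \<in> regular" if "y \<in> ball z (e/2)" for y
  proof -
    have "ball y (e/2) \<subseteq> ball z e"
    proof
      fix w assume "w \<in> ball y (e/2)"
      then show "w \<in> ball z e" using that dist_triangle[of z w y] by simp
    qed
    then have "\<forall>w\<in>ball y (e/2). \<forall>n\<in>N. e/2 \<le> cmod (1 - cnj (a n) * w)" using e by force
    then show ?thesis unfolding regular_def mem_Collect_eq using e(1) by (intro exI[of _ "e/2"]) simp
  qed
  then show "\<exists>e>0. ball z e \<subseteq> regular" using e(1) by (intro exI[of _ "e/2"]) auto
qed

lemma disc_subset_regular: "ball 0 1 \<subseteq> regular"
proof
  fix z :: complex assume z: "z \<in> ball 0 1"
  define e where "e = (1 - cmod z) / 2"
  have "e \<le> cmod (1 - cnj (a n) * w)" if "w \<in> ball z e" "n \<in> N" for w n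
  proof -
    have "cmod w \<le> cmod z + e" using that norm_triangle_ineq2[of w z] by (simp add: dist_norm norm_minus_commute)
    moreover have "cmod (cnj (a n) * w) \<le> 1 * cmod w"
      unfolding norm_mult using a[OF that(2)] by (intro mult_right_mono) auto
    ultimately show ?thesis using norm_triangle_ineq2[of 1 "cnj (a n) * w"] by (simp add: e_def field_simps)
  qed
  then show "z \<in> regular" unfolding regular_def using z by (auto simp: e_def intro!: exI[of _ e])
qed

text \<open>For \<open>|\<zeta>| = 1\<close> one has
  \<open>|1 - cnj a \<zeta>| = |a - \<zeta>|\<close>: a boundary point is as far from the zeros as
  the denominators are from \<open>0\<close>.\<close>

lemma sphere_regularI:
  assumes "cmod \<zeta> = 1" "e > 0" "\<And>n. n \<in> N \<Longrightarrow> e \<le> dist (a n) \<zeta>"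
  shows "\<zeta> \<in> regular"
proof -
  have "e / 2 \<le> cmod (1 - cnj (a n) * w)" if "w \<in> ball \<zeta> (e/2)" "n \<in> N" for w n
  proof -
    have "1 - cnj (a n) * \<zeta> = \<zeta> * cnj (\<zeta> - a n)"
      using complex_norm_square[of \<zeta>] assms(1) by (simp add: algebra_simps)
    then have "cmod (1 - cnj (a n) * \<zeta>) = dist (a n) \<zeta>"
      using assms(1) by (simp only: norm_mult complex_mod_cnj dist_norm norm_minus_commute)
    then have "e \<le> cmod (1 - cnj (a n) * \<zeta>)" using assms(3)[OF that(2)] by simp
    moreover have "cmod (cnj (a n) * (w - \<zeta>)) \<le> 1 * (e/2)"
      unfolding norm_mult using a[OF that(2)] that(1) by (intro mult_mono) (auto simp: dist_norm norm_minus_commute)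
    moreover have "1 - cnj (a n) * w = (1 - cnj (a n) * \<zeta>) - cnj (a n) * (w - \<zeta>)" by (simp add: algebra_simps)
    ultimately show ?thesis
      using norm_triangle_ineq2[of "1 - cnj (a n) * \<zeta>" "cnj (a n) * (w - \<zeta>)"] by (simp only:)
  qed
  then show ?thesis unfolding regular_def using assms(2) by (auto intro!: exI[of _ "e/2"])
qed

text \<open>Over the common denominator the difference has numerator
  \<open>- (1 - |a|) (a + |a| w)\<close>; the factor \<open>1 - |a|\<close> is what the Blaschke
  condition sums. Nothing requires \<open>w\<close> to lie in the disc, so convergence extends
  across the circle.\<close>

lemma factor_minus_1_le:
  assumes e: "e > 0" "\<And>n. n \<in> N \<Longrightarrow> e \<le> cmod (1 - cnj (a n) * w)"
  shows "cmod (factor n w - 1) \<le> (1 + cmod w) / e * (if n \<in> N then 1 - cmod (a n) else 0)"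
proof (cases "n \<in> N")
  case True
  define b where "b = a n"
  have b: "b \<noteq> 0" "cmod b < 1" using a[OF True] by (auto simp: b_def)
  have nz: "1 - cnj b * w \<noteq> 0" using e(2)[OF True] e(1) by (auto simp: b_def)
  have bb: "b * cnj b = of_real (cmod b) * of_real (cmod b)"
    using complex_norm_square[of b] by (simp add: power2_eq_square)
  have "blaschke_factor b w - 1 = (of_real (cmod b) * (b - w) - b * (1 - cnj b * w)) / (b * (1 - cnj b * w))"
    using b nz by (simp add: blaschke_factor_def diff_divide_distrib)
  also have "of_real (cmod b) * (b - w) - b * (1 - cnj b * w) = - (of_real (1 - cmod b) * (b + of_real (cmod b) * w))"
    using bb by (simp add: algebra_simps)
  finally have "cmod (blaschke_factor b w - 1) = (1 - cmod b) * cmod (b + of_real (cmod b) * w) / (cmod b * cmod (1 - cnj b * w))"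
    using b by (simp only: norm_divide norm_mult norm_minus_cancel norm_of_real)
  also have "\<dots> \<le> (1 - cmod b) * (cmod b * (1 + cmod w)) / (cmod b * e)"
  proof (intro frac_le mult_left_mono)
    show "cmod (b + of_real (cmod b) * w) \<le> cmod b * (1 + cmod w)"
      using norm_triangle_ineq[of b "of_real (cmod b) * w"] by (simp add: norm_mult algebra_simps)
  qed (use b e e(2)[OF True] in \<open>auto simp: b_def\<close>)
  also have "\<dots> = (1 + cmod w) / e * (1 - cmod b)" using b e by (simp add: field_simps)
  finally show ?thesis using True by (simp add: factor_def b_def)
qed (simp add: factor_def)

lemma regularE:
  assumes "z \<in> regular"
  obtains e where "e > 0" "\<And>w n. w \<in> ball z e \<Longrightarrow> n \<in> N \<Longrightarrow> e \<le> cmod (1 - cnj (a n) * w)"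
  using assms by (auto simp: regular_def)

lemma factor_has_prod: "z \<in> regular \<Longrightarrow> (\<lambda>n. factor n z) has_prod bprod z"
proof -
  assume z: "z \<in> regular"
  obtain e where e: "e > 0" "\<And>w n. w \<in> ball z e \<Longrightarrow> n \<in> N \<Longrightarrow> e \<le> cmod (1 - cnj (a n) * w)"
    using regularE[OF z] by blast
  have "summable (\<lambda>n. (1 + cmod z) / e * (if n \<in> N then 1 - cmod (a n) else 0))"
    by (intro summable_mult summable_a)
  then have "summable (\<lambda>n. norm (factor n z - 1))"
    by (rule summable_comparison_test'[of _ 0]) (use factor_minus_1_le[OF e(1), of z] e in auto)
  then have "convergent_prod (\<lambda>n. factor n z)"
    by (metis abs_convergent_prod_conv_summable abs_convergent_prod_imp_convergent_prod)
  then show ?thesis unfolding bprod_def by (rule convergent_prod_has_prod)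
qed

lemma factor_holomorphic: "factor n holomorphic_on regular"
proof (cases "n \<in> N")
  case True
  have nz: "1 - cnj (a n) * z \<noteq> 0" if "z \<in> regular" for z
    using that True by (elim regularE) (metis centre_in_ball norm_zero not_less)
  have "(\<lambda>z. of_real (cmod (a n)) / a n * disc_factor (a n) z) holomorphic_on regular"
    by (intro holomorphic_intros disc_factor_holomorphic nz)
  then show ?thesis using True by (simp add: factor_def[abs_def] blaschke_factor_conv)
qed (simp add: factor_def[abs_def])

text \<open>A majorant series, uniform on a small closed ball, makes the partial products converge
  uniformly there. Since \<open>regular\<close> contains the boundary points away from the zeros,
  this is also the continuation of the product.\<close>

lemma bprod_holomorphic: "bprod holomorphic_on regular"
proof (rule holomorphic_uniform_sequence[OF open_regular])
  show "(\<lambda>z. \<Prod>k<n. factor k z) holomorphic_on regular" for n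
    by (intro holomorphic_intros factor_holomorphic)
  fix z assume z: "z \<in> regular"
  obtain e where e: "e > 0" "\<And>w n. w \<in> ball z e \<Longrightarrow> n \<in> N \<Longrightarrow> e \<le> cmod (1 - cnj (a n) * w)"
    using regularE[OF z] by blast
  obtain d0 where d0: "d0 > 0" "cball z d0 \<subseteq> regular" using open_regular z by (meson open_contains_cball)
  define d where "d = min d0 (e/2)"
  have d: "d > 0" "cball z d \<subseteq> regular" "cball z d \<subseteq> ball z e" using d0 e by (auto simp: d_def subset_iff)
  define C where "C = (1 + (cmod z + d)) / e"
  have bound: "cmod (factor n w - 1) \<le> C * (if n \<in> N then 1 - cmod (a n) else 0)" if w: "w \<in> cball z d" for n w
  proof -
    have "cmod w \<le> cmod z + d" using w norm_triangle_ineq2[of w z] by (simp add: dist_norm norm_minus_commute)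
    then have "(1 + cmod w) / e \<le> C" unfolding C_def using e by (intro divide_right_mono) auto
    then have "(1 + cmod w) / e * (if n \<in> N then 1 - cmod (a n) else 0) \<le> C * (if n \<in> N then 1 - cmod (a n) else 0)"
      using a[of n] by (intro mult_right_mono) auto
    then show ?thesis using factor_minus_1_le[OF e(1), of w n] e(2)[of w] w d by force
  qed
  have "uniformly_convergent_on (cball z d) (\<lambda>n x. \<Sum>k<n. norm (factor k x - 1))"
    by (rule Weierstrass_m_test'[where M="\<lambda>n. C * (if n \<in> N then 1 - cmod (a n) else 0)"])
       (use bound in \<open>auto intro!: summable_mult summable_a\<close>)
  then have "uniformly_convergent_on (cball z d) (\<lambda>n x. \<Prod>k<n. factor k x)"
    by (intro uniformly_convergent_on_prod' continuous_on_subset[OF holomorphic_on_imp_continuous_on[OF factor_holomorphic] d(2)]) auto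
  then obtain l where l: "uniform_limit (cball z d) (\<lambda>n x. \<Prod>k<n. factor k x) l sequentially"
    by (auto simp: uniformly_convergent_on_def)
  have "l w = bprod w" if "w \<in> cball z d" for w
  proof -
    have "(\<lambda>n. \<Prod>k<n. factor k w) \<longlonglongrightarrow> l w" using tendsto_uniform_limitI[OF l that] .
    moreover have "(\<lambda>n. \<Prod>k<n. factor k w) \<longlonglongrightarrow> bprod w"
      using has_prod_imp_tendsto'[OF factor_has_prod] that d by auto
    ultimately show ?thesis using LIMSEQ_unique by blast
  qed
  then have "uniform_limit (cball z d) (\<lambda>n x. \<Prod>k<n. factor k x) bprod sequentially"
    using l uniform_limit_cong' by (metis (mono_tags, lifting))
  then show "\<exists>d>0. cball z d \<subseteq> regular \<and> uniform_limit (cball z d) (\<lambda>n z. \<Prod>k<n. factor k z) bprod sequentially"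
    using d by blast
qed

lemma norm_bprod_eq_1:
  assumes "\<zeta> \<in> regular" "cmod \<zeta> = 1" shows "cmod (bprod \<zeta>) = 1"
proof -
  have "(\<lambda>n. cmod (factor n \<zeta>)) has_prod cmod (bprod \<zeta>)" by (rule has_prod_norm[OF factor_has_prod[OF assms(1)]])
  moreover have "cmod (factor n \<zeta>) = 1" for n
    using assms a[of n] by (auto simp: factor_def norm_blaschke_factor norm_disc_factor_eq_1)
  ultimately show ?thesis by (metis has_prod_cong has_prod_one has_prod_unique2)
qed

lemma norm_bprod_le_1:
  assumes z: "z \<in> ball 0 1" shows "cmod (bprod z) \<le> 1"
proof -
  have "cmod (factor n z) \<le> 1" for n
    using a[of n] z by (auto simp: factor_def norm_blaschke_factor intro!: norm_disc_factor_le_1)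
  then have "cmod (\<Prod>k<n. factor k z) \<le> 1" for n
    by (subst prod_norm[symmetric]) (auto intro!: prod_le_1)
  moreover have "(\<lambda>n. cmod (\<Prod>k<n. factor k z)) \<longlonglongrightarrow> cmod (bprod z)"
    using z disc_subset_regular by (intro tendsto_norm has_prod_imp_tendsto'[OF factor_has_prod]) auto
  ultimately show ?thesis by (intro LIMSEQ_le_const2) auto
qed

lemma bprod_eq_0_iff:
  assumes "z \<in> ball 0 1" shows "bprod z = 0 \<longleftrightarrow> (\<exists>n\<in>N. a n = z)"
proof -
  have "bprod z = 0 \<longleftrightarrow> (\<exists>n. factor n z = 0)"
    unfolding has_prod_eq_0_iff[OF factor_has_prod[OF subsetD[OF disc_subset_regular assms]]] by force
  also have "\<dots> \<longleftrightarrow> (\<exists>n\<in>N. a n = z)"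
    using a assms disc_factor_eq_0_iff[of _ z] by (auto simp: factor_def blaschke_factor_conv split: if_splits)
  finally show ?thesis .
qed

lemma bprod_analytic: "cmod w < 1 \<Longrightarrow> bprod analytic_on {w}"
  unfolding analytic_at
  by (intro exI[of _ "ball 0 1"] conjI holomorphic_on_subset[OF bprod_holomorphic disc_subset_regular]) auto

end

text \<open>All occurrences of \<open>w\<close> lie in a finite head of the product. The remaining
  factors again form a Blaschke product, which is nonzero at \<open>w\<close>, so the order is that
  of the finite head.\<close>

lemma (in blaschke_zeros) zorder_bprod:
  assumes w: "cmod w < 1" and fin: "finite {n\<in>N. a n = w}" and nz: "z0 \<in> ball 0 1" "bprod z0 \<noteq> 0"
  shows "zorder bprod w = int (card {n\<in>N. a n = w})"
proof -
  obtain K where K: "{n\<in>N. a n = w} \<subseteq> {..<K}" using fin finite_nat_iff_bounded by blast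
  interpret tail: blaschke_zeros "{n. n + K \<in> N}" "\<lambda>n. a (n + K)"
  proof
    show "summable (\<lambda>n. if n \<in> {n. n + K \<in> N} then 1 - cmod (a (n + K)) else 0)"
      using summable_ignore_initial_segment[OF summable_a, of K] by simp
  qed (use a in auto)
  have split: "bprod z = (\<Prod>n<K. factor n z) * tail.bprod z" if z: "z \<in> ball 0 1" for z
  proof (rule has_prod_unique2)
    show "(\<lambda>n. factor n z) has_prod bprod z" using factor_has_prod z disc_subset_regular by auto
    have cp: "convergent_prod (\<lambda>n. factor n z)"
      using factor_has_prod[of z] z disc_subset_regular by (auto simp: has_prod_iff)
    have "tail.bprod z = (\<Prod>n. factor (n + K) z)"
      by (simp add: tail.bprod_def tail.factor_def factor_def)
    then show "(\<lambda>n. factor n z) has_prod ((\<Prod>n<K. factor n z) * tail.bprod z)"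
      using has_prod_ignore_initial_segment'[OF cp, of K] by simp
  qed
  define F where "F = N \<inter> {..<K}"
  define c where "c = (\<Prod>n\<in>F. of_real (cmod (a n)) / a n)"
  have c0: "c \<noteq> 0" unfolding c_def using a by (auto simp: F_def)
  have fp: "(\<Prod>n<K. factor n z) = c * (\<Prod>n\<in>F. disc_factor (a n) z)" for z
  proof -
    have "(\<Prod>n<K. factor n z) = (\<Prod>n\<in>F. blaschke_factor (a n) z)"
      unfolding F_def factor_def by (subst Int_commute) (rule prod.inter_restrict[symmetric], simp)
    then show ?thesis by (simp only: c_def blaschke_factor_conv prod.distrib)
  qed
  have tn: "tail.bprod w \<noteq> 0" using tail.bprod_eq_0_iff[of w] K w by auto
  have hol: "bprod holomorphic_on ball 0 1" using bprod_holomorphic disc_subset_regular holomorphic_on_subset by blast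
  have ev: "eventually (\<lambda>z. bprod z \<noteq> 0 \<and> z \<in> ball 0 1) (at w)"
    by (rule eventually_nonzero_disc[OF hol nz]) (use w in auto)
  have "zorder bprod w = zorder (\<lambda>z. (\<Prod>n\<in>F. disc_factor (a n) z) * (c * tail.bprod z)) w"
    by (rule zorder_cong) (use ev in \<open>auto elim!: eventually_mono simp: split fp\<close>)
  also have "\<dots> = zorder (\<lambda>z. \<Prod>n\<in>F. disc_factor (a n) z) w + zorder (\<lambda>z. c * tail.bprod z) w"
  proof (rule zorder_times_analytic)
    show "(\<lambda>z. \<Prod>n\<in>F. disc_factor (a n) z) analytic_on {w}"
      by (intro analytic_intros disc_factor_analytic) (use a w in \<open>auto simp: F_def\<close>)
    show "(\<lambda>z. c * tail.bprod z) analytic_on {w}" by (intro analytic_intros tail.bprod_analytic w)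
    show "\<forall>\<^sub>F z in at w. (\<Prod>n\<in>F. disc_factor (a n) z) * (c * tail.bprod z) \<noteq> 0"
      using ev by eventually_elim (auto simp: split fp)
  qed
  also have "zorder (\<lambda>z. c * tail.bprod z) w = 0"
    by (intro zorder_eq_0I analytic_intros tail.bprod_analytic w) (use c0 tn in auto)
  also have "zorder (\<lambda>z. \<Prod>n\<in>F. disc_factor (a n) z) w = int (card {n\<in>F. a n = w})"
    by (rule zorder_prod_disc_factor) (use a w in \<open>auto simp: F_def\<close>)
  also have "{n\<in>F. a n = w} = {n\<in>N. a n = w}" using K by (auto simp: F_def)
  finally show ?thesis by simp
qed

section \<open>Dividing an inner function by its Blaschke product\<close>

lemma inner_nonzero:
  assumes "inner I" obtains z0 where "z0 \<in> ball 0 1" "I z0 \<noteq> 0"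
proof -
  have "\<exists>z0\<in>ball 0 1. I z0 \<noteq> 0"
  proof (rule ccontr)
    assume "\<not> ?thesis"
    then have 0: "I z = 0" if "z \<in> ball 0 1" for z using that by blast
    have "AE \<zeta> in circle_meas. cmod (bdry I \<zeta>) = 1" using assms by (simp add: inner_def)
    then have "AE \<zeta> in circle_meas. False" using AE_circle_meas_norm
    proof eventually_elim
      case (elim \<zeta>)
      have "eventually (\<lambda>r::real. 0 = I (of_real r * \<zeta>)) (at_left 1)"
        using eventually_radius[OF elim(2)] by eventually_elim (simp only: 0)
      then have "radial_limit I \<zeta> 0"
        by (rule Lim_transform_eventually[OF tendsto_const])
      then show ?case using bdry_eqI elim(1) by fastforce
    qed
    then show False by simp
  qed
  then show thesis using that by blast
qed

lemma inner_norm_le_1: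
  assumes "inner I" "z \<in> ball 0 1" shows "cmod (I z) \<le> 1"
  by (rule Hinf_norm_le[of I 1]) (use assms in \<open>auto simp: inner_def elim: eventually_mono\<close>)

text \<open>\<open>|I| \<le> |B|\<close> is the limit of the bounds for finite products. Since
  \<open>B\<close> and \<open>I\<close> have the same zeros with the same orders, the quotient
  \<open>Q\<close> is zero-free; \<open>|Q| \<le> 1\<close> holds off the isolated zeros and extends
  by continuity. The inequality \<open>|I| \<le> |Q|\<close>, from \<open>|B| \<le> 1\<close>,
  passes the boundary modulus \<open>1\<close> on to \<open>Q\<close>.\<close>

lemma inner_blaschke_quotient:
  assumes I: "inner I"
  obtains N a Q m where "blaschke_zeros N a" "\<And>n. n \<in> N \<Longrightarrow> I (a n) = 0"
    "Q holomorphic_on ball 0 1" "\<And>z. z \<in> ball 0 1 \<Longrightarrow> Q z \<noteq> 0"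
    "\<And>z. z \<in> ball 0 1 \<Longrightarrow> cmod (Q z) \<le> 1"
    "\<And>z. z \<in> ball 0 1 \<Longrightarrow> cmod (I z) \<le> cmod (Q z)"
    "\<And>z. z \<in> ball 0 1 \<Longrightarrow> I z = Q z * (z ^ m * blaschke_zeros.bprod N a z)"
proof -
  have hI: "I holomorphic_on ball 0 1" using I by (simp add: inner_def Hinf_def)
  have I1: "cmod (I z) \<le> 1" if "z \<in> ball 0 1" for z using inner_norm_le_1[OF I that] .
  obtain z0 where z0: "z0 \<in> ball 0 1" "I z0 \<noteq> 0" using inner_nonzero[OF I] .
  obtain N0 :: "nat set" and a where Na: "\<And>n. n \<in> N0 \<Longrightarrow> cmod (a n) < 1 \<and> I (a n) = 0"
    "\<And>w. w \<in> ball 0 1 \<Longrightarrow> finite {n\<in>N0. a n = w} \<and> int (card {n\<in>N0. a n = w}) = zorder I w"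
    using disc_zeros_enumeration[OF hI z0] by blast
  have bc: "cmod (I z) \<le> (\<Prod>i\<in>F. cmod (disc_factor (a i) z))" if "finite F" "F \<subseteq> N0" "z \<in> ball 0 1" for F z
    using blaschke_condition(1)[OF hI I1 z0 _ Na(2) that] Na(1) by blast
  have sum0: "summable (\<lambda>n. if n \<in> N0 then 1 - cmod (a n) else 0)"
    using blaschke_condition(2)[OF hI I1 z0 _ Na(2)] Na(1) by blast
  \<comment> \<open>\<open>blaschke_factor\<close> degenerates at \<open>0\<close>, so the zeros at
    the origin are set aside and enter as the power \<open>z ^ m\<close>.\<close>
  define Z where "Z = {n\<in>N0. a n = 0}"
  define m where "m = card Z"
  define N where "N = {n\<in>N0. a n \<noteq> 0}"
  have finZ: "finite Z" using Na(2)[of 0] by (simp add: Z_def)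
  interpret blaschke_zeros N a
  proof
    show "summable (\<lambda>n. if n \<in> N then 1 - cmod (a n) else 0)"
    proof (rule summable_comparison_test'[OF sum0, of 0])
      show "norm (if n \<in> N then 1 - cmod (a n) else 0) \<le> (if n \<in> N0 then 1 - cmod (a n) else 0)" for n
        using Na(1)[of n] by (auto simp: N_def)
    qed
  qed (use Na in \<open>auto simp: N_def\<close>)
  define B where "B z = z ^ m * bprod z" for z
  have hb: "bprod holomorphic_on ball 0 1" using bprod_holomorphic disc_subset_regular holomorphic_on_subset by blast
  have hB: "B holomorphic_on ball 0 1" unfolding B_def by (intro holomorphic_intros hb)
  have IB: "cmod (I z) \<le> cmod (B z)" if z: "z \<in> ball 0 1" for z
  proof -
    have "(\<lambda>n. \<Prod>k<n. factor k z) \<longlonglongrightarrow> bprod z"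
      using has_prod_imp_tendsto'[OF factor_has_prod] z disc_subset_regular by auto
    then have "(\<lambda>n. cmod z ^ m * cmod (\<Prod>k<n. factor k z)) \<longlonglongrightarrow> cmod z ^ m * cmod (bprod z)"
      by (intro tendsto_intros)
    moreover have "cmod (I z) \<le> cmod z ^ m * cmod (\<Prod>k<n. factor k z)" for n
    proof -
      define F where "F = {..<n} \<inter> N"
      have "cmod (I z) \<le> (\<Prod>i\<in>Z \<union> F. cmod (disc_factor (a i) z))"
        by (rule bc) (use finZ z in \<open>auto simp: F_def N_def Z_def\<close>)
      also have "\<dots> = (\<Prod>i\<in>Z. cmod (disc_factor (a i) z)) * (\<Prod>i\<in>F. cmod (disc_factor (a i) z))"
        by (rule prod.union_disjoint) (use finZ in \<open>auto simp: F_def N_def Z_def\<close>)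
      also have "(\<Prod>i\<in>Z. cmod (disc_factor (a i) z)) = cmod z ^ m"
        by (simp add: m_def Z_def disc_factor_def)
      also have "(\<Prod>i\<in>F. cmod (disc_factor (a i) z)) = (\<Prod>i\<in>F. cmod (blaschke_factor (a i) z))"
        by (intro prod.cong) (auto simp: F_def N_def norm_blaschke_factor)
      also have "\<dots> = (\<Prod>k<n. cmod (factor k z))"
        unfolding F_def by (subst prod.inter_restrict) (auto simp: factor_def intro!: prod.cong)
      finally show ?thesis by (simp add: prod_norm)
    qed
    ultimately have "cmod (I z) \<le> cmod z ^ m * cmod (bprod z)" by (intro LIMSEQ_le_const) auto
    then show ?thesis by (simp add: B_def norm_mult norm_power)
  qed
  have zo: "if I w = 0 then zorder I w > 0 else zorder I w = 0" if "w \<in> ball 0 1" for w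
    using zorder_exist_zero[OF hI open_ball connected_ball that] z0 by blast
  have B0: "B z0 \<noteq> 0" using IB[OF z0(1)] z0(2) by auto
  have zeros: "B w = 0 \<longleftrightarrow> I w = 0" if w: "w \<in> ball 0 1" for w
  proof
    assume "B w = 0"
    then have "w = 0 \<and> m \<noteq> 0 \<or> (\<exists>n\<in>N. a n = w)"
      using bprod_eq_0_iff[OF w] by (auto simp: B_def)
    then have "\<exists>n\<in>N0. a n = w" using finZ by (auto simp: m_def Z_def N_def card_eq_0_iff)
    then show "I w = 0" using Na(1) by blast
  next
    assume "I w = 0"
    then have "{n\<in>N0. a n = w} \<noteq> {}" using zo[OF w] Na(2)[OF w] by (auto simp del: Collect_empty_eq)
    then obtain n where n: "n \<in> N0" "a n = w" by blast
    show "B w = 0"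
    proof (cases "w = 0")
      case True
      then have "m \<noteq> 0" using n finZ by (auto simp: m_def Z_def)
      then show ?thesis using True by (simp add: B_def)
    next
      case False
      then show ?thesis using n bprod_eq_0_iff[OF w] by (auto simp: B_def N_def)
    qed
  qed
  have zord: "zorder B w = zorder I w" if w: "w \<in> ball 0 1" for w
  proof -
    have ev: "eventually (\<lambda>z. B z \<noteq> 0 \<and> z \<in> ball 0 1) (at w)"
      by (rule eventually_nonzero_disc[OF hB z0(1) B0 w])
    have "zorder B w = zorder (\<lambda>z. z ^ m) w + zorder bprod w"
      unfolding B_def
    proof (rule zorder_times_analytic)
      show "\<forall>\<^sub>F z in at w. z ^ m * bprod z \<noteq> 0" using ev by eventually_elim (simp add: B_def)
    qed (use w bprod_analytic in \<open>auto intro!: analytic_intros\<close>)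
    also have "zorder bprod w = int (card {n\<in>N. a n = w})"
    proof (rule zorder_bprod)
      show "finite {n\<in>N. a n = w}" by (rule finite_subset[OF _ conjunct1[OF Na(2)[OF w]]]) (auto simp: N_def)
      show "bprod z0 \<noteq> 0" using B0 by (simp add: B_def)
    qed (use w z0 in auto)
    also have "zorder (\<lambda>z. z ^ m) w = (if w = 0 then int m else 0)"
    proof (cases "w = 0")
      case True
      have "zorder (\<lambda>z::complex. z ^ m) 0 = int m"
        by (rule zorder_eqI[of UNIV _ "\<lambda>_. 1"]) (auto simp: power_int_of_nat)
      then show ?thesis using True by simp
    qed (auto intro!: zorder_eq_0I analytic_intros)
    also have "(if w = 0 then int m else 0) + int (card {n\<in>N. a n = w}) = int (card {n\<in>N0. a n = w})"
    proof (cases "w = 0")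
      case True
      then have "{n\<in>N. a n = w} = {}" by (auto simp: N_def)
      then show ?thesis using True by (simp only: if_True m_def Z_def) simp
    next
      case False
      then have "{n\<in>N. a n = w} = {n\<in>N0. a n = w}" by (auto simp: N_def)
      then show ?thesis using False by simp
    qed
    finally show ?thesis using Na(2)[OF w] by simp
  qed
  obtain Q where Q: "Q holomorphic_on ball 0 1" "\<And>z. z \<in> ball 0 1 \<Longrightarrow> Q z \<noteq> 0" "\<And>z. z \<in> ball 0 1 \<Longrightarrow> I z = Q z * B z"
    using holomorphic_zorder_factorization[OF hI open_ball connected_ball hB zeros zord] by blast
  have Q1: "cmod (Q w) \<le> 1" if w: "w \<in> ball 0 1" for w
  proof -
    have "isCont Q w" using Q(1) w by (metis continuous_on_eq_continuous_at holomorphic_on_imp_continuous_on open_ball)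
    then have "((\<lambda>z. cmod (Q z)) \<longlongrightarrow> cmod (Q w)) (at w)" by (intro tendsto_intros) (simp add: isCont_def)
    moreover have "eventually (\<lambda>z. B z \<noteq> 0 \<and> z \<in> ball 0 1) (at w)"
      by (rule eventually_nonzero_disc[OF hB z0(1) B0 w])
    then have "eventually (\<lambda>z. cmod (Q z) \<le> 1) (at w)"
    proof eventually_elim
      case (elim z)
      then have "cmod (Q z) * cmod (B z) \<le> 1 * cmod (B z)" using IB[of z] Q(3)[of z] by (simp add: norm_mult)
      then show ?case using elim by (simp only: mult_le_cancel_right zero_less_norm_iff) auto
    qed
    ultimately show ?thesis by (intro tendsto_upperbound) auto
  qed
  have IQ: "cmod (I z) \<le> cmod (Q z)" if z: "z \<in> ball 0 1" for z
  proof -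
    have "cmod (bprod z) \<le> 1" by (rule norm_bprod_le_1[OF z])
    moreover have "cmod z ^ m \<le> 1" using z by (intro power_le_one) auto
    ultimately have "cmod z ^ m * cmod (bprod z) \<le> 1 * 1" by (intro mult_mono) auto
    then have "cmod (B z) \<le> 1" by (simp add: B_def norm_mult norm_power)
    then have "cmod (Q z) * cmod (B z) \<le> cmod (Q z) * 1" by (intro mult_left_mono) auto
    then show ?thesis using Q(3)[OF z] by (simp add: norm_mult)
  qed
  have IN: "I (a n) = 0" if "n \<in> N" for n using Na(1) that by (simp add: N_def)
  show thesis by (rule that[OF blaschke_zeros_axioms IN Q(1,2) Q1 IQ Q(3)[unfolded B_def]])
qed

section \<open>Canonical factorisation of inner functions\<close>

lemma Re_herglotz_integral:
  fixes w :: "complex \<Rightarrow> real" and \<mu> :: "complex measure"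
  assumes w: "integrable \<mu> w" and sets: "sets \<mu> = sets borel" and AE: "AE \<zeta> in \<mu>. cmod \<zeta> = 1"
    and z: "cmod z < 1"
  shows "Re (\<integral>\<zeta>. (\<zeta> + z) / (\<zeta> - z) * of_real (w \<zeta>) \<partial>\<mu>) = (\<integral>\<zeta>. poisson z \<zeta> * w \<zeta> \<partial>\<mu>)"
proof -
  have [measurable_cong]: "sets \<mu> = sets borel" by fact
  have [measurable]: "w \<in> borel_measurable \<mu>" using w by auto
  have i: "integrable \<mu> (\<lambda>\<zeta>. (\<zeta> + z) / (\<zeta> - z) * of_real (w \<zeta>))"
    by (rule herglotz_kernel_integrable[OF _ sets AE subsetD[OF disc_subset_away[OF AE]]]) (use w z in simp_all)
  have "Re (\<integral>\<zeta>. (\<zeta> + z) / (\<zeta> - z) * of_real (w \<zeta>) \<partial>\<mu>) = (\<integral>\<zeta>. Re ((\<zeta> + z) / (\<zeta> - z) * of_real (w \<zeta>)) \<partial>\<mu>)"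
    by (rule integral_Re[OF i, symmetric])
  also have "\<dots> = (\<integral>\<zeta>. poisson z \<zeta> * w \<zeta> \<partial>\<mu>)"
  proof (rule integral_cong_AE)
    show "AE \<zeta> in \<mu>. Re ((\<zeta> + z) / (\<zeta> - z) * of_real (w \<zeta>)) = poisson z \<zeta> * w \<zeta>"
      using AE
    proof eventually_elim
      case (elim \<zeta>)
      have "z \<noteq> \<zeta>" using elim z by auto
      have "Re ((\<zeta> + z) / (\<zeta> - z) * of_real (w \<zeta>)) = Re ((\<zeta> + z) / (\<zeta> - z)) * w \<zeta>"
        by (simp only: times_complex.sel Re_complex_of_real Im_complex_of_real mult_zero_right diff_zero)
      then show ?case using poisson_eq_Re[OF elim \<open>z \<noteq> \<zeta>\<close>] by simp
    qed
  qed measurable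
  finally show ?thesis .
qed

corollary herglotz_holomorphic_disc:
  assumes "integrable \<mu> w" "sets \<mu> = sets borel" "AE \<zeta> in \<mu>. cmod \<zeta> = 1"
  shows "herglotz \<mu> w holomorphic_on ball 0 1"
  by (rule holomorphic_on_subset[OF herglotz_holomorphic[OF assms] disc_subset_away[OF assms(3)]])

text \<open>\<open>N\<close> has the largest \<open>\<mu>\<close>-measure among the
  \<open>circle_meas\<close>-null sets, attained as the union of a maximising sequence. A null set
  disjoint from \<open>N\<close> with positive \<open>\<mu>\<close>-measure could be added to it and
  would exceed the supremum.\<close>

lemma lebesgue_decomposition_circle:
  fixes \<mu> :: "complex measure"
  assumes fin: "finite_measure \<mu>" and sets: "sets \<mu> = sets borel"
  obtains N where "N \<in> sets borel" "emeasure circle_meas N = 0"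
    "\<And>A. A \<in> sets borel \<Longrightarrow> emeasure circle_meas A = 0 \<Longrightarrow> A \<inter> N = {} \<Longrightarrow> emeasure \<mu> A = 0"
proof -
  interpret \<mu>: finite_measure \<mu> by fact
  define \<N> where "\<N> = {A \<in> sets borel. emeasure circle_meas A = 0}"
  define s where "s = (SUP A\<in>\<N>. measure \<mu> A)"
  have bdd: "bdd_above (measure \<mu> ` \<N>)"
    by (rule bdd_aboveI[of _ "measure \<mu> (space \<mu>)"]) (auto simp: \<mu>.bounded_measure)
  have ne: "\<N> \<noteq> {}" by (auto simp: \<N>_def intro!: exI[of _ "{}"])
  have "\<exists>A\<in>\<N>. s - 1 / Suc n < measure \<mu> A" for n
    using less_cSUP_iff[OF ne bdd, of "s - 1 / Suc n"] by (simp add: s_def)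
  then obtain A where A: "\<And>n. A n \<in> \<N>" "\<And>n::nat. s - 1 / Suc n < measure \<mu> (A n)" by metis
  define N where "N = (\<Union>n. A n)"
  have NN: "N \<in> \<N>"
  proof -
    have "A n \<in> null_sets circle_meas" for n using A(1)[of n] by (auto simp: \<N>_def null_sets_def)
    then have "N \<in> null_sets circle_meas" unfolding N_def by (intro null_sets_UN) auto
    then show ?thesis by (auto simp: \<N>_def null_sets_def)
  qed
  have Ns: "s \<le> measure \<mu> N"
  proof -
    have "s - 1 / Suc n \<le> measure \<mu> N" for n
      using A(2)[of n] \<mu>.finite_measure_mono[of "A n" N] NN sets by (force simp: N_def \<N>_def)
    then have "s \<le> measure \<mu> N + 1 / Suc n" for n by (simp add: diff_le_eq)
    moreover have "(\<lambda>n. measure \<mu> N + 1 / Suc n) \<longlonglongrightarrow> measure \<mu> N + 0"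
      by (intro tendsto_intros) (use LIMSEQ_inverse_real_of_nat in \<open>simp add: inverse_eq_divide\<close>)
    ultimately show ?thesis by (intro LIMSEQ_le_const) auto
  qed
  show thesis
  proof (rule that[of N])
    fix B :: "complex set" assume B: "B \<in> sets borel" "emeasure circle_meas B = 0" "B \<inter> N = {}"
    have "B \<in> null_sets circle_meas" "N \<in> null_sets circle_meas" using B NN by (auto simp: \<N>_def null_sets_def)
    then have "B \<union> N \<in> null_sets circle_meas" by (rule null_sets.Un)
    then have "B \<union> N \<in> \<N>" by (auto simp: \<N>_def null_sets_def)
    then have "measure \<mu> (B \<union> N) \<le> s" unfolding s_def by (intro cSUP_upper bdd)
    moreover have "measure \<mu> (B \<union> N) = measure \<mu> B + measure \<mu> N"
      using B NN sets by (intro \<mu>.finite_measure_Union) (auto simp: \<N>_def)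
    ultimately have "measure \<mu> B = 0" using Ns measure_nonneg[of \<mu> B] by linarith
    then show "emeasure \<mu> B = 0" by (simp add: \<mu>.emeasure_eq_measure)
  qed (use NN in \<open>auto simp: \<N>_def\<close>)
qed

text \<open>Radial limits in \<open>\<bar>I\<bar> \<le> exp (- poisson_int g)\<close>, where \<open>g\<close> is the density of the absolutely continuous
  part of \<open>\<mu>\<close>, give \<open>1 \<le> exp (- g)\<close>.\<close>
lemma singular_measure_of_radial_bound:
  fixes \<mu> :: "complex measure"
  assumes fin: "finite_measure \<mu>" and sets: "sets \<mu> = sets borel" and sph: "emeasure \<mu> (- sphere 0 1) = 0"
    and I: "inner I" and bd: "\<And>z. z \<in> ball 0 1 \<Longrightarrow> cmod (I z) \<le> exp (- (\<integral>\<zeta>. poisson z \<zeta> \<partial>\<mu>))"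
  shows "singular_measure \<mu>"
proof -
  have AE: "AE \<zeta> in \<mu>. cmod \<zeta> = 1" by (rule AE_norm_eq_1[OF sets sph])
  have [measurable_cong]: "sets \<mu> = sets borel" by fact
  interpret \<mu>: finite_measure \<mu> by fact
  obtain N where N: "N \<in> sets borel" "emeasure circle_meas N = 0"
    "\<And>A. A \<in> sets borel \<Longrightarrow> emeasure circle_meas A = 0 \<Longrightarrow> A \<inter> N = {} \<Longrightarrow> emeasure \<mu> A = 0"
    using lebesgue_decomposition_circle[OF fin sets] by blast
  have [measurable]: "N \<in> sets borel" by fact
  \<comment> \<open>The part of \<open>\<mu>\<close> outside \<open>N\<close>; by the maximality of
    \<open>N\<close> it has a density, and the goal becomes that this density vanishes.\<close>
  define \<nu> where "\<nu> = density \<mu> (\<lambda>\<zeta>. ennreal (indicator (- N) \<zeta>))"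
  have em\<nu>: "emeasure \<nu> A = emeasure \<mu> (A - N)" if "A \<in> sets borel" for A
  proof -
    have "emeasure \<nu> A = (\<integral>\<^sup>+\<zeta>. ennreal (indicator (- N) \<zeta>) * indicator A \<zeta> \<partial>\<mu>)"
      unfolding \<nu>_def using that sets by (intro emeasure_density) auto
    also have "\<dots> = (\<integral>\<^sup>+\<zeta>. indicator (A - N) \<zeta> \<partial>\<mu>)"
      by (intro nn_integral_cong) (auto simp: indicator_def)
    finally have "emeasure \<nu> A = (\<integral>\<^sup>+\<zeta>. indicator (A - N) \<zeta> \<partial>\<mu>)" .
    then show ?thesis using that N(1) sets by simp
  qed
  have sets\<nu>: "sets \<nu> = sets borel" by (simp add: \<nu>_def sets)
  have sp: "space \<nu> = UNIV" using sets_eq_imp_space_eq[OF sets\<nu>] by simp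
  have fin\<nu>: "finite_measure \<nu>"
    by (rule finite_measureI) (simp add: sp em\<nu> \<mu>.emeasure_eq_measure)
  obtain g :: "complex \<Rightarrow> real" where g: "integrable circle_meas g" "\<And>\<zeta>. g \<zeta> \<ge> 0"
    "\<nu> = density circle_meas (\<lambda>\<zeta>. ennreal (g \<zeta>))"
  proof (rule absolutely_continuous_real_density[OF fin\<nu> sets\<nu>])
    fix A :: "complex set" assume A: "A \<in> sets borel" "emeasure circle_meas A = 0"
    have "emeasure circle_meas (A - N) = 0" using emeasure_mono[of "A - N" A circle_meas] A by simp
    then show "emeasure \<nu> A = 0" using em\<nu>[OF A(1)] N(3)[of "A - N"] A N(1) by auto
  qed auto
  have gle: "poisson_int g z \<le> (\<integral>\<zeta>. poisson z \<zeta> \<partial>\<mu>)" if z: "cmod z < 1" for z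
  proof -
    have ip: "integrable \<mu> (poisson z)" using poisson_integrable[OF AE, of "\<lambda>_. 1::real" z] sets z by simp
    have "poisson_int g z = (\<integral>\<zeta>. poisson z \<zeta> \<partial>\<nu>)"
      unfolding g(3) using g by (subst integral_density) (auto simp: mult.commute)
    also have "\<dots> = (\<integral>\<zeta>. indicator (- N) \<zeta> * poisson z \<zeta> \<partial>\<mu>)"
      unfolding \<nu>_def by (subst integral_density) auto
    also have "\<dots> \<le> (\<integral>\<zeta>. poisson z \<zeta> \<partial>\<mu>)"
    proof (rule integral_mono)
      show "integrable \<mu> (\<lambda>\<zeta>. indicator (- N) \<zeta> * poisson z \<zeta>)"
        by (rule Bochner_Integration.integrable_bound[OF ip]) (auto simp: indicator_def)
    qed (use ip z poisson_nonneg[of z] in \<open>auto simp: indicator_def\<close>)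
    finally show ?thesis .
  qed
  have Ib: "AE \<zeta> in circle_meas. cmod (bdry I \<zeta>) = 1" and IH: "I \<in> Hinf" using I by (auto simp: inner_def)
  have "AE \<zeta> in circle_meas. g \<zeta> = 0"
    using Ib Hinf_radial_limit[OF IH] poisson_radial_limit[OF g(1)] AE_circle_meas_norm
  proof eventually_elim
    case (elim \<zeta>)
    have "((\<lambda>r::real. exp (- (poisson_int g (of_real r * \<zeta>)))) \<longlongrightarrow> exp (- g \<zeta>)) (at_left 1)"
      by (intro tendsto_intros elim)
    moreover have "((\<lambda>r::real. cmod (I (of_real r * \<zeta>))) \<longlongrightarrow> cmod (bdry I \<zeta>)) (at_left 1)"
      by (intro tendsto_intros elim)
    moreover have "eventually (\<lambda>r::real. cmod (I (of_real r * \<zeta>)) \<le> exp (- (poisson_int g (of_real r * \<zeta>)))) (at_left 1)"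
      using eventually_radius[OF elim(4)]
    proof eventually_elim
      case (elim r)
      then have n: "cmod (of_real r * \<zeta>) < 1" by simp
      then show ?case using bd[of "of_real r * \<zeta>"] gle[OF n] by (auto elim!: order_trans)
    qed
    ultimately have "cmod (bdry I \<zeta>) \<le> exp (- g \<zeta>)" by (intro tendsto_le) auto
    then show ?case using elim(1) g(2)[of \<zeta>] by simp
  qed
  then have "AE \<zeta> in circle_meas. ennreal (g \<zeta>) = 0" by eventually_elim simp
  then have "emeasure \<nu> UNIV = 0"
    unfolding g(3) using g(1) by (subst emeasure_density) (auto simp: nn_integral_0_iff_AE)
  then have "emeasure \<mu> (- N) = 0" using em\<nu>[of UNIV] by (simp add: Compl_eq_Diff_UNIV)
  then show ?thesis unfolding singular_measure_def using fin sets sph N(1,2) by blast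
qed

text \<open>The quotient \<open>Q\<close> left after removing the zeros has an analytic logarithm
  with nonpositive real part, whose negative has a Herglotz measure. \<open>I\<close> being inner
  forces that measure to be singular.\<close>

theorem canonical_factorization:
  assumes I: "inner I"
  obtains c m N a \<mu> where "cmod c = 1" "blaschke_zeros N a" "\<And>n. n \<in> N \<Longrightarrow> I (a n) = 0" "singular_measure \<mu>"
    "\<And>z. z \<in> ball 0 1 \<Longrightarrow> I z = c * (z ^ m * blaschke_zeros.bprod N a z) * singular_inner \<mu> z"
proof (rule inner_blaschke_quotient[OF I])
  fix N a Q m assume Q: "blaschke_zeros N a" "\<And>n. n \<in> N \<Longrightarrow> I (a n) = 0"
    "Q holomorphic_on ball 0 1" "\<And>z. z \<in> ball 0 1 \<Longrightarrow> Q z \<noteq> 0"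
    "\<And>z. z \<in> ball 0 1 \<Longrightarrow> cmod (Q z) \<le> 1"
    "\<And>z. z \<in> ball 0 1 \<Longrightarrow> cmod (I z) \<le> cmod (Q z)"
    "\<And>z. z \<in> ball 0 1 \<Longrightarrow> I z = Q z * (z ^ m * blaschke_zeros.bprod N a z)"
  obtain L where L: "L holomorphic_on ball 0 1" "\<And>z. z \<in> ball 0 1 \<Longrightarrow> exp (L z) = Q z"
    using holomorphic_logarithm_exists[OF convex_ball open_ball Q(3,4), of 0] by auto
  have nQ: "cmod (Q z) = exp (Re (L z))" if "z \<in> ball 0 1" for z
    using L(2)[OF that] norm_exp_eq_Re[of "L z"] by simp
  have "Re (- L z) \<ge> 0" if "z \<in> ball 0 1" for z using nQ[OF that] Q(5)[OF that] by simp
  moreover have "(\<lambda>z. - L z) holomorphic_on ball 0 1" using L by (intro holomorphic_intros)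
  ultimately obtain \<mu> :: "complex measure" where \<mu>: "finite_measure \<mu>" "sets \<mu> = sets borel"
    "emeasure \<mu> (- sphere 0 1) = 0" "AE \<zeta> in \<mu>. cmod \<zeta> = 1"
    "\<And>z. z \<in> ball 0 1 \<Longrightarrow> Re (- L z) = (\<integral>\<zeta>. poisson z \<zeta> \<partial>\<mu>)"
    using herglotz_representation[of "\<lambda>z. - L z"] by blast
  interpret \<mu>: finite_measure \<mu> by fact
  define S where "S z = (\<integral>\<zeta>. (\<zeta> + z) / (\<zeta> - z) \<partial>\<mu>)" for z
  have one: "integrable \<mu> (\<lambda>_. 1::complex)" "integrable \<mu> (\<lambda>_. 1::real)" by auto
  have hS: "S holomorphic_on ball 0 1"
    using herglotz_holomorphic_disc[OF one(1) \<mu>(2,4)] by (simp add: S_def[abs_def])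
  have ReS: "Re (S z) = Re (- L z)" if z: "z \<in> ball 0 1" for z
    using Re_herglotz_integral[OF one(2) \<mu>(2,4), of z] z \<mu>(5)[OF z] by (simp add: S_def)
  \<comment> \<open>The Herglotz representation determines only real parts, so \<open>Q\<close> and
    \<open>singular_inner \<mu>\<close> agree up to a function of modulus \<open>1\<close>; being
    analytic, it is a constant.\<close>
  define D where "D z = exp (L z + S z)" for z
  have hD: "D holomorphic_on ball 0 1" unfolding D_def using L(1) hS by (intro holomorphic_intros)
  have D1: "cmod (D z) = 1" if "z \<in> ball 0 1" for z using ReS[OF that] by (simp add: D_def norm_exp_eq_Re)
  have "D constant_on ball 0 1"
    by (rule maximum_modulus_principle[OF hD open_ball connected_ball open_ball order_refl, of 0]) (use D1 in auto)
  then obtain c where c: "\<And>z. z \<in> ball 0 1 \<Longrightarrow> D z = c" by (auto simp: constant_on_def)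
  have Qc: "Q z = c * singular_inner \<mu> z" if z: "z \<in> ball 0 1" for z
  proof -
    have "Q z = exp (L z + S z) * exp (- S z)" using L(2)[OF z] by (simp flip: exp_add)
    then show ?thesis using c[OF z] by (simp add: D_def singular_inner_def S_def)
  qed
  show thesis
  proof (rule that[OF _ Q(1,2)])
    show "cmod c = 1" using D1[of 0] c[of 0] by simp
    show "singular_measure \<mu>"
    proof (rule singular_measure_of_radial_bound[OF \<mu>(1,2,3) I])
      show "cmod (I z) \<le> exp (- (\<integral>\<zeta>. poisson z \<zeta> \<partial>\<mu>))" if "z \<in> ball 0 1" for z
        using Q(6)[OF that] nQ[OF that] by (simp flip: \<mu>(5)[OF that])
    qed
    show "I z = c * (z ^ m * blaschke_zeros.bprod N a z) * singular_inner \<mu> z" if "z \<in> ball 0 1" for z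
      using Q(7)[OF that] Qc[OF that] by simp
  qed
qed

lemma blaschke_zeros_imp_blaschke:
  assumes "blaschke_zeros N a"
  shows "blaschke (\<lambda>z. z ^ m * blaschke_zeros.bprod N a z)"
proof -
  interpret blaschke_zeros N a by fact
  show ?thesis unfolding blaschke_def bprod_def factor_def
    using a summable_a by (intro exI[of _ m] exI[of _ N] exI[of _ a]) auto
qed

section \<open>Behaviour at the spectrum\<close>

text \<open>If the modulus stayed above \<open>e\<close> near \<open>\<zeta>0\<close>, the Poisson
  integrals of \<open>\<mu>\<close> would be bounded there by \<open>- ln e\<close>, so
  \<open>\<mu>\<close> would give no mass to null sets in a neighbourhood. But \<open>\<mu>\<close>
  is carried by a null set, so the neighbourhood would have mass \<open>0\<close>, against the
  choice of \<open>\<zeta>0\<close> in the support.\<close>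

lemma singular_inner_small_near_support:
  assumes \<mu>: "singular_measure \<mu>" and \<zeta>0: "\<zeta>0 \<in> measure_support \<mu>" and e: "e > 0"
  shows "\<exists>z\<in>ball 0 1. dist z \<zeta>0 < e \<and> cmod (singular_inner \<mu> z) < e"
proof (rule ccontr)
  assume neg: "\<not> ?thesis"
  have fin: "finite_measure \<mu>" and sets: "sets \<mu> = sets borel" and sph: "emeasure \<mu> (- sphere 0 1) = 0"
    using \<mu> by (auto simp: singular_measure_def)
  obtain N where N: "N \<in> sets borel" "emeasure circle_meas N = 0" "emeasure \<mu> (- N) = 0"
    using \<mu> by (auto simp: singular_measure_def)
  have AE: "AE \<zeta> in \<mu>. cmod \<zeta> = 1" by (rule AE_norm_eq_1[OF sets sph])
  interpret \<mu>: finite_measure \<mu> by fact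
  have le: "(\<integral>\<zeta>. poisson z \<zeta> \<partial>\<mu>) \<le> - ln e" if z: "z \<in> ball 0 1" "dist z \<zeta>0 < e" for z
  proof -
    have "cmod (singular_inner \<mu> z) = exp (- (\<integral>\<zeta>. poisson z \<zeta> \<partial>\<mu>))"
      using Re_herglotz_integral[OF _ sets AE, of "\<lambda>_. 1" z] z
      by (simp add: singular_inner_def norm_exp_eq_Re)
    moreover have "e \<le> cmod (singular_inner \<mu> z)" using neg z by force
    ultimately have "ln e \<le> - (\<integral>\<zeta>. poisson z \<zeta> \<partial>\<mu>)" using e by (metis exp_gt_zero ln_exp ln_le_cancel_iff)
    then show ?thesis by simp
  qed
  define V where "V = ball \<zeta>0 (e/2)"
  have "emeasure \<mu> (N \<inter> V) = 0"
  \<comment> \<open>The halved radii place \<open>z\<close> within \<open>e\<close> of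
    \<open>\<zeta>0\<close>. The maximum with \<open>0\<close> is there because \<open>e\<close> may
    exceed \<open>1\<close>.\<close>
  proof (rule null_set_of_poisson_le[OF fin sets AE, of V "e/2" "max 0 (- ln e)"])
    fix z x assume "z \<in> ball 0 1" "x \<in> V" "dist x z < e/2"
    then show "(\<integral>\<zeta>. poisson z \<zeta> \<partial>\<mu>) \<le> max 0 (- ln e)"
      using le[of z] dist_triangle[of z \<zeta>0 x] by (auto simp: V_def dist_commute le_max_iff_disj)
  next
    show "emeasure circle_meas (N \<inter> V) = 0" using emeasure_mono[of "N \<inter> V" N circle_meas] N by simp
  qed (use e N in \<open>auto simp: V_def\<close>)
  moreover have "emeasure \<mu> V \<le> emeasure \<mu> ((N \<inter> V) \<union> - N)"
    using N sets by (intro emeasure_mono) (auto simp: V_def)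
  moreover have "\<dots> \<le> emeasure \<mu> (N \<inter> V) + emeasure \<mu> (- N)"
    using N sets by (intro emeasure_subadditive) (auto simp: V_def)
  ultimately have "emeasure \<mu> V = 0" using N by simp
  moreover have "emeasure \<mu> V > 0" using \<zeta>0 e by (simp add: measure_support_def V_def)
  ultimately show False by simp
qed

lemma norm_blaschke_le_1:
  assumes "blaschke B" "z \<in> ball 0 1" shows "cmod (B z) \<le> 1"
proof -
  obtain m N a where B: "\<forall>n\<in>N. a n \<noteq> 0 \<and> cmod (a n) < 1"
    "summable (\<lambda>n. if n \<in> N then 1 - cmod (a n) else 0)"
    "\<forall>z\<in>ball 0 1. B z = z ^ m * (\<Prod>n. if n \<in> N then blaschke_factor (a n) z else 1)"
    using assms(1) unfolding blaschke_def by blast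
  interpret blaschke_zeros N a by unfold_locales (use B in auto)
  have "cmod (B z) = cmod z ^ m * cmod (bprod z)"
    using B(3) assms(2) by (simp add: bprod_def factor_def norm_mult norm_power)
  also have "\<dots> \<le> 1 * 1" using assms(2) norm_bprod_le_1[OF assms(2)] by (intro mult_mono power_le_one) auto
  finally show ?thesis by simp
qed

text \<open>Near an accumulation point of zeros \<open>I\<close> even vanishes. In the other case
  the factorisation that witnesses membership in the spectrum is used, and its Blaschke factor can
  only decrease the modulus.\<close>

lemma inner_small_near_spectrum:
  assumes "\<zeta>0 \<in> inner_spectrum I" and e: "e > 0"
  shows "\<exists>z\<in>ball 0 1. dist z \<zeta>0 < e \<and> cmod (I z) < e"
  using assms(1) unfolding inner_spectrum_def
proof
  assume "\<zeta>0 \<in> {\<zeta>. cmod \<zeta> = 1 \<and> \<zeta> islimpt {z \<in> ball 0 1. I z = 0}}"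
  then obtain z where "z \<in> {z \<in> ball 0 1. I z = 0}" "dist z \<zeta>0 < e" using e by (auto simp: islimpt_approachable)
  then show ?thesis using e by auto
next
  assume "\<zeta>0 \<in> {\<zeta>. \<exists>c B \<mu>. cmod c = 1 \<and> blaschke B \<and> singular_measure \<mu> \<and>
          (\<forall>z\<in>ball 0 1. I z = c * B z * singular_inner \<mu> z) \<and> \<zeta> \<in> measure_support \<mu>}"
  then obtain c B \<mu> where cB: "cmod c = 1" "blaschke B" "singular_measure \<mu>"
    "\<And>z. z \<in> ball 0 1 \<Longrightarrow> I z = c * B z * singular_inner \<mu> z" "\<zeta>0 \<in> measure_support \<mu>" by blast
  obtain z where z: "z \<in> ball 0 1" "dist z \<zeta>0 < e" "cmod (singular_inner \<mu> z) < e"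
    using singular_inner_small_near_support[OF cB(3,5) e] by blast
  have "cmod (I z) = cmod (B z) * cmod (singular_inner \<mu> z)" using cB(1) cB(4)[OF z(1)] by (simp add: norm_mult)
  also have "\<dots> \<le> 1 * cmod (singular_inner \<mu> z)"
    using norm_blaschke_le_1[OF cB(2) z(1)] by (intro mult_right_mono) auto
  finally show ?thesis using z by auto
qed

lemma Hinf_mult: "f \<in> Hinf \<Longrightarrow> g \<in> Hinf \<Longrightarrow> (\<lambda>z. f z * g z) \<in> Hinf"
proof -
  assume f: "f \<in> Hinf" and g: "g \<in> Hinf"
  obtain B C where "\<And>z. z \<in> ball 0 1 \<Longrightarrow> cmod (f z) \<le> B" "\<And>z. z \<in> ball 0 1 \<Longrightarrow> cmod (g z) \<le> C"
    using f g unfolding Hinf_def bounded_iff by blast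
  then have "\<forall>z\<in>ball 0 1. cmod (f z * g z) \<le> B * C"
    unfolding norm_mult by (meson mult_mono' norm_ge_zero)
  then have "bounded ((\<lambda>z. f z * g z) ` ball 0 1)" unfolding bounded_iff by blast
  then show ?thesis using f g unfolding Hinf_def by (auto intro!: holomorphic_intros)
qed

lemma Hinf_bdry_bounded:
  assumes "f \<in> Hinf"
  obtains C where "C \<ge> 0" "\<And>z. z \<in> ball 0 1 \<Longrightarrow> cmod (f z) \<le> C" "AE \<zeta> in circle_meas. cmod (bdry f \<zeta>) \<le> C"
proof -
  obtain C where C: "\<And>z. z \<in> ball 0 1 \<Longrightarrow> cmod (f z) \<le> C"
    using assms unfolding Hinf_def bounded_iff by blast
  have "AE \<zeta> in circle_meas. cmod (bdry f \<zeta>) \<le> C"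
    using Hinf_radial_limit[OF assms] AE_circle_meas_norm
  proof eventually_elim
    case (elim \<zeta>)
    have "eventually (\<lambda>r::real. cmod (f (of_real r * \<zeta>)) \<le> C) (at_left 1)"
      using eventually_radius[OF elim(2)] by eventually_elim (rule C)
    then show ?case by (intro tendsto_upperbound[OF tendsto_norm[OF elim(1)]]) auto
  qed
  moreover have "C \<ge> 0" using C[of 0] norm_ge_zero[of "f 0"] by (auto simp del: norm_ge_zero)
  ultimately show thesis using that C by blast
qed

lemma bdry_mult:
  assumes "f \<in> Hinf" "g \<in> Hinf"
  shows "AE \<zeta> in circle_meas. bdry (\<lambda>z. f z * g z) \<zeta> = bdry f \<zeta> * bdry g \<zeta>"
  using Hinf_radial_limit[OF assms(1)] Hinf_radial_limit[OF assms(2)]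
  by eventually_elim (rule bdry_eqI, rule tendsto_mult)

section \<open>Essential suprema and the infimum in the definition of saturation\<close>

text \<open>If the arc were null, the zero function would be at least \<open>1\<close> almost
  everywhere on it, and its Poisson integrals would be positive near
  \<open>\<zeta>0\<close>.\<close>

lemma circle_meas_full_support:
  assumes "cmod \<zeta>0 = 1" "d > 0"
  shows "\<not> (AE \<zeta> in circle_meas. d \<le> dist \<zeta> \<zeta>0)"
proof
  assume "AE \<zeta> in circle_meas. d \<le> dist \<zeta> \<zeta>0"
  then have *: "AE \<zeta> in circle_meas. dist \<zeta> \<zeta>0 < d \<longrightarrow> 1 \<le> (0::real)" by eventually_elim simp
  have "eventually (\<lambda>z. False) (at \<zeta>0 within ball 0 1)"
    using poisson_eventually_ge[OF integrable_zero assms(2,1) *, of 0] by simp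
  then have "eventually (\<lambda>r::real. False) (at_left 1)"
    by (rule eventually_compose_filterlim[OF _ filterlim_radius[OF assms(1)]])
  then show False by simp
qed

lemma circle_AE_le_imp_le:
  fixes h :: "complex \<Rightarrow> real"
  assumes h: "continuous_on (sphere 0 1) h" and le: "AE \<zeta> in circle_meas. h \<zeta> \<le> C" and \<zeta>0: "\<zeta>0 \<in> sphere 0 1"
  shows "h \<zeta>0 \<le> C"
proof (rule ccontr)
  assume "\<not> ?thesis"
  then have "h \<zeta>0 - C > 0" by simp
  then obtain d where d: "d > 0" "\<And>\<zeta>. \<zeta> \<in> sphere 0 1 \<Longrightarrow> dist \<zeta> \<zeta>0 < d \<Longrightarrow> dist (h \<zeta>) (h \<zeta>0) < h \<zeta>0 - C"
    using h \<zeta>0 unfolding continuous_on_iff by blast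
  have "AE \<zeta> in circle_meas. d \<le> dist \<zeta> \<zeta>0"
    using le AE_circle_meas_sphere
  proof eventually_elim
    case (elim \<zeta>)
    then show ?case using d(2)[of \<zeta>] by (force simp: dist_real_def)
  qed
  then show False using circle_meas_full_support[of \<zeta>0 d] \<zeta>0 d by simp
qed

lemma linf_le: "C \<ge> 0 \<Longrightarrow> AE \<zeta> in circle_meas. cmod (g \<zeta>) \<le> C \<Longrightarrow> linf g \<le> C"
  unfolding linf_def by (rule cInf_lower) (auto intro!: bdd_belowI[of _ 0])

text \<open>The bound \<open>B\<close> makes the set under \<open>Inf\<close> nonempty; the infimum
  of the empty set of reals carries no information.\<close>

lemma linf_lessD:
  assumes "AE \<zeta> in circle_meas. cmod (g \<zeta>) \<le> B" "B \<ge> 0" "linf g < M"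
  obtains C where "C \<ge> 0" "C < M" "AE \<zeta> in circle_meas. cmod (g \<zeta>) \<le> C"
proof -
  define X where "X = {C. C \<ge> 0 \<and> (AE \<zeta> in circle_meas. cmod (g \<zeta>) \<le> C)}"
  have "B \<in> X" using assms by (simp add: X_def)
  then have "\<exists>C\<in>X. C < M" using assms(3) by (intro cInf_lessD) (auto simp: linf_def X_def)
  then show thesis using that by (auto simp: X_def)
qed

lemma linf_nonneg:
  assumes "AE \<zeta> in circle_meas. cmod (g \<zeta>) \<le> B" "B \<ge> 0" shows "linf g \<ge> 0"
  unfolding linf_def by (rule cInf_greatest) (use assms in auto)

text \<open>Every arc has positive measure, so an almost everywhere bound on a continuous modulus
  already holds at the point where the maximum is attained.\<close>

lemma linf_eq_max:
  fixes h :: "complex \<Rightarrow> real"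
  assumes h: "continuous_on (sphere 0 1) h" and g: "AE \<zeta> in circle_meas. cmod (g \<zeta>) = h \<zeta>"
    and \<zeta>1: "\<zeta>1 \<in> sphere 0 1" "\<And>\<zeta>. \<zeta> \<in> sphere 0 1 \<Longrightarrow> h \<zeta> \<le> h \<zeta>1" and M: "h \<zeta>1 \<ge> 0"
  shows "linf g = h \<zeta>1"
  unfolding linf_def
proof (rule cInf_eq_minimum)
  show "h \<zeta>1 \<in> {C. C \<ge> 0 \<and> (AE \<zeta> in circle_meas. cmod (g \<zeta>) \<le> C)}"
    using M g AE_circle_meas_sphere \<zeta>1(2) by (auto elim!: eventually_elim2)
  fix C assume "C \<in> {C. C \<ge> 0 \<and> (AE \<zeta> in circle_meas. cmod (g \<zeta>) \<le> C)}"
  then have "AE \<zeta> in circle_meas. cmod (g \<zeta>) \<le> C" by simp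
  with g have "AE \<zeta> in circle_meas. h \<zeta> \<le> C" by eventually_elim simp
  then show "h \<zeta>1 \<le> C" by (rule circle_AE_le_imp_le[OF h _ \<zeta>1(1)])
qed

lemma bdry_diff_bounded:
  assumes "\<phi> \<in> Hinf" "f \<in> Hinf"
  obtains B where "B \<ge> 0" "AE \<zeta> in circle_meas. cmod (bdry \<phi> \<zeta> - cnj (bdry f \<zeta>)) \<le> B"
proof -
  obtain C1 where C1: "C1 \<ge> 0" "AE \<zeta> in circle_meas. cmod (bdry \<phi> \<zeta>) \<le> C1"
    by (rule Hinf_bdry_bounded[OF assms(1)])
  obtain C2 where C2: "C2 \<ge> 0" "AE \<zeta> in circle_meas. cmod (bdry f \<zeta>) \<le> C2"
    by (rule Hinf_bdry_bounded[OF assms(2)])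
  have "AE \<zeta> in circle_meas. cmod (bdry \<phi> \<zeta> - cnj (bdry f \<zeta>)) \<le> C1 + C2"
    using C1(2) C2(2)
  proof eventually_elim
    case (elim \<zeta>)
    then show ?case using norm_triangle_ineq4[of "bdry \<phi> \<zeta>" "cnj (bdry f \<zeta>)"]
      unfolding complex_mod_cnj by linarith
  qed
  with C1(1) C2(1) show thesis by (intro that[of "C1 + C2"]) simp_all
qed

text \<open>The competitor \<open>0\<close> makes the infimum at most
  \<open>linf (bdry \<phi>)\<close>, so only the opposite inequality has content, and it can be
  tested on each \<open>f\<close> separately.\<close>

lemma saturated_iff:
  assumes \<phi>: "\<phi> \<in> Hinf"
  shows "saturated \<phi> \<longleftrightarrow> (\<forall>f\<in>Hinf0. linf (bdry \<phi>) \<le> linf (\<lambda>\<zeta>. bdry \<phi> \<zeta> - cnj (bdry f \<zeta>)))"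
proof -
  let ?L = "\<lambda>f. linf (\<lambda>\<zeta>. bdry \<phi> \<zeta> - cnj (bdry f \<zeta>))"
  have 0: "(\<lambda>_. 0) \<in> Hinf0" by (auto simp: Hinf0_def Hinf_def bounded_iff)
  have "bdry (\<lambda>_. 0) = (\<lambda>_. 0)" by (intro ext bdry_eqI) simp
  then have L0: "?L (\<lambda>_. 0) = linf (bdry \<phi>)" by simp
  have nn: "?L f \<ge> 0" if "f \<in> Hinf0" for f
  proof (rule bdry_diff_bounded[OF \<phi>, of f])
    show "f \<in> Hinf" using that by (simp add: Hinf0_def)
  qed (rule linf_nonneg)
  have bdd: "bdd_below (?L ` Hinf0)" using nn by (auto intro!: bdd_belowI[of _ 0])
  have "(INF f\<in>Hinf0. ?L f) \<le> linf (bdry \<phi>)" using cINF_lower[OF bdd 0] L0 by simp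
  then have "saturated \<phi> \<longleftrightarrow> linf (bdry \<phi>) \<le> (INF f\<in>Hinf0. ?L f)"
    unfolding saturated_def by auto
  also have "\<dots> \<longleftrightarrow> (\<forall>f\<in>Hinf0. linf (bdry \<phi>) \<le> ?L f)"
    using le_cINF_iff[OF _ bdd] 0 by auto
  finally show ?thesis .
qed

text \<open>On the arc \<open>2 Re (\<phi> f) \<ge> \<bar>\<phi>\<bar>\<^sup>2 - \<bar>\<phi> - cnj f\<bar>\<^sup>2 \<ge> M\<^sup>2 - C\<^sup>2\<close>.\<close>
lemma mult_bounded_below_near:
  assumes \<phi>: "\<phi> \<in> Hinf" and f: "f \<in> Hinf" and C: "0 \<le> C" "C < M"
    and le: "AE \<zeta> in circle_meas. cmod (bdry \<phi> \<zeta> - cnj (bdry f \<zeta>)) \<le> C"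
    and \<zeta>0: "cmod \<zeta>0 = 1" and d: "d > 0" and near: "AE \<zeta> in circle_meas. dist \<zeta> \<zeta>0 < d \<longrightarrow> M \<le> cmod (bdry \<phi> \<zeta>)"
  obtains e \<delta> where "e > 0" "\<delta> > 0" "\<And>z. z \<in> ball 0 1 \<Longrightarrow> dist z \<zeta>0 < \<delta> \<Longrightarrow> e \<le> cmod (\<phi> z * f z)"
proof -
  define F where "F z = \<phi> z * f z" for z
  have FH: "F \<in> Hinf" unfolding F_def by (rule Hinf_mult[OF \<phi> f])
  obtain g :: "complex \<Rightarrow> complex" where g: "integrable circle_meas g"
    "AE \<zeta> in circle_meas. bdry F \<zeta> = g \<zeta> \<and> radial_limit F \<zeta> (g \<zeta>)"
    "\<And>z. z \<in> ball 0 1 \<Longrightarrow> F z = (\<integral>\<zeta>. poisson z \<zeta> *\<^sub>R g \<zeta> \<partial>circle_meas)"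
    using Hinf_poisson_bdry[OF FH] by blast
  define c where "c = (M\<^sup>2 - C\<^sup>2) / 2"
  have c: "c > 0" using C by (simp add: c_def power_strict_mono)
  have low: "AE \<zeta> in circle_meas. dist \<zeta> \<zeta>0 < d \<longrightarrow> c \<le> Re (g \<zeta>)"
    using le near g(2) bdry_mult[OF \<phi> f]
  proof eventually_elim
    case (elim \<zeta>)
    show ?case
    proof
      assume "dist \<zeta> \<zeta>0 < d"
      then have "M \<le> cmod (bdry \<phi> \<zeta>)" using elim by blast
      then have 1: "M\<^sup>2 \<le> (cmod (bdry \<phi> \<zeta>))\<^sup>2" using C by (intro power_mono) auto
      have 2: "(cmod (bdry \<phi> \<zeta> - cnj (bdry f \<zeta>)))\<^sup>2 \<le> C\<^sup>2" using elim by (intro power_mono) auto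
      have "(cmod (bdry \<phi> \<zeta> - cnj (bdry f \<zeta>)))\<^sup>2 =
          (cmod (bdry \<phi> \<zeta>))\<^sup>2 - 2 * Re (bdry \<phi> \<zeta> * bdry f \<zeta>) + (cmod (bdry f \<zeta>))\<^sup>2"
        unfolding cmod_power2 by (simp add: power2_eq_square algebra_simps)
      then have "(cmod (bdry \<phi> \<zeta>))\<^sup>2 - 2 * Re (bdry \<phi> \<zeta> * bdry f \<zeta>) \<le> C\<^sup>2" using 2 by (smt (verit) zero_le_power2)
      moreover have "g \<zeta> = bdry \<phi> \<zeta> * bdry f \<zeta>" using elim by (simp add: F_def[abs_def])
      ultimately show "c \<le> Re (g \<zeta>)" using 1 by (simp add: c_def)
    qed
  qed
  have "eventually (\<lambda>z. c / 2 < poisson_int (\<lambda>\<zeta>. Re (g \<zeta>)) z) (at \<zeta>0 within ball 0 1)"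
    by (rule poisson_eventually_ge[OF _ d \<zeta>0 low]) (use g(1) c in auto)
  then obtain \<delta> where \<delta>: "\<delta> > 0" "\<And>z. z \<in> ball 0 1 \<Longrightarrow> z \<noteq> \<zeta>0 \<Longrightarrow> dist z \<zeta>0 < \<delta> \<Longrightarrow> c / 2 < poisson_int (\<lambda>\<zeta>. Re (g \<zeta>)) z"
    unfolding eventually_at by blast
  show thesis
  proof (rule that[of "c/2" \<delta>])
    fix z assume z: "z \<in> ball 0 1" "dist z \<zeta>0 < \<delta>"
    have nz: "cmod z < 1" using z by simp
    have "Re (F z) = (\<integral>\<zeta>. Re (poisson z \<zeta> *\<^sub>R g \<zeta>) \<partial>circle_meas)"
      unfolding g(3)[OF z(1)] by (rule integral_Re[symmetric, OF poisson_integrable_circle[OF g(1) nz]])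
    also have "\<dots> = poisson_int (\<lambda>\<zeta>. Re (g \<zeta>)) z" by simp
    finally have "c / 2 < Re (F z)" using \<delta>(2)[OF z(1) _ z(2)] nz \<zeta>0 by force
    then show "c / 2 \<le> cmod (\<phi> z * f z)" using complex_Re_le_cmod[of "F z"] by (simp add: F_def)
  qed (use c \<delta> in auto)
qed

text \<open>The \<open>k\<close> provided by \<open>outer\<close> is a priori unrelated to
  \<open>h\<close>. On almost every radius \<open>|\<Phi>|\<close> tends to
  \<open>exp (ln k)\<close>, \<open>|I|\<close> to \<open>1\<close> and \<open>|\<phi>|\<close> to
  \<open>h\<close>, so comparing limits in \<open>|\<phi>| = |\<Phi>| |I|\<close> identifies
  them.\<close>

lemma outer_boundary_modulus:
  assumes \<phi>: "\<phi> \<in> Hinf" and I: "inner I" and \<Phi>: "outer \<Phi>"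
    and eq: "\<forall>z\<in>ball 0 1. \<phi> z = \<Phi> z * I z"
    and h: "AE \<zeta> in circle_meas. cmod (bdry \<phi> \<zeta>) = h \<zeta>"
  obtains c k where "cmod c = 1" "\<And>\<zeta>. k \<zeta> > 0" "integrable circle_meas (\<lambda>\<zeta>. ln (k \<zeta>))"
    "AE \<zeta> in circle_meas. k \<zeta> = h \<zeta>"
    "\<And>z. z \<in> ball 0 1 \<Longrightarrow> \<Phi> z = c * exp (\<integral>\<zeta>. (\<zeta> + z) / (\<zeta> - z) * of_real (ln (k \<zeta>)) \<partial>circle_meas)"
proof -
  obtain c k where ck: "cmod c = 1" "\<And>\<zeta>. k \<zeta> > 0" "integrable circle_meas (\<lambda>\<zeta>. ln (k \<zeta>))"
    "\<And>z. z \<in> ball 0 1 \<Longrightarrow> \<Phi> z = c * exp (\<integral>\<zeta>. (\<zeta> + z) / (\<zeta> - z) * of_real (ln (k \<zeta>)) \<partial>circle_meas)"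
    using \<Phi> unfolding outer_def by blast
  have mod: "cmod (\<Phi> z) = exp (poisson_int (\<lambda>\<zeta>. ln (k \<zeta>)) z)" if "z \<in> ball 0 1" for z
    using ck(1) ck(4)[OF that] Re_herglotz_integral[OF ck(3) sets_circle_meas AE_circle_meas_norm, of z] that
    by (simp add: norm_mult norm_exp_eq_Re)
  have IH: "I \<in> Hinf" and I1: "AE \<zeta> in circle_meas. cmod (bdry I \<zeta>) = 1" using I by (auto simp: inner_def)
  have "AE \<zeta> in circle_meas. k \<zeta> = h \<zeta>"
    using poisson_radial_limit[OF ck(3)] Hinf_radial_limit[OF IH] Hinf_radial_limit[OF \<phi>] I1 h AE_circle_meas_norm
  proof eventually_elim
    case (elim \<zeta>)
    have "((\<lambda>r::real. exp (poisson_int (\<lambda>\<xi>. ln (k \<xi>)) (of_real r * \<zeta>)) * cmod (I (of_real r * \<zeta>)))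
       \<longlongrightarrow> exp (ln (k \<zeta>)) * cmod (bdry I \<zeta>)) (at_left 1)"
      by (intro tendsto_intros elim)
    moreover have "eventually (\<lambda>r::real. exp (poisson_int (\<lambda>\<xi>. ln (k \<xi>)) (of_real r * \<zeta>)) * cmod (I (of_real r * \<zeta>))
       = cmod (\<phi> (of_real r * \<zeta>))) (at_left 1)"
      using eventually_radius[OF elim(6)] by eventually_elim (use mod eq in \<open>simp add: norm_mult\<close>)
    ultimately have "((\<lambda>r::real. cmod (\<phi> (of_real r * \<zeta>))) \<longlongrightarrow> exp (ln (k \<zeta>)) * cmod (bdry I \<zeta>)) (at_left 1)"
      by (rule Lim_transform_eventually)
    moreover have "((\<lambda>r::real. cmod (\<phi> (of_real r * \<zeta>))) \<longlongrightarrow> cmod (bdry \<phi> \<zeta>)) (at_left 1)"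
      by (intro tendsto_intros elim)
    ultimately have "exp (ln (k \<zeta>)) * cmod (bdry I \<zeta>) = cmod (bdry \<phi> \<zeta>)"
      by (rule tendsto_unique[rotated]) simp
    then show ?case using elim ck(2)[of \<zeta>] by simp
  qed
  then show thesis using that ck by blast
qed

lemma norm_exp_herglotz_le:
  fixes w :: "complex \<Rightarrow> real"
  assumes w: "integrable circle_meas w" and le: "AE \<zeta> in circle_meas. w \<zeta> \<le> C" and z: "z \<in> ball 0 1"
  shows "cmod (exp (\<integral>\<zeta>. (\<zeta> + z) / (\<zeta> - z) * of_real (w \<zeta>) \<partial>circle_meas)) \<le> exp C"
proof -
  have nz: "cmod z < 1" using z by simp
  have "poisson_int w z \<le> poisson_int (\<lambda>_. C) z"
  proof (rule integral_mono_AE)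
    show "AE \<zeta> in circle_meas. poisson z \<zeta> * w \<zeta> \<le> poisson z \<zeta> * C"
      using le by eventually_elim (use nz poisson_nonneg in \<open>auto intro!: mult_left_mono\<close>)
  qed (use poisson_integrable_circle[OF w nz] integrable_poisson[OF nz] in auto)
  also have "\<dots> = C" using integral_poisson[OF nz] by simp
  finally show ?thesis
    using Re_herglotz_integral[OF w sets_circle_meas AE_circle_meas_norm nz] by (simp add: norm_exp_eq_Re)
qed

section \<open>Approximation on proper closed subsets of the circle\<close>

text \<open>Radius \<open>2\<close> makes the approximants analytic across the closed unit disc,
  hence bounded on it and continuous up to the circle, while a pole of modulus \<open>2\<close> is
  still allowed; the pole pushing starts there.\<close>

definition disc_approx :: "complex set \<Rightarrow> (complex \<Rightarrow> complex) \<Rightarrow> bool" where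
  "disc_approx K f \<longleftrightarrow> (\<forall>e>0. \<exists>g. g holomorphic_on ball 0 2 \<and> (\<forall>z\<in>K. cmod (f z - g z) < e))"

lemma disc_approx_holomorphic: "f holomorphic_on ball 0 2 \<Longrightarrow> disc_approx K f"
  unfolding disc_approx_def by (auto intro!: exI[of _ f])

lemma disc_approx_cong: "(\<And>z. z \<in> K \<Longrightarrow> f z = g z) \<Longrightarrow> disc_approx K f \<Longrightarrow> disc_approx K g"
  unfolding disc_approx_def by simp

lemma disc_approx_add:
  assumes "disc_approx K f" "disc_approx K g"
  shows "disc_approx K (\<lambda>z. f z + g z)"
  unfolding disc_approx_def
proof (intro allI impI)
  fix e :: real assume "e > 0"
  then obtain f' g' where "f' holomorphic_on ball 0 2" "\<forall>z\<in>K. cmod (f z - f' z) < e/2"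
    "g' holomorphic_on ball 0 2" "\<forall>z\<in>K. cmod (g z - g' z) < e/2"
    using assms unfolding disc_approx_def by (meson half_gt_zero)
  moreover from this have "cmod ((f z + g z) - (f' z + g' z)) < e" if "z \<in> K" for z
    using that norm_diff_triangle_less norm_triangle_ineq[of "f z - f' z" "g z - g' z"]
    by (smt (verit) add_diff_add field_sum_of_halves)
  ultimately show "\<exists>k. k holomorphic_on ball 0 2 \<and> (\<forall>z\<in>K. cmod (f z + g z - k z) < e)"
    by (intro exI[of _ "\<lambda>z. f' z + g' z"]) (auto intro!: holomorphic_intros)
qed

lemma holomorphic_bounded_on:
  assumes "g holomorphic_on ball 0 2" "K \<subseteq> sphere 0 1"
  obtains B where "B > 0" "\<And>z. z \<in> K \<Longrightarrow> cmod (g z) \<le> B"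
proof -
  have "continuous_on (sphere 0 1) g"
    by (rule continuous_on_subset[OF holomorphic_on_imp_continuous_on[OF assms(1)]]) auto
  then show thesis using compact_continuous_bounded[OF compact_sphere] that assms(2) by (metis subsetD)
qed

lemma disc_approx_mult:
  assumes f: "disc_approx K f" and g: "disc_approx K g" and K: "K \<subseteq> sphere 0 1"
  shows "disc_approx K (\<lambda>z. f z * g z)"
  unfolding disc_approx_def
proof (intro allI impI)
  fix e :: real assume e: "e > 0"
  \<comment> \<open>Neither \<open>f\<close> nor \<open>g\<close> is assumed bounded on
    \<open>K\<close>; boundedness is read off from one coarse approximant. The tolerance for
    \<open>g\<close> is fixed last because it depends on the bound \<open>A\<close> of
    \<open>f'\<close>.\<close>
  obtain g1 where g1: "g1 holomorphic_on ball 0 2" "\<And>z. z \<in> K \<Longrightarrow> cmod (g z - g1 z) < 1"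
    using g unfolding disc_approx_def by (meson zero_less_one)
  obtain B where B: "B > 0" "\<And>z. z \<in> K \<Longrightarrow> cmod (g1 z) \<le> B" using holomorphic_bounded_on[OF g1(1) K] by blast
  have gB: "cmod (g z) \<le> B + 1" if "z \<in> K" for z
    using B(2)[OF that] g1(2)[OF that] norm_triangle_ineq2[of "g z" "g1 z"] by linarith
  define e1 where "e1 = e / 2 / (B + 1)"
  have e1: "e1 > 0" using e B by (simp add: e1_def)
  obtain f' where f': "f' holomorphic_on ball 0 2" "\<And>z. z \<in> K \<Longrightarrow> cmod (f z - f' z) < e1"
    using f e1 unfolding disc_approx_def by meson
  obtain A where A: "A > 0" "\<And>z. z \<in> K \<Longrightarrow> cmod (f' z) \<le> A" using holomorphic_bounded_on[OF f'(1) K] by blast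
  define e2 where "e2 = e / (2 * A)"
  have e2: "e2 > 0" using e A by (simp add: e2_def)
  obtain g' where g': "g' holomorphic_on ball 0 2" "\<And>z. z \<in> K \<Longrightarrow> cmod (g z - g' z) < e2"
    using g e2 unfolding disc_approx_def by meson
  have "cmod (f z * g z - f' z * g' z) < e" if z: "z \<in> K" for z
  proof -
    have "f z * g z - f' z * g' z = (f z - f' z) * g z + f' z * (g z - g' z)" by (simp add: algebra_simps)
    then have "cmod (f z * g z - f' z * g' z) \<le> cmod (f z - f' z) * cmod (g z) + cmod (f' z) * cmod (g z - g' z)"
      by (metis norm_mult norm_triangle_ineq)
    also have "cmod (f z - f' z) * cmod (g z) \<le> e1 * (B + 1)"
      using f'(2)[OF z] gB[OF z] e1 by (intro mult_mono) auto
    also have "e1 * (B + 1) = e / 2" by (rule nonzero_eq_divide_eq[THEN iffD1, OF _ e1_def]) (use B in simp)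
    also have "cmod (f' z) * cmod (g z - g' z) < A * e2"
      by (rule order_le_less_trans[OF mult_right_mono[OF A(2)[OF z] norm_ge_zero] mult_strict_left_mono[OF g'(2)[OF z] A(1)]])
    also have "A * e2 = e / 2" using A by (simp add: e2_def)
    finally show ?thesis by simp
  qed
  then show "\<exists>k. k holomorphic_on ball 0 2 \<and> (\<forall>z\<in>K. cmod (f z * g z - k z) < e)"
    using f' g' by (intro exI[of _ "\<lambda>z. f' z * g' z"]) (auto intro!: holomorphic_intros)
qed

lemma disc_approx_limit:
  assumes "\<And>e. e > 0 \<Longrightarrow> \<exists>g. disc_approx K g \<and> (\<forall>z\<in>K. cmod (f z - g z) < e)"
  shows "disc_approx K f"
  unfolding disc_approx_def
proof (intro allI impI)
  fix e :: real assume e: "e > 0"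
  obtain g where g: "disc_approx K g" "\<And>z. z \<in> K \<Longrightarrow> cmod (f z - g z) < e/2" using assms[of "e/2"] e by auto
  obtain k where k: "k holomorphic_on ball 0 2" "\<And>z. z \<in> K \<Longrightarrow> cmod (g z - k z) < e/2"
    using g(1) e unfolding disc_approx_def by (meson half_gt_zero)
  have "cmod (f z - k z) < e" if "z \<in> K" for z
    using g(2)[OF that] k(2)[OF that] norm_triangle_ineq[of "f z - g z" "g z - k z"] by simp
  then show "\<exists>k. k holomorphic_on ball 0 2 \<and> (\<forall>z\<in>K. cmod (f z - k z) < e)" using k by blast
qed

lemma disc_approx_const: "disc_approx K (\<lambda>_. c)"
  by (rule disc_approx_holomorphic) (rule holomorphic_on_const)

lemma disc_approx_power:
  assumes "disc_approx K f" "K \<subseteq> sphere 0 1" shows "disc_approx K (\<lambda>z. f z ^ n)"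
proof (induction n)
  case (Suc n)
  show ?case using disc_approx_mult[OF assms(1) Suc assms(2)] by simp
qed (simp add: disc_approx_const)

lemma disc_approx_sum:
  fixes n :: nat
  assumes "\<And>i. i < n \<Longrightarrow> disc_approx K (f i)" shows "disc_approx K (\<lambda>z. \<Sum>i<n. f i z)"
  using assms
proof (induction n)
  case (Suc n)
  have "disc_approx K (\<lambda>z. \<Sum>i<n. f i z)" by (rule Suc.IH) (use Suc.prems in simp)
  then show ?case using disc_approx_add Suc.prems[of n] by simp
qed (simp add: disc_approx_const)

text \<open>Runge's pole pushing: expand \<open>1 / (z - q)\<close> into a geometric series in \<open>1 / (z - p)\<close>.\<close>
lemma disc_approx_push_pole:
  assumes p: "disc_approx K (\<lambda>z. 1 / (z - p))" and K: "K \<subseteq> sphere 0 1"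
    and d: "\<And>z. z \<in> K \<Longrightarrow> d \<le> cmod (z - p)" and q: "cmod (q - p) < d"
  shows "disc_approx K (\<lambda>z. 1 / (z - q))"
proof (rule disc_approx_limit)
  fix e :: real assume e: "e > 0"
  define \<rho> where "\<rho> = cmod (q - p) / d"
  have d0: "d > 0" using q norm_ge_zero[of "q - p"] by linarith
  have \<rho>: "0 \<le> \<rho>" "\<rho> < 1" using q d0 by (auto simp: \<rho>_def)
  have "(\<lambda>m. \<rho> ^ m / (d - cmod (q - p))) \<longlonglongrightarrow> 0 / (d - cmod (q - p))"
    using \<rho> q by (intro tendsto_intros LIMSEQ_realpow_zero) auto
  then have "eventually (\<lambda>m. \<rho> ^ m / (d - cmod (q - p)) < e) sequentially"
    by (rule order_tendstoD(2)) (use e in simp)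
  then obtain m where m: "\<rho> ^ m / (d - cmod (q - p)) < e" by (auto simp: eventually_sequentially)
  define g where "g z = (\<Sum>n<m. (q - p) ^ n * (1 / (z - p)) ^ Suc n)" for z
  have "disc_approx K g" unfolding g_def
    by (intro disc_approx_sum disc_approx_mult disc_approx_const disc_approx_power p K)
  moreover have "cmod (1 / (z - q) - g z) < e" if z: "z \<in> K" for z
  proof -
    define x where "x = (q - p) / (z - p)"
    have zp: "z - p \<noteq> 0" using d[OF z] d0 by auto
    have dq: "d - cmod (q - p) \<le> cmod (z - q)"
      using d[OF z] norm_triangle_ineq2[of "z - p" "q - p"] by simp
    then have zq: "z - q \<noteq> 0" using q by auto
    have x1: "1 - x = (z - q) / (z - p)" using zp by (simp add: x_def field_simps)
    then have "1 - x \<noteq> 0" using zp zq by simp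
    have "g z = (1 / (z - p)) * (\<Sum>n<m. x ^ n)"
      unfolding g_def sum_distrib_left by (intro sum.cong) (auto simp: x_def power_divide)
    also have "(\<Sum>n<m. x ^ n) = (1 - x ^ m) / (1 - x)" using \<open>1 - x \<noteq> 0\<close> by (simp add: sum_gp_strict)
    also have "(1 / (z - p)) * ((1 - x ^ m) / (1 - x)) = (1 - x ^ m) / (z - q)"
      unfolding x1 using zp by simp
    finally have "1 / (z - q) - g z = x ^ m / (z - q)" by (simp add: diff_divide_distrib)
    then have "cmod (1 / (z - q) - g z) = cmod x ^ m / cmod (z - q)" by (simp add: norm_divide norm_power)
    also have "\<dots> \<le> \<rho> ^ m / (d - cmod (q - p))"
    proof (intro frac_le power_mono)
      show "cmod x \<le> \<rho>" unfolding x_def \<rho>_def norm_divide using d[OF z] d0 zp by (intro divide_left_mono mult_pos_pos) auto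
    qed (use \<rho> q dq in auto)
    finally show ?thesis using m by simp
  qed
  ultimately show "\<exists>g. disc_approx K g \<and> (\<forall>z\<in>K. cmod (1 / (z - q) - g z) < e)" by blast
qed

text \<open>The pole is moved from \<open>2 \<zeta>1\<close>, where
  \<open>1 / (z - 2 \<zeta>1)\<close> is analytic in the disc of radius \<open>2\<close>, along the
  ray through the gap at \<open>\<zeta>1\<close> to \<open>0\<close>. The ray is compact and misses
  \<open>K\<close>, so a single step size works throughout.\<close>

lemma disc_approx_inverse:
  assumes K: "compact K" "K \<subseteq> sphere 0 1" and \<zeta>1: "cmod \<zeta>1 = 1" "\<zeta>1 \<notin> K"
  shows "disc_approx K (\<lambda>z. 1 / z)"
proof -
  define L where "L = (\<lambda>t. of_real t * \<zeta>1) ` {0..2::real}"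
  have "compact L" unfolding L_def by (intro compact_continuous_image continuous_intros) auto
  moreover have "K \<inter> L = {}"
  proof -
    have False if "t \<in> {0..2}" "of_real t * \<zeta>1 \<in> K" for t :: real
    proof -
      have "cmod (of_real t * \<zeta>1) = 1" using that K by auto
      then have "t = 1" using that \<zeta>1 by (simp add: norm_mult)
      then show False using that \<zeta>1 by simp
    qed
    then show ?thesis unfolding L_def by blast
  qed
  ultimately obtain d where d: "d > 0" "\<forall>x\<in>K. \<forall>y\<in>L. d \<le> dist x y"
    using separate_compact_closed[OF K(1), of L] compact_imp_closed by blast
  \<comment> \<open>The ray has length \<open>2\<close>, so \<open>n\<close> steps of length
    \<open>2 / n < d\<close> reach \<open>0\<close>, each within the range of
    \<open>disc_approx_push_pole\<close>.\<close>
  obtain n :: nat where n: "2 / d < real n" using reals_Archimedean2 by blast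
  have n0: "n > 0" using n d by (cases n) auto
  define t where "t k = 2 - 2 * real k / real n" for k
  have "k \<le> n \<Longrightarrow> disc_approx K (\<lambda>z. 1 / (z - of_real (t k) * \<zeta>1))" for k
  proof (induction k)
    case 0
    have "z - of_real 2 * \<zeta>1 \<noteq> 0" if "z \<in> ball 0 2" for z
      using that \<zeta>1 by (auto simp: norm_mult)
    then show ?case by (intro disc_approx_holomorphic holomorphic_intros) (simp add: t_def)
  next
    case (Suc k)
    show ?case
    proof (rule disc_approx_push_pole[OF Suc.IH K(2)])
      have "t k \<in> {0..2}" using Suc.prems n0 by (simp add: t_def field_simps)
      then show "d \<le> cmod (z - of_real (t k) * \<zeta>1)" if "z \<in> K" for z
        using d(2) that by (auto simp: L_def dist_norm)
      have "of_real (t (Suc k)) * \<zeta>1 - of_real (t k) * \<zeta>1 = of_real (- 2 / real n) * \<zeta>1"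
        by (simp add: t_def algebra_simps add_divide_distrib diff_divide_distrib)
      then have "cmod (of_real (t (Suc k)) * \<zeta>1 - of_real (t k) * \<zeta>1) = 2 / real n"
        using \<zeta>1 n0 by (simp only: norm_mult norm_of_real) simp
      also have "\<dots> < d" using n d n0 by (simp add: field_simps)
      finally show "cmod (of_real (t (Suc k)) * \<zeta>1 - of_real (t k) * \<zeta>1) < d" .
    qed (use Suc.prems in simp)
  qed
  from this[of n] show ?thesis using n0 by (simp add: t_def)
qed

text \<open>On the circle \<open>cnj z = 1 / z\<close>, so the algebra of approximable functions
  contains \<open>z\<close> and \<open>cnj z\<close>, hence all polynomials in the real coordinates,
  and Stone-Weierstrass finishes. The gap \<open>\<zeta>1\<close> enters only through
  \<open>1 / z\<close>.\<close>

lemma disc_approx_continuous: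
  assumes K: "compact K" "K \<subseteq> sphere 0 1" and \<zeta>1: "cmod \<zeta>1 = 1" "\<zeta>1 \<notin> K" and f: "continuous_on K f"
  shows "disc_approx K f"
proof -
  have id: "disc_approx K (\<lambda>z. z)" by (rule disc_approx_holomorphic) (rule holomorphic_on_ident)
  have cnj: "disc_approx K cnj"
  proof (rule disc_approx_cong[OF _ disc_approx_inverse[OF K \<zeta>1]])
    fix z assume "z \<in> K"
    then have "z * cnj z = 1" "z \<noteq> 0" using K complex_norm_square[of z] by auto
    then show "1 / z = cnj z" by (simp add: field_simps)
  qed
  have real: "disc_approx K (\<lambda>z. of_real (p z))" if "real_polynomial_function p" for p :: "complex \<Rightarrow> real"
    using that
  proof (induction rule: real_polynomial_function.induct)
    case (linear p)
    interpret bounded_linear p by fact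
    \<comment> \<open>A real-linear form is \<open>p 1 * Re z + p \<i> * Im z\<close>, here with
      both coordinates expressed by \<open>z\<close> and \<open>cnj z\<close>.\<close>
    have eq: "(of_real (p 1) / 2) * (z + cnj z) + (of_real (p \<i>) / (2 * \<i>)) * (z + (- 1) * cnj z) = of_real (p z)" for z
    proof -
      have "p z = p (Re z *\<^sub>R 1 + Im z *\<^sub>R \<i>)" by (simp add: scaleR_conv_of_real complex_eq[symmetric] mult.commute)
      also have "\<dots> = Re z * p 1 + Im z * p \<i>" by (simp only: add scaleR) simp
      finally show ?thesis by (intro complex_eqI) (simp_all add: complex_eq_iff Re_divide Im_divide)
    qed
    show ?case
      by (rule disc_approx_cong[OF eq]) (intro disc_approx_add disc_approx_mult disc_approx_const id cnj K)
  next
    case (const c)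
    then show ?case by (simp add: disc_approx_const)
  next
    case (add p q)
    then show ?case by (simp add: disc_approx_add)
  next
    case (mult p q)
    then show ?case using K by (simp add: disc_approx_mult)
  qed
  show ?thesis
  proof (rule disc_approx_limit)
    fix e :: real assume "e > 0"
    then obtain g :: "complex \<Rightarrow> complex" where g: "polynomial_function g" "\<forall>x\<in>K. cmod (f x - g x) < e"
      using Stone_Weierstrass_polynomial_function[OF K(1) f] by blast
    have "real_polynomial_function (Re \<circ> g)" "real_polynomial_function (Im \<circ> g)"
      using g(1) bounded_linear_Re bounded_linear_Im unfolding polynomial_function_def by blast+
    then have "disc_approx K (\<lambda>z. of_real ((Re \<circ> g) z) + \<i> * of_real ((Im \<circ> g) z))"
      by (intro disc_approx_add disc_approx_mult disc_approx_const real K)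
    then have "disc_approx K g" by (rule disc_approx_cong[rotated]) (simp add: complex_eq[symmetric])
    then show "\<exists>g. disc_approx K g \<and> (\<forall>z\<in>K. cmod (f z - g z) < e)" using g(2) by blast
  qed
qed

section \<open>Analytic continuation of inner functions off the spectrum\<close>

text \<open>The real part is the Poisson kernel, whose numerator \<open>1 - |z|^2\<close> vanishes
  on the circle. At coinciding points the quotient is \<open>0\<close> by the convention for
  division by zero.\<close>

lemma Re_herglotz_kernel_circle:
  assumes "cmod \<zeta> = 1" "cmod \<xi> = 1" shows "Re ((\<xi> + \<zeta>) / (\<xi> - \<zeta>)) = 0"
proof (cases "\<xi> = \<zeta>")
  case False
  have "poisson \<zeta> \<xi> = 0" using assms by (simp add: poisson_def)
  then show ?thesis using poisson_eq_Re[OF assms(2), of \<zeta>] False by metis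
qed simp

text \<open>When the kernel is not integrable, the integral is \<open>0\<close> by convention.\<close>
lemma Re_herglotz_integral_circle:
  fixes w :: "complex \<Rightarrow> real"
  assumes AE: "AE \<zeta> in \<mu>. cmod \<zeta> = 1" and z: "cmod z = 1"
  shows "Re (\<integral>\<zeta>. (\<zeta> + z) / (\<zeta> - z) * of_real (w \<zeta>) \<partial>\<mu>) = 0"
proof (cases "integrable \<mu> (\<lambda>\<zeta>. (\<zeta> + z) / (\<zeta> - z) * of_real (w \<zeta>))")
  case True
  have "(\<integral>\<zeta>. Re ((\<zeta> + z) / (\<zeta> - z) * of_real (w \<zeta>)) \<partial>\<mu>) = 0"
  proof (rule integral_eq_zero_AE)
    show "AE \<zeta> in \<mu>. Re ((\<zeta> + z) / (\<zeta> - z) * of_real (w \<zeta>)) = 0"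
      using AE
    proof eventually_elim
      case (elim \<zeta>)
      have "Re ((\<zeta> + z) / (\<zeta> - z) * of_real (w \<zeta>)) = Re ((\<zeta> + z) / (\<zeta> - z)) * w \<zeta>"
        by (simp only: times_complex.sel Re_complex_of_real Im_complex_of_real mult_zero_right diff_zero)
      then show ?case using Re_herglotz_kernel_circle[OF z elim] by simp
    qed
  qed
  then show ?thesis using integral_Re[OF True] by simp
qed (simp add: not_integrable_integral_eq)

text \<open>Off the spectrum the zeros do not accumulate, so the Blaschke product continues
  analytically, and the singular measure has no mass nearby, so its Herglotz integral continues too.
  On \<open>K\<close> each factor of the continuation has modulus \<open>1\<close>.\<close>

lemma inner_extends_off_spectrum:
  assumes I: "inner I" and K: "K \<subseteq> sphere 0 1" "K \<inter> inner_spectrum I = {}"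
  obtains U J where "open U" "ball 0 1 \<subseteq> U" "K \<subseteq> U" "J holomorphic_on U"
    "\<And>z. z \<in> ball 0 1 \<Longrightarrow> J z = I z" "\<And>\<zeta>. \<zeta> \<in> K \<Longrightarrow> cmod (J \<zeta>) = 1"
proof (rule canonical_factorization[OF I])
  fix c m N a \<mu> assume cf: "cmod c = 1" "blaschke_zeros N a" "\<And>n. n \<in> N \<Longrightarrow> I (a n) = 0" "singular_measure \<mu>"
    "\<And>z. z \<in> ball 0 1 \<Longrightarrow> I z = c * (z ^ m * blaschke_zeros.bprod N a z) * singular_inner \<mu> z"
  interpret blaschke_zeros N a by fact
  have fin: "finite_measure \<mu>" and sets: "sets \<mu> = sets borel" and sph: "emeasure \<mu> (- sphere 0 1) = 0"
    using cf(4) by (auto simp: singular_measure_def)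
  interpret \<mu>: finite_measure \<mu> by fact
  have AE: "AE \<zeta> in \<mu>. cmod \<zeta> = 1" by (rule AE_norm_eq_1[OF sets sph])
  have Kreg: "K \<subseteq> regular"
  proof
    fix \<zeta> assume \<zeta>: "\<zeta> \<in> K"
    then have n1: "cmod \<zeta> = 1" using K by auto
    have "\<not> \<zeta> islimpt {z \<in> ball 0 1. I z = 0}" using \<zeta> K(2) n1 by (auto simp: inner_spectrum_def)
    then obtain e where e0: "e > 0" "\<not> (\<exists>z\<in>{z \<in> ball 0 1. I z = 0}. z \<noteq> \<zeta> \<and> dist z \<zeta> < e)"
      unfolding islimpt_approachable by blast
    have e: "e > 0" "\<And>z. z \<in> ball 0 1 \<Longrightarrow> I z = 0 \<Longrightarrow> z \<noteq> \<zeta> \<Longrightarrow> e \<le> dist z \<zeta>"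
      using e0 by (auto simp: not_less)
    show "\<zeta> \<in> regular"
    proof (rule sphere_regularI[OF n1 e(1)])
      fix n assume n: "n \<in> N"
      then have "a n \<noteq> \<zeta>" using a n1 by fastforce
      then show "e \<le> dist (a n) \<zeta>" using e(2) cf(3)[OF n] a[OF n] by simp
    qed
  qed
  define E where "E = away \<mu> (\<lambda>_. 1)"
  have KE: "K \<subseteq> E"
  proof
    fix \<zeta> assume \<zeta>: "\<zeta> \<in> K"
    then have "\<zeta> \<notin> inner_spectrum I" using K by blast
    \<comment> \<open>\<open>inner_spectrum\<close> quantifies existentially over factorisations, so
      lying outside it excludes the support of the particular \<open>\<mu>\<close> at hand.\<close>
    then have "\<zeta> \<notin> measure_support \<mu>"
      unfolding inner_spectrum_def using cf(1,4,5) blaschke_zeros_imp_blaschke[OF cf(2)] by blast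
    then obtain e where e: "e > 0" "emeasure \<mu> (ball \<zeta> e) = 0" by (auto simp: measure_support_def)
    then have "ball \<zeta> e \<in> null_sets \<mu>" using sets by (auto simp: null_sets_def)
    then have "AE \<xi> in \<mu>. \<xi> \<notin> ball \<zeta> e" by (rule AE_not_in)
    then have "AE \<xi> in \<mu>. (1::complex) = 0 \<or> e \<le> dist \<xi> \<zeta>" by eventually_elim (simp add: dist_commute)
    then show "\<zeta> \<in> E" unfolding E_def by (rule awayI[OF e(1)])
  qed
  define S where "S = herglotz \<mu> (\<lambda>_. 1)"
  have hS: "S holomorphic_on E" unfolding S_def E_def by (rule herglotz_holomorphic[OF _ sets AE]) simp
  define U where "U = regular \<inter> E"
  define J where "J z = c * (z ^ m * bprod z) * exp (- S z)" for z
  show thesis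
  proof (rule that[of U J])
    show "open U" unfolding U_def E_def by (intro open_Int open_regular open_away)
    show "ball 0 1 \<subseteq> U" "K \<subseteq> U"
      unfolding U_def using disc_subset_regular disc_subset_away[OF AE] Kreg KE by (auto simp: E_def)
    show "J holomorphic_on U" unfolding J_def U_def
      by (intro holomorphic_intros holomorphic_on_subset[OF bprod_holomorphic] holomorphic_on_subset[OF hS]) auto
    show "J z = I z" if "z \<in> ball 0 1" for z
      using cf(5)[OF that] by (simp add: J_def S_def singular_inner_def)
    fix \<zeta> assume \<zeta>: "\<zeta> \<in> K"
    then have n1: "cmod \<zeta> = 1" using K by auto
    have "Re (S \<zeta>) = 0" using Re_herglotz_integral_circle[OF AE n1, of "\<lambda>_. 1"] by (simp add: S_def)
    moreover have "cmod (bprod \<zeta>) = 1" using norm_bprod_eq_1 Kreg \<zeta> n1 by auto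
    ultimately show "cmod (J \<zeta>) = 1" using cf(1) n1 by (simp add: J_def norm_mult norm_power norm_exp_eq_Re)
  qed
qed

section \<open>Saturation\<close>

lemma saturated_if_max_on_spectrum:
  assumes \<phi>: "\<phi> \<in> Hinf" and I: "inner I" and \<Phi>: "outer \<Phi>"
    and eq: "\<forall>z\<in>ball 0 1. \<phi> z = \<Phi> z * I z"
    and h: "continuous_on (sphere 0 1) h" and bh: "AE \<zeta> in circle_meas. cmod (bdry \<phi> \<zeta>) = h \<zeta>"
    and \<zeta>0: "\<zeta>0 \<in> sphere 0 1" "\<zeta>0 \<in> inner_spectrum I" "\<And>\<zeta>. \<zeta> \<in> sphere 0 1 \<Longrightarrow> h \<zeta> \<le> h \<zeta>0"
    and pos: "h \<zeta>0 > 0"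
  shows "saturated \<phi>"
  unfolding saturated_iff[OF \<phi>]
proof (rule ballI, rule ccontr)
  fix f assume f: "f \<in> Hinf0" and neg: "\<not> linf (bdry \<phi>) \<le> linf (\<lambda>\<zeta>. bdry \<phi> \<zeta> - cnj (bdry f \<zeta>))"
  define M where "M = h \<zeta>0"
  have n1: "cmod \<zeta>0 = 1" using \<zeta>0 by simp
  have fH: "f \<in> Hinf" using f by (simp add: Hinf0_def)
  have "linf (bdry \<phi>) = M" unfolding M_def by (rule linf_eq_max[OF h bh \<zeta>0(1,3)]) (use pos in auto)
  then have lt: "linf (\<lambda>\<zeta>. bdry \<phi> \<zeta> - cnj (bdry f \<zeta>)) < M" using neg by simp
  obtain B where B: "B \<ge> 0" "AE \<zeta> in circle_meas. cmod (bdry \<phi> \<zeta> - cnj (bdry f \<zeta>)) \<le> B"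
    by (rule bdry_diff_bounded[OF \<phi> fH])
  obtain C where C: "C \<ge> 0" "C < M" "AE \<zeta> in circle_meas. cmod (bdry \<phi> \<zeta> - cnj (bdry f \<zeta>)) \<le> C"
    by (rule linf_lessD[OF B(2,1) lt])
  \<comment> \<open>A level strictly between \<open>C\<close> and \<open>M\<close>: by continuity
    \<open>|\<phi>|\<close> stays above it on an arc around \<open>\<zeta>0\<close>, leaving the
    positive gap \<open>M'^2 - C^2\<close>.\<close>
  define M' where "M' = (C + M) / 2"
  have M': "C < M'" "M' < M" using C by (auto simp: M'_def)
  then have "M - M' > 0" by simp
  then obtain d where d: "d > 0" "\<And>\<zeta>. \<zeta> \<in> sphere 0 1 \<Longrightarrow> dist \<zeta> \<zeta>0 < d \<Longrightarrow> dist (h \<zeta>) (h \<zeta>0) < M - M'"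
    using h \<zeta>0(1) unfolding continuous_on_iff by blast
  have near: "AE \<zeta> in circle_meas. dist \<zeta> \<zeta>0 < d \<longrightarrow> M' \<le> cmod (bdry \<phi> \<zeta>)"
    using bh AE_circle_meas_sphere
  proof eventually_elim
    case (elim \<zeta>)
    then show ?case using d(2)[of \<zeta>] by (auto simp: dist_real_def M_def abs_less_iff)
  qed
  obtain e \<delta> where e: "e > 0" "\<delta> > 0" "\<And>z. z \<in> ball 0 1 \<Longrightarrow> dist z \<zeta>0 < \<delta> \<Longrightarrow> e \<le> cmod (\<phi> z * f z)"
    by (rule mult_bounded_below_near[OF \<phi> fH C(1) M'(1) C(3) n1 d(1) near]) (rule that)
  obtain Cf where Cf: "Cf \<ge> 0" "\<And>z. z \<in> ball 0 1 \<Longrightarrow> cmod (f z) \<le> Cf"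
    by (rule Hinf_bdry_bounded[OF fH]) (rule that)
  obtain c k where ck: "cmod c = 1" "\<And>\<zeta>. k \<zeta> > 0" "integrable circle_meas (\<lambda>\<zeta>. ln (k \<zeta>))"
    "AE \<zeta> in circle_meas. k \<zeta> = h \<zeta>"
    "\<And>z. z \<in> ball 0 1 \<Longrightarrow> \<Phi> z = c * exp (\<integral>\<zeta>. (\<zeta> + z) / (\<zeta> - z) * of_real (ln (k \<zeta>)) \<partial>circle_meas)"
    by (rule outer_boundary_modulus[OF \<phi> I \<Phi> eq bh]) (rule that)
  have lnk: "AE \<zeta> in circle_meas. ln (k \<zeta>) \<le> ln M"
    using ck(4) AE_circle_meas_sphere
  proof eventually_elim
    case (elim \<zeta>)
    then have "k \<zeta> \<le> M" using \<zeta>0(3)[of \<zeta>] by (simp add: M_def)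
    then show ?case using ck(2)[of \<zeta>] by simp
  qed
  have \<Phi>M: "cmod (\<Phi> z) \<le> M" if z: "z \<in> ball 0 1" for z
    using norm_exp_herglotz_le[OF ck(3) lnk z] ck(1) ck(5)[OF z] pos by (simp add: norm_mult M_def)
  \<comment> \<open>Makes \<open>M Cf |I z| < e\<close> at the point where \<open>I\<close> is
    small, contradicting \<open>|\<phi> f| \<ge> e\<close>; the \<open>+ 1\<close> guards against
    \<open>Cf = 0\<close>.\<close>
  define \<epsilon> where "\<epsilon> = min \<delta> (e / (M * Cf + 1))"
  have M0: "M > 0" using pos by (simp add: M_def)
  then have MC: "M * Cf + 1 > 0" using Cf(1) by (simp add: add_nonneg_pos)
  then have \<epsilon>: "\<epsilon> > 0" using e by (simp add: \<epsilon>_def)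
  obtain z where z: "z \<in> ball 0 1" "dist z \<zeta>0 < \<epsilon>" "cmod (I z) < \<epsilon>"
    using inner_small_near_spectrum[OF \<zeta>0(2) \<epsilon>] by blast
  have "e \<le> cmod (\<phi> z * f z)" using e(3)[OF z(1)] z(2) by (simp add: \<epsilon>_def)
  also have "\<dots> = (cmod (\<Phi> z) * cmod (f z)) * cmod (I z)" using eq z(1) by (simp add: norm_mult)
  also have "\<dots> \<le> (M * Cf) * cmod (I z)"
    using \<Phi>M[OF z(1)] Cf(2)[OF z(1)] M0 by (intro mult_right_mono mult_mono) auto
  also have "\<dots> \<le> (M * Cf) * (e / (M * Cf + 1))"
    using z(3) M0 Cf(1) by (intro mult_left_mono) (auto simp: \<epsilon>_def)
  also have "\<dots> < e"
  proof -
    have "(M * Cf) * e < e * (M * Cf + 1)" using e(1) by (simp add: algebra_simps)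
    then show ?thesis using MC by (simp add: divide_less_eq)
  qed
  finally show False by simp
qed

lemma not_saturated_if_max_off_spectrum:
  assumes \<phi>: "\<phi> \<in> Hinf" and I: "inner I" and \<Phi>: "outer \<Phi>"
    and eq: "\<forall>z\<in>ball 0 1. \<phi> z = \<Phi> z * I z"
    and h: "continuous_on (sphere 0 1) h" and bh: "AE \<zeta> in circle_meas. cmod (bdry \<phi> \<zeta>) = h \<zeta>"
    and \<zeta>1: "\<zeta>1 \<in> sphere 0 1" "\<And>\<zeta>. \<zeta> \<in> sphere 0 1 \<Longrightarrow> h \<zeta> \<le> h \<zeta>1" and pos: "h \<zeta>1 > 0"
    and \<zeta>2: "\<zeta>2 \<in> sphere 0 1" "h \<zeta>2 < h \<zeta>1"
    and off: "{\<zeta>\<in>sphere 0 1. h \<zeta>1 \<le> h \<zeta>} \<inter> inner_spectrum I = {}"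
  shows "\<not> saturated \<phi>"
proof -
  define M where "M = h \<zeta>1"
  have M0: "M > 0" using pos by (simp add: M_def)
  define K where "K = {\<zeta>\<in>sphere 0 1. M \<le> h \<zeta>}"
  have Ks: "K \<subseteq> sphere 0 1" by (auto simp: K_def)
  have "closed K" unfolding K_def
    using continuous_closed_preimage[OF h closed_sphere, of "{M..}"] by (simp add: vimage_def Int_def)
  then have Kc: "compact K" using Ks by (meson bounded_sphere bounded_subset compact_eq_bounded_closed)
  have \<zeta>2K: "cmod \<zeta>2 = 1" "\<zeta>2 \<notin> K" using \<zeta>2 by (auto simp: K_def M_def)
  have KI: "K \<inter> inner_spectrum I = {}" using off by (simp add: K_def M_def)
  obtain U J where U: "open U" "ball 0 1 \<subseteq> U" "K \<subseteq> U" and J: "J holomorphic_on U"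
    "\<And>z. z \<in> ball 0 1 \<Longrightarrow> J z = I z" "\<And>\<zeta>. \<zeta> \<in> K \<Longrightarrow> cmod (J \<zeta>) = 1"
    by (rule inner_extends_off_spectrum[OF I Ks KI]) (rule that)
  obtain c k where ck: "cmod c = 1" "\<And>\<zeta>. k \<zeta> > 0" "integrable circle_meas (\<lambda>\<zeta>. ln (k \<zeta>))"
    "AE \<zeta> in circle_meas. k \<zeta> = h \<zeta>"
    "\<And>z. z \<in> ball 0 1 \<Longrightarrow> \<Phi> z = c * exp (\<integral>\<zeta>. (\<zeta> + z) / (\<zeta> - z) * of_real (ln (k \<zeta>)) \<partial>circle_meas)"
    by (rule outer_boundary_modulus[OF \<phi> I \<Phi> eq bh]) (rule that)
  \<comment> \<open>\<open>\<Psi>\<close> is the outer function with modulus \<open>1 / max h (M/2)\<close>, so that \<open>\<Psi> \<Phi>\<close> is unimodular and analytic near \<open>K\<close>.\<close>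
  define w1 where "w1 \<zeta> = - max (ln (k \<zeta>)) (ln (M/2))" for \<zeta>
  have w1: "integrable circle_meas w1" unfolding w1_def using ck(3) by (intro integrable_minus integrable_max) auto
  \<comment> \<open>\<open>w2\<close> is the logarithm of the boundary modulus of
    \<open>\<Phi> \<Psi>\<close>. It is \<open>0\<close> wherever \<open>k \<ge> M/2\<close>, hence
    almost everywhere near \<open>K\<close>, and so its Herglotz integral continues across
    \<open>K\<close>.\<close>
  define w2 where "w2 \<zeta> = ln (k \<zeta>) + w1 \<zeta>" for \<zeta>
  have w2: "integrable circle_meas w2" unfolding w2_def using ck(3) w1 by auto
  define H where "H w = herglotz circle_meas (\<lambda>\<zeta>. of_real (w \<zeta>))" for w :: "complex \<Rightarrow> real"
  define \<Psi> where "\<Psi> z = exp (H w1 z)" for z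
  have Hadd: "H w2 z = H (\<lambda>\<zeta>. ln (k \<zeta>)) z + H w1 z" if "z \<in> ball 0 1" for z
  proof -
    have "integrable circle_meas (\<lambda>\<zeta>. (\<zeta> + z) / (\<zeta> - z) * complex_of_real (ln (k \<zeta>)))"
      "integrable circle_meas (\<lambda>\<zeta>. (\<zeta> + z) / (\<zeta> - z) * complex_of_real (w1 \<zeta>))"
      using ck(3) w1 subsetD[OF disc_subset_away[OF AE_circle_meas_norm] that]
      by (intro herglotz_kernel_integrable[OF _ sets_circle_meas AE_circle_meas_norm]; simp)+
    then show ?thesis unfolding H_def w2_def of_real_add distrib_left by (rule Bochner_Integration.integral_add)
  qed
  have \<Phi>\<Psi>: "\<Phi> z * \<Psi> z = c * exp (H w2 z)" if "z \<in> ball 0 1" for z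
    using ck(5)[OF that] Hadd[OF that] by (simp add: \<Psi>_def H_def exp_add)
  have \<Psi>H: "\<Psi> \<in> Hinf"
  proof -
    have "H w1 holomorphic_on ball 0 1" unfolding H_def
      by (rule herglotz_holomorphic_disc[OF _ sets_circle_meas AE_circle_meas_norm]) (use w1 in auto)
    then have "\<Psi> holomorphic_on ball 0 1" unfolding \<Psi>_def by (intro holomorphic_intros)
    moreover have "cmod (\<Psi> z) \<le> exp (- ln (M/2))" if "z \<in> ball 0 1" for z
      unfolding \<Psi>_def H_def by (rule norm_exp_herglotz_le[OF w1 _ that]) (simp add: w1_def)
    ultimately show ?thesis unfolding Hinf_def bounded_iff by blast
  qed
  define E where "E = away circle_meas (\<lambda>\<zeta>. complex_of_real (w2 \<zeta>))"
  have KE: "K \<subseteq> E"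
  proof
    fix \<zeta> assume \<zeta>: "\<zeta> \<in> K"
    then have "\<zeta> \<in> sphere 0 1" "M \<le> h \<zeta>" by (auto simp: K_def)
    moreover have "M/2 > 0" using M0 by simp
    ultimately obtain d where d: "d > 0" "\<And>\<xi>. \<xi> \<in> sphere 0 1 \<Longrightarrow> dist \<xi> \<zeta> < d \<Longrightarrow> dist (h \<xi>) (h \<zeta>) < M/2"
      using h unfolding continuous_on_iff by blast
    have "AE \<xi> in circle_meas. complex_of_real (w2 \<xi>) = 0 \<or> d \<le> dist \<xi> \<zeta>"
      using ck(4) AE_circle_meas_sphere
    proof eventually_elim
      case (elim \<xi>)
      have "w2 \<xi> = 0" if "dist \<xi> \<zeta> < d"
      proof -
        have "M/2 \<le> k \<xi>" using d(2)[OF elim(2) that] elim(1) \<open>M \<le> h \<zeta>\<close>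
          unfolding dist_real_def abs_less_iff by linarith
        then have "ln (M/2) \<le> ln (k \<xi>)" using M0 ck(2)[of \<xi>] by simp
        then show ?thesis by (simp add: w2_def w1_def)
      qed
      then show ?case by force
    qed
    then show "\<zeta> \<in> E" unfolding E_def by (rule awayI[OF d(1)])
  qed
  have hH: "H w2 holomorphic_on E" unfolding H_def E_def
    by (rule herglotz_holomorphic[OF _ sets_circle_meas AE_circle_meas_norm]) (use w2 in simp)
  define W where "W z = c * exp (H w2 z) * J z" for z
  define U' where "U' = U \<inter> E \<inter> ball 0 2"
  have oU': "open U'" unfolding U'_def E_def by (intro open_Int U open_away open_ball)
  have discU': "ball 0 1 \<subseteq> U'" and KU': "K \<subseteq> U'" unfolding U'_def using U disc_subset_away[OF AE_circle_meas_norm] KE Ks by (force simp: E_def)+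
  have hW: "W holomorphic_on U'" unfolding W_def U'_def
    by (intro holomorphic_intros holomorphic_on_subset[OF J(1)] holomorphic_on_subset[OF hH]) auto
  have W1: "cmod (W \<zeta>) = 1" if "\<zeta> \<in> K" for \<zeta>
  proof -
    have "cmod \<zeta> = 1" using that Ks by auto
    then have "Re (H w2 \<zeta>) = 0" unfolding H_def by (rule Re_herglotz_integral_circle[OF AE_circle_meas_norm])
    then show ?thesis using ck(1) J(3)[OF that] by (simp add: W_def norm_mult norm_exp_eq_Re)
  qed
  have W\<phi>: "\<phi> z * \<Psi> z = W z" if "z \<in> ball 0 1" for z
    using eq that \<Phi>\<Psi>[OF that] J(2)[OF that] by (simp add: W_def mult_ac)
  have contW: "continuous_on K W"
    using holomorphic_on_imp_continuous_on[OF hW] KU' continuous_on_subset by blast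
  \<comment> \<open>Approximating \<open>cnj W / z\<close> instead of \<open>cnj W\<close> and
    multiplying back by \<open>z\<close> produces a \<open>p\<close> with \<open>p 0 = 0\<close>, as
    membership in \<open>Hinf0\<close> requires.\<close>
  have "disc_approx K (\<lambda>z. cnj (W z) / z)"
    by (rule disc_approx_continuous[OF Kc Ks \<zeta>2K]) (use Ks in \<open>auto intro!: continuous_intros contW\<close>)
  then obtain q where q: "q holomorphic_on ball 0 2" "\<And>z. z \<in> K \<Longrightarrow> cmod (cnj (W z) / z - q z) < 1/2"
    unfolding disc_approx_def by (meson half_gt_zero zero_less_one)
  define p where "p z = z * q z" for z
  have hp: "p holomorphic_on ball 0 2" unfolding p_def by (intro holomorphic_intros q)
  have ReWp: "Re (W z * p z) > 1/4" if z: "z \<in> K" for z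
  proof -
    have nz: "cmod z = 1" "z \<noteq> 0" using z Ks by auto
    have "cnj (W z) - p z = z * (cnj (W z) / z - q z)" using nz by (simp add: p_def algebra_simps)
    then have lt: "cmod (cnj (W z) - p z) < 1/2" using q(2)[OF z] nz by (simp add: norm_mult)
    have "W z * p z = W z * cnj (W z) - W z * (cnj (W z) - p z)" by (simp add: algebra_simps)
    moreover have "W z * cnj (W z) = 1" using W1[OF z] complex_norm_square[of "W z"] by simp
    ultimately have "Re (W z * p z) = 1 - Re (W z * (cnj (W z) - p z))" by simp
    moreover have "Re (W z * (cnj (W z) - p z)) \<le> cmod (cnj (W z) - p z)"
      using complex_Re_le_cmod[of "W z * (cnj (W z) - p z)"] W1[OF z] by (simp add: norm_mult)
    ultimately show ?thesis using lt by linarith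
  qed
  have cWp: "continuous_on U' (\<lambda>z. W z * p z)"
    by (intro continuous_intros holomorphic_on_imp_continuous_on[OF hW]
        continuous_on_subset[OF holomorphic_on_imp_continuous_on[OF hp]]) (auto simp: U'_def)
  \<comment> \<open>The bound on \<open>K\<close> spreads to an open neighbourhood, since
    \<open>W p\<close> is continuous across the circle there. On \<open>V\<close> the perturbation
    gains; outside \<open>V\<close> the modulus \<open>h\<close> leaves slack.\<close>
  define V where "V = {z\<in>U'. Re (W z * p z) > 1/4}"
  have oV: "open V"
  proof -
    have "open (U' \<inter> (\<lambda>z. Re (W z * p z)) -` {1/4<..})"
      by (rule continuous_open_preimage[OF continuous_on_Re[OF cWp] oU' open_greaterThan])
    moreover have "U' \<inter> (\<lambda>z. Re (W z * p z)) -` {1/4<..} = V" by (auto simp: V_def)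
    ultimately show ?thesis by simp
  qed
  have KV: "K \<subseteq> V" using KU' ReWp by (auto simp: V_def)
  \<comment> \<open>The rest of the circle is compact and misses \<open>K\<close>, so
    \<open>h\<close> has a maximum strictly below \<open>M\<close> on it, unless that rest is
    empty.\<close>
  obtain \<eta> where \<eta>: "\<eta> > 0" "\<And>\<zeta>. \<zeta> \<in> sphere 0 1 - V \<Longrightarrow> h \<zeta> \<le> M - \<eta>"
  proof (cases "sphere 0 1 - V = {}")
    case True
    then show thesis by (intro that[of 1]) auto
  next
    case False
    have "compact (sphere 0 1 - V)" using oV by (intro compact_diff) auto
    then have "\<exists>x\<in>sphere 0 1 - V. \<forall>y\<in>sphere 0 1 - V. h y \<le> h x"
      by (rule continuous_attains_sup[OF _ False continuous_on_subset[OF h Diff_subset]])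
    then obtain x where x: "x \<in> sphere 0 1 - V" "\<And>y. y \<in> sphere 0 1 - V \<Longrightarrow> h y \<le> h x" by blast
    have "x \<notin> K" using x(1) KV by blast
    then have "h x < M" using x(1) by (simp add: K_def)
    then show thesis using that[of "M - h x"] x(2) by simp
  qed
  define F where "F z = \<Psi> z * p z" for z
  have pH: "p \<in> Hinf"
  proof -
    have "compact (p ` cball 0 1)"
      by (intro compact_continuous_image continuous_on_subset[OF holomorphic_on_imp_continuous_on[OF hp]]) auto
    then have "bounded (p ` ball 0 1)" by (rule bounded_subset[OF compact_imp_bounded]) auto
    then show ?thesis unfolding Hinf_def using holomorphic_on_subset[OF hp subset_ball[of 1 2 0]] by simp
  qed
  have FH: "F \<in> Hinf" unfolding F_def by (rule Hinf_mult[OF \<Psi>H pH])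
  obtain C0 where C0: "C0 \<ge> 0" "AE \<zeta> in circle_meas. cmod (bdry F \<zeta>) \<le> C0" by (rule Hinf_bdry_bounded[OF FH])
  define C where "C = C0 + 1"
  have C: "C \<ge> 1" "AE \<zeta> in circle_meas. cmod (bdry F \<zeta>) \<le> C"
    using C0 by (auto simp: C_def elim!: eventually_mono)
  have prod: "AE \<zeta> in circle_meas. \<zeta> \<in> V \<longrightarrow> Re (bdry \<phi> \<zeta> * bdry F \<zeta>) > 1/4"
    using bdry_mult[OF \<phi> FH] AE_circle_meas_norm
  proof eventually_elim
    case (elim \<zeta>)
    show ?case
    proof
      assume \<zeta>V: "\<zeta> \<in> V"
      then have \<zeta>U: "\<zeta> \<in> U'" by (simp add: V_def)
      \<comment> \<open>Inside the disc \<open>\<phi> F = W p\<close>, and the right-hand side is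
        continuous at \<open>\<zeta>\<close>; this turns a bound on \<open>W p\<close> into one on
        the radial limit of \<open>\<phi> F\<close>.\<close>
      have "isCont (\<lambda>z. W z * p z) \<zeta>" using cWp \<zeta>U oU' by (simp add: continuous_on_eq_continuous_at)
      moreover have "((\<lambda>r::real. of_real r * \<zeta>) \<longlongrightarrow> \<zeta>) (at_left 1)"
        using filterlim_radius[OF elim(2)] by (simp add: filterlim_at)
      ultimately have lim: "((\<lambda>r::real. W (of_real r * \<zeta>) * p (of_real r * \<zeta>)) \<longlongrightarrow> W \<zeta> * p \<zeta>) (at_left 1)"
        by (rule isCont_tendsto_compose)
      have "eventually (\<lambda>r::real. W (of_real r * \<zeta>) * p (of_real r * \<zeta>) = \<phi> (of_real r * \<zeta>) * F (of_real r * \<zeta>)) (at_left 1)"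
        using eventually_radius[OF elim(2)]
        by eventually_elim (use W\<phi> in \<open>simp add: F_def mult.assoc[symmetric]\<close>)
      then have "((\<lambda>r::real. \<phi> (of_real r * \<zeta>) * F (of_real r * \<zeta>)) \<longlongrightarrow> W \<zeta> * p \<zeta>) (at_left 1)"
        by (rule Lim_transform_eventually[OF lim])
      then have "bdry (\<lambda>z. \<phi> z * F z) \<zeta> = W \<zeta> * p \<zeta>" by (rule bdry_eqI)
      then show "Re (bdry \<phi> \<zeta> * bdry F \<zeta>) > 1/4" using elim(1) \<zeta>V by (simp add: V_def)
    qed
  qed
  \<comment> \<open>On \<open>V\<close> the cross term gains at least
    \<open>2 \<epsilon> / 4\<close> and the quadratic term costs at most
    \<open>\<epsilon>^2 C^2 \<le> \<epsilon> / 4\<close>, a net gain of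
    \<open>\<epsilon> / 4\<close> in the square. Off \<open>V\<close> the perturbation has size at
    most \<open>\<epsilon> C \<le> \<eta> / 2\<close>, half of the slack.\<close>
  define \<epsilon> where "\<epsilon> = min (\<eta> / (2 * C)) (1 / (4 * C\<^sup>2))"
  have \<epsilon>: "\<epsilon> > 0" "\<epsilon> * C \<le> \<eta> / 2" "\<epsilon> * C\<^sup>2 \<le> 1/4"
  proof -
    have C2: "C\<^sup>2 > 0" using C(1) by simp
    show "\<epsilon> > 0" using \<eta> C(1) C2 by (simp add: \<epsilon>_def)
    have "\<epsilon> * C \<le> \<eta> / (2 * C) * C" using C(1) by (intro mult_right_mono) (auto simp: \<epsilon>_def)
    then show "\<epsilon> * C \<le> \<eta> / 2" using C(1) by simp
    have "\<epsilon> * C\<^sup>2 \<le> 1 / (4 * C\<^sup>2) * C\<^sup>2" using C2 by (intro mult_right_mono) (auto simp: \<epsilon>_def)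
    then show "\<epsilon> * C\<^sup>2 \<le> 1/4" using C2 by simp
  qed
  define f where "f z = of_real \<epsilon> * F z" for z
  have "(\<lambda>_. complex_of_real \<epsilon>) \<in> Hinf" by (auto simp: Hinf_def bounded_iff)
  then have fH: "f \<in> Hinf0" unfolding Hinf0_def f_def using Hinf_mult[OF _ FH] by (simp add: F_def p_def)
  have bf: "AE \<zeta> in circle_meas. bdry f \<zeta> = of_real \<epsilon> * bdry F \<zeta>"
    using Hinf_radial_limit[OF FH] unfolding f_def by eventually_elim (rule bdry_eqI, rule tendsto_mult_left)
  define C' where "C' = max (sqrt (M\<^sup>2 - \<epsilon> / 4)) (M - \<eta> / 2)"
  have "sqrt (M\<^sup>2 - \<epsilon> / 4) < M" using \<epsilon>(1) M0 by (intro real_less_lsqrt) auto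
  then have C'M: "C' < M" using \<eta>(1) by (simp add: C'_def)
  have le: "AE \<zeta> in circle_meas. cmod (bdry \<phi> \<zeta> - cnj (bdry f \<zeta>)) \<le> C'"
    using bh bf C(2) prod AE_circle_meas_sphere
  proof eventually_elim
    case (elim \<zeta>)
    have hM: "h \<zeta> \<le> M" using \<zeta>1(2)[OF elim(5)] by (simp add: M_def)
    have e0: "cmod (of_real \<epsilon>) = \<epsilon>" using \<epsilon> by simp
    show ?case
    proof (cases "\<zeta> \<in> V")
      case True
      have "(cmod (bdry \<phi> \<zeta> - cnj (bdry f \<zeta>)))\<^sup>2 =
          (cmod (bdry \<phi> \<zeta>))\<^sup>2 - 2 * \<epsilon> * Re (bdry \<phi> \<zeta> * bdry F \<zeta>) + \<epsilon>\<^sup>2 * (cmod (bdry F \<zeta>))\<^sup>2"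
        unfolding elim(2) cmod_power2 by (simp add: power2_eq_square algebra_simps)
      moreover have "(cmod (bdry \<phi> \<zeta>))\<^sup>2 \<le> M\<^sup>2" using hM by (intro power_mono) (simp_all only: elim(1)[symmetric] norm_ge_zero)
      moreover have "\<epsilon>\<^sup>2 * (cmod (bdry F \<zeta>))\<^sup>2 \<le> \<epsilon>\<^sup>2 * C\<^sup>2"
        using elim(3) by (intro mult_left_mono power_mono) auto
      moreover have "\<epsilon>\<^sup>2 * C\<^sup>2 \<le> \<epsilon> * (1/4)"
        using mult_left_mono[OF \<epsilon>(3), of \<epsilon>] \<epsilon>(1) by (simp add: power2_eq_square mult.assoc)
      moreover have "2 * \<epsilon> * (1/4) \<le> 2 * \<epsilon> * Re (bdry \<phi> \<zeta> * bdry F \<zeta>)"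
        using elim(4) True \<epsilon>(1) by (intro mult_left_mono) auto
      ultimately have "(cmod (bdry \<phi> \<zeta> - cnj (bdry f \<zeta>)))\<^sup>2 \<le> M\<^sup>2 - \<epsilon> / 4" by linarith
      then have "cmod (bdry \<phi> \<zeta> - cnj (bdry f \<zeta>)) \<le> sqrt (M\<^sup>2 - \<epsilon> / 4)" by (rule real_le_rsqrt)
      then show ?thesis by (simp add: C'_def)
    next
      case False
      have "cmod (bdry \<phi> \<zeta> - cnj (bdry f \<zeta>)) \<le> cmod (bdry \<phi> \<zeta>) + cmod (bdry f \<zeta>)"
        using norm_triangle_ineq4[of "bdry \<phi> \<zeta>" "cnj (bdry f \<zeta>)"] by simp
      moreover have "cmod (bdry \<phi> \<zeta>) \<le> M - \<eta>" using \<eta>(2)[of \<zeta>] elim(1,5) False by simp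
      moreover have "cmod (bdry f \<zeta>) \<le> \<epsilon> * C"
        unfolding elim(2) norm_mult e0 using elim(3) \<epsilon>(1) by (intro mult_left_mono) auto
      ultimately have "cmod (bdry \<phi> \<zeta> - cnj (bdry f \<zeta>)) \<le> M - \<eta> / 2" using \<epsilon>(2) by linarith
      then show ?thesis by (simp add: C'_def)
    qed
  qed
  \<comment> \<open>A negative bound on a modulus almost everywhere is impossible because the
    measure is not zero; \<open>linf_le\<close> asks for this sign.\<close>
  have C'0: "C' \<ge> 0"
  proof (rule ccontr)
    assume "\<not> C' \<ge> 0"
    from le have "AE \<zeta> in circle_meas. False"
    proof eventually_elim
      case (elim \<zeta>)
      then show ?case using \<open>\<not> C' \<ge> 0\<close> norm_ge_zero[of "bdry \<phi> \<zeta> - cnj (bdry f \<zeta>)"] by linarith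
    qed
    then show False by simp
  qed
  have "linf (bdry \<phi>) = M" unfolding M_def by (rule linf_eq_max[OF h bh \<zeta>1]) (use pos in auto)
  then have "linf (\<lambda>\<zeta>. bdry \<phi> \<zeta> - cnj (bdry f \<zeta>)) < linf (bdry \<phi>)" using linf_le[OF C'0 le] C'M by simp
  then show ?thesis unfolding saturated_iff[OF \<phi>] using fH by (auto simp: not_le)
qed

text \<open>\<open>\<Phi>\<close> is given by its values in the disc, so its super-level set is
  expressed through \<open>h\<close>, the continuous representative of the common boundary modulus
  of \<open>\<phi>\<close> and \<open>\<Phi>\<close>. With \<open>linf\<close> identified as the
  maximum of \<open>h\<close>, that set is the maximum set \<open>K\<close>.\<close>

theorem theorem3:
  fixes \<phi> \<Phi> I :: "complex \<Rightarrow> complex" and h :: "complex \<Rightarrow> real"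
  assumes "\<phi> \<in> Hinf"
    and "inner I" and "outer \<Phi>"
    and "\<forall>z\<in>ball 0 1. \<phi> z = \<Phi> z * I z"
    and "continuous_on (sphere 0 1) h"
    and "AE \<zeta> in circle_meas. cmod (bdry \<phi> \<zeta>) = h \<zeta>"
    and "\<not> (\<exists>c. \<forall>\<zeta>\<in>sphere 0 1. h \<zeta> = c)"
  shows "saturated \<phi> \<longleftrightarrow> superlevel (\<lambda>\<zeta>. of_real (h \<zeta>)) 1 \<inter> inner_spectrum I \<noteq> {}"
proof -
  \<comment> \<open>\<open>h\<close> is a modulus only almost everywhere; continuity extends the
    sign to every point of the circle.\<close>
  have h0: "h \<zeta> \<ge> 0" if "\<zeta> \<in> sphere 0 1" for \<zeta>
  proof -
    have "AE \<zeta> in circle_meas. - h \<zeta> \<le> 0"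
      using assms(6)
    proof eventually_elim
      case (elim \<zeta>)
      then show ?case using norm_ge_zero[of "bdry \<phi> \<zeta>"] by linarith
    qed
    then show ?thesis using circle_AE_le_imp_le[of "\<lambda>\<zeta>. - h \<zeta>" 0 \<zeta>] assms(5) that by (auto intro: continuous_intros)
  qed
  obtain \<zeta>1 where \<zeta>1: "\<zeta>1 \<in> sphere 0 1" "\<And>\<zeta>. \<zeta> \<in> sphere 0 1 \<Longrightarrow> h \<zeta> \<le> h \<zeta>1"
    using continuous_attains_sup[OF compact_sphere _ assms(5)] by auto
  \<comment> \<open>Non-constancy serves twice: \<open>\<zeta>2\<close> is a point of the circle
    outside the maximum set, and together with \<open>h \<ge> 0\<close> it makes the maximum
    positive.\<close>
  obtain \<zeta>2 where \<zeta>2: "\<zeta>2 \<in> sphere 0 1" "h \<zeta>2 \<noteq> h \<zeta>1" using assms(7) by blast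
  have lt: "h \<zeta>2 < h \<zeta>1" using \<zeta>2 \<zeta>1(2)[of \<zeta>2] by simp
  then have pos: "h \<zeta>1 > 0" using h0[OF \<zeta>2(1)] by linarith
  have "AE \<zeta> in circle_meas. cmod (complex_of_real (h \<zeta>)) = h \<zeta>"
    using AE_circle_meas_sphere by eventually_elim (use h0 in auto)
  then have "linf (\<lambda>\<zeta>. of_real (h \<zeta>)) = h \<zeta>1"
    by (rule linf_eq_max[OF assms(5) _ \<zeta>1]) (use pos in auto)
  then have sup: "superlevel (\<lambda>\<zeta>. of_real (h \<zeta>)) 1 = {\<zeta>\<in>sphere 0 1. h \<zeta>1 \<le> h \<zeta>}"
    unfolding superlevel_def using h0 by auto
  show ?thesis
  proof
    assume "saturated \<phi>"
    then show "superlevel (\<lambda>\<zeta>. of_real (h \<zeta>)) 1 \<inter> inner_spectrum I \<noteq> {}"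
      using not_saturated_if_max_off_spectrum[OF assms(1-6) \<zeta>1 pos \<zeta>2(1) lt] unfolding sup by blast
  next
    assume "superlevel (\<lambda>\<zeta>. of_real (h \<zeta>)) 1 \<inter> inner_spectrum I \<noteq> {}"
    then obtain \<zeta>0 where \<zeta>0: "\<zeta>0 \<in> sphere 0 1" "h \<zeta>1 \<le> h \<zeta>0" "\<zeta>0 \<in> inner_spectrum I" unfolding sup by blast
    show "saturated \<phi>"
      by (rule saturated_if_max_on_spectrum[OF assms(1-6) \<zeta>0(1,3)]) (use \<zeta>0(2) \<zeta>1(2) pos in force)+
  qed
qed

end
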